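(* Let $\Gamma$ be a tetravalent graph of girth $5$. Then there exists a subgroup $G\le \mathrm{Aut}(\Gamma)$ which is half-arc-transitive on $\Gamma$ and relative to which $\Gamma$ is $G$-tightly-attached if and only if one of the following holds: (1) $\Gamma\cong\mathcal{X}_o(3,9;4)$ (the Doyle-Holt graph); (2) $\Gamma\cong\mathcal{X}_o(5,r;q)$ for some odd $r\ge3$ and $q\in\mathbb{Z}_r$ with $q\neq\pm1$ and $1+q+q^2+q^3+q^4=0$. Moreover, all such graphs $\Gamma$ are half-arc-transitive (i.e. $\mathrm{Aut}(\Gamma)$ itself is half-arc-transitive on $\Gamma$). Furthermore, the only tetravalent graph of girth $5$ admitting a half-arc-transitive group $G$ of automorphisms relative to which it is $G$-tightly-attached and has undirected $5$-cycles (with respect to a $G$-induced orientation) is the Doyle-Holt graph.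
   Context: Graphs are finite, simple, connected. A subgroup $G\le\mathrm{Aut}(\Gamma)$ is half-arc-transitive on $\Gamma$ if it is transitive on vertices and on edges but not on arcs (ordered pairs of adjacent vertices). Then $G$ has two orbits on arcs, each containing exactly one of $(u,v),(v,u)$ for each edge; each orbit is a $G$-induced orientation $\vec\Gamma$. For tetravalent $\Gamma$, a $G$-alternating cycle is a cycle of $\Gamma$ in which every two consecutive edges have opposite orientations in $\vec\Gamma$. All $G$-alternating cycles have the same even length $2r_G$ ($r_G$ is the $G$-radius) and any two $G$-alternating cycles sharing a vertex share the same number of vertices (the $G$-attachment number). $\Gamma$ is $G$-tightly-attached if the $G$-attachment number equals the $G$-radius. A $5$-cycle $C$ is directed with respect to $\vec\Gamma$ if each vertex of $C$ is the head of one and the tail of the other of the arcs of $\vec\Gamma$ on the two edges of $C$ at it; otherwise undirected. For integers $m\ge3$, odd $r\ge3$, and $q\in\mathbb{Z}_r$ with $q^m=\pm1$, $\mathcal{X}_o(m,r;q)$ is the graph with vertex set $\{u_i^j: i\in\mathbb{Z}_m, j\in\mathbb{Z}_r\}$ and edges $u_i^j\sim u_{i+1}^{j\pm q^i}$ (subscripts mod $m$, superscripts mod $r$). *)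

theory Defs
  imports
    "HOL-Algebra.Bij"
    "HOL-Number_Theory.Cong"
    "HOL-Library.Extended_Nat"
    "Graph_Theory.Graph_Theory"
begin

text \<open>
  A finite simple graph is a \<^locale>\<open>pair_graph\<close>: an edge \<open>{u, v}\<close> is represented by the two arcs
  \<open>(u, v)\<close> and \<open>(v, u)\<close>, so that \<^const>\<open>parcs\<close> is exactly the set of arcs in the sense of
  ordered pairs of adjacent vertices.
\<close>

definition tetravalent :: "'a pair_pre_digraph \<Rightarrow> bool" where
  "tetravalent \<Gamma> \<longleftrightarrow> (\<forall>v \<in> pverts \<Gamma>. out_degree (with_proj \<Gamma>) v = 4)"

text \<open>
  A cycle is given by the list of arcs of one of its traversals. The library notion of cycle also
  admits the closed walks \<open>u, v, u\<close> of length 2, which are not cycles of an undirected graph.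
\<close>

definition graph_cycle :: "'a pair_pre_digraph \<Rightarrow> ('a \<times> 'a) awalk \<Rightarrow> bool" where
  "graph_cycle \<Gamma> p \<longleftrightarrow> pre_digraph.cycle (with_proj \<Gamma>) p \<and> 3 \<le> length p"

definition cycle_verts :: "('a \<times> 'a) awalk \<Rightarrow> 'a set" where
  "cycle_verts p = fst ` set p"

definition cycle_edges :: "('a \<times> 'a) awalk \<Rightarrow> 'a set set" where
  "cycle_edges p = (\<lambda>(u, v). {u, v}) ` set p"

definition girth :: "'a pair_pre_digraph \<Rightarrow> enat" where
  "girth \<Gamma> = (INF p \<in> {p. graph_cycle \<Gamma> p}. enat (length p))"

definition graph_auto :: "'a pair_pre_digraph \<Rightarrow> ('a \<Rightarrow> 'a) set" where
  "graph_auto \<Gamma> = {f \<in> Bij (pverts \<Gamma>).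
     \<forall>u \<in> pverts \<Gamma>. \<forall>v \<in> pverts \<Gamma>. (f u, f v) \<in> parcs \<Gamma> \<longleftrightarrow> (u, v) \<in> parcs \<Gamma>}"

definition Aut :: "'a pair_pre_digraph \<Rightarrow> ('a \<Rightarrow> 'a) monoid" where
  "Aut \<Gamma> = BijGroup (pverts \<Gamma>) \<lparr>carrier := graph_auto \<Gamma>\<rparr>"

definition transitive_on :: "('a \<Rightarrow> 'a) set \<Rightarrow> (('a \<Rightarrow> 'a) \<Rightarrow> 'b \<Rightarrow> 'b) \<Rightarrow> 'b set \<Rightarrow> bool" where
  "transitive_on G act X \<longleftrightarrow> (\<forall>x \<in> X. \<forall>y \<in> X. \<exists>g \<in> G. act g x = y)"

definition edges :: "'a pair_pre_digraph \<Rightarrow> 'a set set" where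
  "edges \<Gamma> = (\<lambda>(u, v). {u, v}) ` parcs \<Gamma>"

definition half_arc_transitive :: "'a pair_pre_digraph \<Rightarrow> ('a \<Rightarrow> 'a) set \<Rightarrow> bool" where
  "half_arc_transitive \<Gamma> G \<longleftrightarrow>
     subgroup G (Aut \<Gamma>) \<and>
     transitive_on G (\<lambda>g. g) (pverts \<Gamma>) \<and>
     transitive_on G (\<lambda>g. image g) (edges \<Gamma>) \<and>
     \<not> transitive_on G (\<lambda>g. map_prod g g) (parcs \<Gamma>)"

text \<open>
  The orbits of \<open>G\<close> on arcs. If \<open>G\<close> is half-arc-transitive there are two of them, converse to each
  other, and an arc \<open>(u, v)\<close> of such an orbit has tail \<open>u\<close> and head \<open>v\<close>.
\<close>

definition induced_orientations :: "'a pair_pre_digraph \<Rightarrow> ('a \<Rightarrow> 'a) set \<Rightarrow> 'a rel set" where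
  "induced_orientations \<Gamma> G = {{map_prod g g a | g. g \<in> G} | a. a \<in> parcs \<Gamma>}"

text \<open>
  In the next two definitions \<open>p ! i\<close> and \<open>p ! (Suc i mod length p)\<close> are consecutive arcs
  \<open>(u, v)\<close> and \<open>(v, w)\<close> of a traversal. The cycle alternates at \<open>v\<close> if \<open>v\<close> is the head of both or
  the tail of both arcs of the orientation \<open>D\<close> on these two edges; it is directed at \<open>v\<close> if \<open>v\<close> is
  the head of one and the tail of the other.
\<close>

definition alternating_wrt :: "'a rel \<Rightarrow> ('a \<times> 'a) awalk \<Rightarrow> bool" where
  "alternating_wrt D p \<longleftrightarrow> (\<forall>i < length p.
     let e = p ! i; e' = p ! (Suc i mod length p)
     in (e \<in> D \<and> prod.swap e' \<in> D) \<or> (prod.swap e \<in> D \<and> e' \<in> D))"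

definition directed_wrt :: "'a rel \<Rightarrow> ('a \<times> 'a) awalk \<Rightarrow> bool" where
  "directed_wrt D p \<longleftrightarrow> (\<forall>i < length p.
     let e = p ! i; e' = p ! (Suc i mod length p)
     in (e \<in> D \<and> e' \<in> D) \<or> (prod.swap e \<in> D \<and> prod.swap e' \<in> D))"

text \<open>Replacing \<open>D\<close> by its converse does not change which cycles are alternating.\<close>

definition alternating_cycle ::
  "'a pair_pre_digraph \<Rightarrow> ('a \<Rightarrow> 'a) set \<Rightarrow> ('a \<times> 'a) awalk \<Rightarrow> bool" where
  "alternating_cycle \<Gamma> G p \<longleftrightarrow>
     graph_cycle \<Gamma> p \<and> (\<exists>D \<in> induced_orientations \<Gamma> G. alternating_wrt D p)"

text \<open>
  For a half-arc-transitive \<open>G\<close> on a connected tetravalent graph the following two numbers are well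
  defined: the alternating cycles have a common even length, and any two distinct ones that meet
  have the same number of common vertices. Cycles are distinguished by their edge sets, since the
  same cycle has several traversals, while two different alternating cycles may have the same
  vertices.
\<close>

definition G_radius :: "'a pair_pre_digraph \<Rightarrow> ('a \<Rightarrow> 'a) set \<Rightarrow> nat" where
  "G_radius \<Gamma> G = (THE r. \<exists>p. alternating_cycle \<Gamma> G p \<and> length p = 2 * r)"

definition G_attachment_number :: "'a pair_pre_digraph \<Rightarrow> ('a \<Rightarrow> 'a) set \<Rightarrow> nat" where
  "G_attachment_number \<Gamma> G = (THE a. \<exists>p p'.
     alternating_cycle \<Gamma> G p \<and> alternating_cycle \<Gamma> G p' \<and>
     cycle_edges p \<noteq> cycle_edges p' \<and> cycle_verts p \<inter> cycle_verts p' \<noteq> {} \<and>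
     card (cycle_verts p \<inter> cycle_verts p') = a)"

definition tightly_attached :: "'a pair_pre_digraph \<Rightarrow> ('a \<Rightarrow> 'a) set \<Rightarrow> bool" where
  "tightly_attached \<Gamma> G \<longleftrightarrow> G_attachment_number \<Gamma> G = G_radius \<Gamma> G"

definition has_undirected_5_cycle :: "'a pair_pre_digraph \<Rightarrow> ('a \<Rightarrow> 'a) set \<Rightarrow> bool" where
  "has_undirected_5_cycle \<Gamma> G \<longleftrightarrow>
     (\<exists>D \<in> induced_orientations \<Gamma> G. \<exists>p. graph_cycle \<Gamma> p \<and> length p = 5 \<and> \<not> directed_wrt D p)"

text \<open>
  The vertex \<open>(i, j)\<close> is $u_i^j$; elements of $\mathbb{Z}_m$ and $\mathbb{Z}_r$ are represented by
  their least nonnegative residues. The exponent of \<open>q\<close> is the representative of the subscript, which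
  is immaterial when $q^m = \pm 1$ in $\mathbb{Z}_r$. The graph is meant for \<open>m \<ge> 3\<close>, odd \<open>r \<ge> 3\<close>
  and such \<open>q\<close>.
\<close>

definition Xo_step :: "nat \<Rightarrow> nat \<Rightarrow> int \<Rightarrow> nat \<times> int \<Rightarrow> nat \<times> int \<Rightarrow> bool" where
  "Xo_step m r q = (\<lambda>(i, j) (i', j'). i' = Suc i mod m \<and>
     ([j' = j + q ^ i] (mod int r) \<or> [j' = j - q ^ i] (mod int r)))"

definition Xo :: "nat \<Rightarrow> nat \<Rightarrow> int \<Rightarrow> (nat \<times> int) pair_pre_digraph" where
  "Xo m r q = (let V = {0..<m} \<times> {0..<int r}
     in \<lparr>pverts = V, parcs = {(x, y) \<in> V \<times> V. Xo_step m r q x y \<or> Xo_step m r q y x}\<rparr>)"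

abbreviation graph_iso :: "'a pair_pre_digraph \<Rightarrow> 'b pair_pre_digraph \<Rightarrow> bool" where
  "graph_iso \<Gamma> \<Delta> \<equiv> digraph_iso (with_proj \<Gamma>) (with_proj \<Delta>)"

abbreviation Doyle_Holt :: "(nat \<times> int) pair_pre_digraph" where
  "Doyle_Holt \<equiv> Xo 3 9 4"

end

theory Submission
  imports Defs
begin

text \<open>
  The tails and the heads of an alternating cycle are the values of two sequences \<open>t\<close> and \<open>h\<close>. Tight
  attachment says that the heads of one alternating cycle are the tails of the next, so the vertices
  fall into cyclically arranged layers, and the stabiliser of one layer preserves all of them and acts
  on each as a dihedral group. A generating rotation \<open>R\<close> of one layer rotates all of them. If \<open>\<Gamma>\<close> is not bipartite then \<open>r\<close> is
  odd, a reflection of one layer fixes exactly one vertex of each layer, and the powers of \<open>R\<close> together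
  with an element \<open>\<sigma>\<close> of \<open>G\<close> that maps one layer to the next yield the coordinates of
  $\mathcal{X}_o(m,r;q)$.

  Every step of a walk moves by one layer, so a 5-cycle forces \<open>m = 3\<close> or \<open>m = 5\<close>. A closed walk is a
  congruence modulo \<open>r\<close> between signed powers of \<open>q\<close>; those given by the 5-cycles, in the absence of
  4-cycles, leave only $\mathcal{X}_o(3,9;4)$ or $1+q+q^2+q^3+q^4=0$.

  Conversely, in these graphs the 5-cycles tell the 2-paths with two equal signs from the others, so an
  automorphism permutes the lines of constant sign. Its effect on the closed walks of length 5
  (for \<open>m = 3\<close>) or 8 (for \<open>m = 5\<close>) shows that it keeps the direction of every line. Hence the full
  automorphism group preserves the orientation from each layer to the next.
\<close>

section \<open>Alternating cycles of an orientation\<close>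

text \<open>An element of \<open>G\<close> is determined by its action on one layer: with radius at
  least 3 the tails and the heads of an alternating cycle, taken in order, determine each other, and
  the graph is connected. So identities between group elements are checked on one layer only. The
  difficulty is a base point in every layer: the images of a vertex under the powers of
  \<open>\<sigma>\<close> could come back to the first layer at a different vertex, and the
  coordinates would not close up. Fixed points of a reflection \<open>\<tau>\<close> are canonical,
  and \<open>\<sigma>\<close> commutes with \<open>\<tau>\<close> once it maps one fixed point to
  another. For odd \<open>r\<close> the basic rotation also has a square root \<open>R\<close>,
  which puts the two out-neighbours of the base points at symmetric places. For five layers every
  5-cycle is one line run through in one direction, so 5-cycles cannot compare the directions of
  different lines. This takes a closed walk that changes lines, and the one of length 8 closes for
  every \<open>q\<close>. In the Doyle-Holt graph the 5-cycles themselves change lines.\<close>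

lemma int_subgroup_eq_multiples:
  fixes X :: "int set"
  assumes diff: "\<And>x y. x \<in> X \<Longrightarrow> y \<in> X \<Longrightarrow> x - y \<in> X" and ex: "\<exists>k>0. k \<in> X"
  shows "\<exists>d>0. d \<in> X \<and> X = {n. d dvd n}"
proof -
  define k where "k = (LEAST k::nat. k > 0 \<and> int k \<in> X)"
  have "\<exists>k::nat. k > 0 \<and> int k \<in> X" using ex by (metis zero_less_imp_eq_int)
  then have k: "k > 0" "int k \<in> X" unfolding k_def by (metis (mono_tags, lifting) LeastI_ex)+
  have zero: "0 \<in> X" using diff[OF k(2) k(2)] by simp
  have neg: "- x \<in> X" if "x \<in> X" for x using diff[OF zero that] by simp
  have add: "x + y \<in> X" if "x \<in> X" "y \<in> X" for x y using diff[OF that(1) neg[OF that(2)]] by simp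
  have mult: "int k * int n \<in> X" for n
  proof (induction n)
    case (Suc n)
    have "int k * int (Suc n) = int k + int k * int n" by (simp add: algebra_simps)
    then show ?case using add[OF k(2) Suc] by simp
  qed (use zero in simp)
  have multi: "int k * z \<in> X" for z
    using mult[of "nat z"] neg[OF mult[of "nat (- z)"]] by (cases "z \<ge> 0") auto
  have "int k dvd n" if "n \<in> X" for n
  proof -
    have "n mod int k = n - int k * (n div int k)" by (simp add: minus_mult_div_eq_mod)
    then have "n mod int k \<in> X" using diff[OF that multi] by simp
    moreover have "0 \<le> n mod int k" "n mod int k < int k" using k by auto
    ultimately have "\<not> nat (n mod int k) > 0"
      using not_less_Least[of "nat (n mod int k)" "\<lambda>k. k > 0 \<and> int k \<in> X"]
      unfolding k_def[symmetric] by auto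
    then show ?thesis using \<open>0 \<le> n mod int k\<close> by (simp add: dvd_eq_mod_eq_0)
  qed
  then show ?thesis using k multi by (intro exI[of _ "int k"]) (auto elim!: dvdE)
qed

text \<open>Serves the count in \<open>tight_imp_range_eq\<close>, where the common vertices of two
  alternating cycles sit at indices that form residue classes modulo \<open>d\<close>.\<close>

lemma card_residue_class:
  fixes d a :: int
  assumes "d > 0" "d dvd int m"
  shows "int (card {n \<in> {0..<int m}. d dvd n - a}) * d = int m"
proof -
  obtain c where c: "int m = d * c" using assms(2) by (elim dvdE)
  have c0: "c \<ge> 0" using c assms(1) by (metis of_nat_0_le_iff zero_le_mult_iff not_less)
  define b where "b = a mod d"
  have b: "0 \<le> b" "b < d" "d dvd n - a \<longleftrightarrow> d dvd n - b" for n
    using assms(1) by (auto simp: b_def mod_eq_dvd_iff[symmetric])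
  have "bij_betw (\<lambda>k. b + d * k) {0..<c} {n \<in> {0..<int m}. d dvd n - a}"
  proof (rule bij_betwI')
    fix x y show "(b + d * x = b + d * y) = (x = y)" using assms(1) by simp
  next
    fix x assume x: "x \<in> {0..<c}"
    then have "b + d * x < d * (x + 1)" using b by (simp add: algebra_simps)
    also have "\<dots> \<le> d * c" using x assms(1) by (intro mult_left_mono) auto
    finally show "b + d * x \<in> {n \<in> {0..<int m}. d dvd n - a}" using b x assms(1) c by auto
  next
    fix n assume n: "n \<in> {n \<in> {0..<int m}. d dvd n - a}"
    then obtain k where k: "n = b + d * k" using b(3)[of n] by (metis (mono_tags, lifting) add.commute diff_add_cancel dvdE mem_Collect_eq)
    have "d * k > d * (-1)" using n b k by auto
    then have "k > -1" using assms(1) by (metis mult_less_cancel_left_pos)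
    moreover have "n < d * c" using n c by simp
    then have "d * k < d * c" using b k by linarith
    then have "k < c" using assms(1) by (simp add: mult_less_cancel_left_pos)
    ultimately show "\<exists>k\<in>{0..<c}. n = b + d * k" using k by auto
  qed
  from bij_betw_same_card[OF this] have "card {n \<in> {0..<int m}. d dvd n - a} = nat c" by simp
  then show ?thesis using c c0 by simp
qed

text \<open>One arc orbit \<open>D\<close> together with the group that preserves it. The group laws
  are stated pointwise on \<open>V\<close>, so values outside \<open>V\<close> never enter.
  \<open>D_induct\<close> is connectedness, phrased as an induction rule for properties that spread
  along arcs in both directions.\<close>

locale half_transitive =
  fixes V :: "'a set" and D :: "'a rel" and G :: "('a \<Rightarrow> 'a) set"
  assumes finite_V: "finite V"
    and D_verts: "(u, v) \<in> D \<Longrightarrow> u \<in> V \<and> v \<in> V"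
    and out2: "v \<in> V \<Longrightarrow> card {w. (v, w) \<in> D} = 2"
    and in2: "v \<in> V \<Longrightarrow> card {w. (w, v) \<in> D} = 2"
    and asym: "(u, v) \<in> D \<Longrightarrow> (v, u) \<notin> D"
    and G_V: "g \<in> G \<Longrightarrow> v \<in> V \<Longrightarrow> g v \<in> V"
    and G_comp: "g \<in> G \<Longrightarrow> h \<in> G \<Longrightarrow> \<exists>k\<in>G. \<forall>v\<in>V. k v = g (h v)"
    and G_inv: "g \<in> G \<Longrightarrow> \<exists>k\<in>G. \<forall>v\<in>V. k (g v) = v \<and> g (k v) = v"
    and G_D: "g \<in> G \<Longrightarrow> (u, v) \<in> D \<Longrightarrow> (g u, g v) \<in> D"
    and arc_trans: "(u, v) \<in> D \<Longrightarrow> (u', v') \<in> D \<Longrightarrow> \<exists>g\<in>G. g u = u' \<and> g v = v'"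
    and V_trans: "u \<in> V \<Longrightarrow> v \<in> V \<Longrightarrow> \<exists>g\<in>G. g u = v"
    and D_induct: "\<lbrakk>u \<in> V; P u; \<And>x y. P x \<Longrightarrow> (x, y) \<in> D \<Longrightarrow> P y; \<And>x y. P y \<Longrightarrow> (x, y) \<in> D \<Longrightarrow> P x; v \<in> V\<rbrakk> \<Longrightarrow> P v"
    and V_ne: "V \<noteq> {}"
begin

lemma G_inj: "g \<in> G \<Longrightarrow> u \<in> V \<Longrightarrow> v \<in> V \<Longrightarrow> g u = g v \<Longrightarrow> u = v"
  by (metis G_inv)

lemma ex1_other:
  assumes "card S = 2" "x \<in> S" shows "\<exists>!y. y \<in> S \<and> y \<noteq> x"
  using assms by (auto simp: card_2_iff)

definition co_out :: "'a \<Rightarrow> 'a \<Rightarrow> 'a" where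
  "co_out u v = (THE w. (u, w) \<in> D \<and> w \<noteq> v)"

definition co_in :: "'a \<Rightarrow> 'a \<Rightarrow> 'a" where
  "co_in u v = (THE w. (w, v) \<in> D \<and> w \<noteq> u)"

lemma co_out:
  assumes "(u, v) \<in> D"
  shows "(u, co_out u v) \<in> D" "co_out u v \<noteq> v" and co_out_cases: "(u, w) \<in> D \<Longrightarrow> w = v \<or> w = co_out u v"
proof -
  have ex: "\<exists>!w. (u, w) \<in> D \<and> w \<noteq> v" using ex1_other[of "{w. (u, w) \<in> D}" v] out2 D_verts assms by auto
  from theI'[OF this] show "(u, co_out u v) \<in> D" "co_out u v \<noteq> v" by (auto simp: co_out_def)
  then show "(u, w) \<in> D \<Longrightarrow> w = v \<or> w = co_out u v" using ex by auto
qed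

lemma co_in:
  assumes "(u, v) \<in> D"
  shows "(co_in u v, v) \<in> D" "co_in u v \<noteq> u" and co_in_cases: "(w, v) \<in> D \<Longrightarrow> w = u \<or> w = co_in u v"
proof -
  have ex: "\<exists>!w. (w, v) \<in> D \<and> w \<noteq> u" using ex1_other[of "{w. (w, v) \<in> D}" u] in2 D_verts assms by auto
  from theI'[OF this] show "(co_in u v, v) \<in> D" "co_in u v \<noteq> u" by (auto simp: co_in_def)
  then show "(w, v) \<in> D \<Longrightarrow> w = u \<or> w = co_in u v" using ex by auto
qed

lemma out_unique: "(u, v) \<in> D \<Longrightarrow> (u, w) \<in> D \<Longrightarrow> (u, w') \<in> D \<Longrightarrow> w \<noteq> v \<Longrightarrow> w' \<noteq> v \<Longrightarrow> w = w'"
  using co_out_cases by metis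

lemma in_unique: "(v, u) \<in> D \<Longrightarrow> (w, u) \<in> D \<Longrightarrow> (w', u) \<in> D \<Longrightarrow> w \<noteq> v \<Longrightarrow> w' \<noteq> v \<Longrightarrow> w = w'"
  using co_in_cases by metis

text \<open>
  The vertices \<open>t 0, h 0, t 1, h 1, \<dots>\<close> run through an alternating cycle, with tails \<open>t n\<close> and heads \<open>h n\<close>.
\<close>

definition trail :: "(int \<Rightarrow> 'a) \<Rightarrow> (int \<Rightarrow> 'a) \<Rightarrow> bool" where
  "trail t h \<longleftrightarrow> (\<forall>n. (t n, h n) \<in> D \<and> (t (n + 1), h n) \<in> D \<and> t (n + 1) \<noteq> t n \<and> h (n + 1) \<noteq> h n)"

lemma trailD:
  assumes "trail t h"
  shows "(t n, h n) \<in> D" "(t (n + 1), h n) \<in> D" "t (n + 1) \<noteq> t n" "h (n + 1) \<noteq> h n" "t n \<in> V" "h n \<in> V"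
    "(t n, h (n - 1)) \<in> D"
proof -
  show *: "(t n, h n) \<in> D" "(t (n + 1), h n) \<in> D" "t (n + 1) \<noteq> t n" "h (n + 1) \<noteq> h n" for n
    using assms by (auto simp: trail_def)
  show "t n \<in> V" "h n \<in> V" using D_verts[OF *(1)[of n]] by auto
  show "(t n, h (n - 1)) \<in> D" using *(2)[of "n - 1"] by simp
qed

lemma trail_shift:
  assumes "trail t h" shows "trail (\<lambda>n. t (n + k)) (\<lambda>n. h (n + k))"
proof -
  have e: "n + 1 + k = n + k + 1" for n :: int by simp
  show ?thesis using trailD(1-4)[OF assms] by (simp add: trail_def e)
qed

text \<open>The head \<open>h n\<close> lies between the tails \<open>t n\<close> and
  \<open>t (n + 1)\<close>. Reversal takes these places to \<open>k - n\<close> and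
  \<open>k - n - 1\<close>, and the head between them is \<open>h (k - 1 - n)\<close>.\<close>

lemma trail_rev:
  assumes "trail t h" shows "trail (\<lambda>n. t (k - n)) (\<lambda>n. h (k - 1 - n))"
  unfolding trail_def
proof (intro allI conjI)
  fix n
  have e: "k - 1 - n + 1 = k - n" "k - (n + 1) = k - 1 - n" "k - 1 - (n + 1) = k - 2 - n" "k - 2 - n + 1 = k - 1 - n" by auto
  show "(t (k - n), h (k - 1 - n)) \<in> D" using trailD(2)[OF assms, of "k - 1 - n"] by (simp only: e)
  show "(t (k - (n + 1)), h (k - 1 - n)) \<in> D" using trailD(1)[OF assms, of "k - 1 - n"] by (simp only: e)
  show "t (k - (n + 1)) \<noteq> t (k - n)" using trailD(3)[OF assms, of "k - 1 - n"] by (metis e(1,2))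
  show "h (k - 1 - (n + 1)) \<noteq> h (k - 1 - n)" using trailD(4)[OF assms, of "k - 2 - n"] e by metis
qed

lemma trail_image:
  assumes "g \<in> G" "trail t h" shows "trail (\<lambda>n. g (t n)) (\<lambda>n. g (h n))"
  unfolding trail_def using trailD[OF assms(2)] assms(1) G_D G_inj by metis

text \<open>Valency 2 leaves no choice in either direction: the next tail is the other in-neighbour
  of the present head, and the next head is the other out-neighbour of that tail.\<close>

lemma trail_unique:
  assumes "trail t h" "trail t' h'" "t a = t' a" "h a = h' a"
  shows "t n = t' n \<and> h n = h' n"
proof (induction n rule: int_induct[where k = a])
  case base show ?case using assms by simp
next
  case (step1 i)
  have "t (i + 1) = t' (i + 1)"
    using trailD[OF assms(1), of i] trailD[OF assms(2), of i] step1(2) in_unique by metis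
  moreover have "h (i + 1) = h' (i + 1)"
    using trailD(7)[OF assms(1), of "i + 1"] trailD(4)[OF assms(1), of i] trailD(1)[OF assms(1), of "i + 1"]
      trailD(7)[OF assms(2), of "i + 1"] trailD(4)[OF assms(2), of i] trailD(1)[OF assms(2), of "i + 1"]
      step1(2) calculation out_unique by (metis add_diff_cancel_right')
  ultimately show ?case ..
next
  case (step2 i)
  have "h (i - 1) = h' (i - 1)"
    using trailD(7)[OF assms(1), of i] trailD(4)[OF assms(1), of "i - 1"] trailD(1)[OF assms(1), of i]
      trailD(7)[OF assms(2), of i] trailD(4)[OF assms(2), of "i - 1"] trailD(1)[OF assms(2), of i]
      step2(2) out_unique by (metis diff_add_cancel)
  moreover have "t (i - 1) = t' (i - 1)"
    using trailD[OF assms(1), of "i - 1"] trailD[OF assms(2), of "i - 1"] step2(2) calculation in_unique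
    by (metis diff_add_cancel)
  ultimately show ?case by blast
qed

lemma trail_exists:
  assumes "(u, v) \<in> D"
  shows "\<exists>t h. trail t h \<and> t 0 = u \<and> h 0 = v"
proof -
  \<comment> \<open>\<open>fw\<close> moves one arc ahead: to the other tail at the same head, then
    to the other head at that tail. \<open>bw\<close> undoes it, so the iterates give a trail
    indexed by all integers.\<close>
  define fw where "fw = (\<lambda>(u, v). let u' = co_in u v in (u', co_out u' v))"
  define bw where "bw = (\<lambda>(u, v). let v' = co_out u v in (co_in u v', v'))"
  define E where "E = (\<lambda>n::int. if n \<ge> 0 then (fw ^^ nat n) (u, v) else (bw ^^ nat (- n)) (u, v))"
  have fwD: "fw e \<in> D" "fst (fw e) \<noteq> fst e" "snd (fw e) \<noteq> snd e" "(fst (fw e), snd e) \<in> D" if "e \<in> D" for e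
    using that co_in[of "fst e" "snd e"] co_out[of "co_in (fst e) (snd e)" "snd e"]
    by (auto simp: fw_def split_beta Let_def)
  have bwD: "bw e \<in> D" "fst (bw e) \<noteq> fst e" "snd (bw e) \<noteq> snd e" "(fst e, snd (bw e)) \<in> D" if "e \<in> D" for e
    using that co_out[of "fst e" "snd e"] co_in[of "fst e" "co_out (fst e) (snd e)"]
    by (auto simp: bw_def split_beta Let_def)
  have f: "(fw ^^ n) (u, v) \<in> D" for n by (induction n) (use assms fwD in auto)
  have b: "(bw ^^ n) (u, v) \<in> D" for n by (induction n) (use assms bwD in auto)
  have "fst (E n) \<noteq> fst (E (n + 1)) \<and> snd (E n) \<noteq> snd (E (n + 1)) \<and> E n \<in> D \<and> (fst (E (n + 1)), snd (E n)) \<in> D" for n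
  proof (cases "n \<ge> 0")
    case True
    then have "nat (n + 1) = Suc (nat n)" by auto
    then have "E (n + 1) = fw (E n)" "E n \<in> D" using True f by (simp_all add: E_def)
    then show ?thesis using fwD by metis
  next
    case False
    then have "nat (- n) = Suc (nat (- (n + 1)))" by auto
    then have "E n = bw (E (n + 1))" "E (n + 1) \<in> D" using False f[of 0] b[of "nat (- (n + 1))"] by (auto simp: E_def)
    then show ?thesis using bwD by metis
  qed
  then have "trail (\<lambda>n. fst (E n)) (\<lambda>n. snd (E n))" unfolding trail_def by (metis prod.collapse)
  then show ?thesis by (intro exI[of _ "\<lambda>n. fst (E n)"] exI[of _ "\<lambda>n. snd (E n)"]) (auto simp: E_def)
qed

text \<open>The least period over all trails, which is half the length of an alternating cycle.
  Arc-transitivity makes the periods independent of the trail, so every single trail has this least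
  period.\<close>

definition radius :: nat where
  "radius = (LEAST k. k > 0 \<and> (\<exists>t h. trail t h \<and> t (int k) = t 0 \<and> h (int k) = h 0))"

lemma trail_G_image:
  assumes "trail t h" "trail t' h'" shows "\<exists>g\<in>G. \<forall>n. g (t n) = t' n \<and> g (h n) = h' n"
proof -
  obtain g where g: "g \<in> G" "g (t 0) = t' 0" "g (h 0) = h' 0"
    using arc_trans[OF trailD(1)[OF assms(1), of 0] trailD(1)[OF assms(2), of 0]] by blast
  then show ?thesis using trail_unique[OF trail_image[OF g(1) assms(1)] assms(2), of 0] by blast
qed

text \<open>By \<open>trail_unique\<close> the periods of a trail form a subgroup of the integers,
  and it is not trivial because \<open>D\<close> is finite. \<open>trail_G_image\<close> carries the
  periods from one trail to any other.\<close>

lemma trail_period: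
  assumes "trail t h" shows "t n = t k \<and> h n = h k \<longleftrightarrow> int radius dvd n - k"
    and radius_pos: "radius > 0"
proof -
  define X where "X = {k. t k = t 0 \<and> h k = h 0}"
  have per: "t (n + k) = t n \<and> h (n + k) = h n" if "k \<in> X" for k n
    using trail_unique[OF trail_shift[OF assms] assms, of 0 k] that by (auto simp: X_def)
  have diff: "x - y \<in> X" if "x \<in> X" "y \<in> X" for x y
    using per[OF that(2), of "x - y"] that(1) by (auto simp: X_def)
  have X_eq: "t n = t k \<and> h n = h k \<longleftrightarrow> n - k \<in> X" for n k
  proof
    assume "t n = t k \<and> h n = h k"
    then show "n - k \<in> X"
      using trail_unique[OF trail_shift[OF assms, of "n - k"] assms, of k 0] by (simp add: X_def)
  next
    assume "n - k \<in> X"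
    from per[OF this, of k] show "t n = t k \<and> h n = h k" by simp
  qed
  have "finite D" by (rule finite_subset[of _ "V \<times> V"]) (use D_verts finite_V in auto)
  moreover have "range (\<lambda>n. (t n, h n)) \<subseteq> D" using trailD[OF assms] by auto
  ultimately have "\<not> inj (\<lambda>n. (t n, h n))" using infinite_UNIV_int finite_subset inj_on_finite by blast
  then obtain a b where "a \<noteq> b" "t a = t b" "h a = h b" by (auto simp: inj_def)
  then have "a - b \<in> X" "b - a \<in> X" using X_eq[of a b] X_eq[of b a] by simp_all
  then have "\<exists>k>0. k \<in> X" using \<open>a \<noteq> b\<close> by (metis diff_gt_0_iff_gt linorder_neqE_linordered_idom)
  from int_subgroup_eq_multiples[OF diff this]
  obtain d where d: "d > 0" "d \<in> X" "X = {n. d dvd n}" by blast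
  have X_indep: "(\<exists>t h. trail t h \<and> t k = t 0 \<and> h k = h 0) \<longleftrightarrow> k \<in> X" for k
  proof
    assume "\<exists>t h. trail t h \<and> t k = t 0 \<and> h k = h 0"
    then obtain t' h' where *: "trail t' h'" "t' k = t' 0" "h' k = h' 0" by blast
    from trail_G_image[OF *(1) assms] show "k \<in> X" using *(2,3) unfolding X_def by (metis (mono_tags, lifting) mem_Collect_eq)
  qed (use assms in \<open>auto simp: X_def\<close>)
  have "radius = nat d" unfolding radius_def X_indep
    by (rule Least_equality) (use d in \<open>auto dest: zdvd_imp_le\<close>)
  then show "t n = t k \<and> h n = h k \<longleftrightarrow> int radius dvd n - k" "radius > 0" using X_eq d by auto
qed

text \<open>If only the tails at \<open>n\<close> and \<open>k\<close> coincided, the trail upwards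
  from \<open>k\<close> would be the trail downwards from \<open>n\<close>. Halfway between them
  sits a tail or a head, according to the parity of \<open>n - k\<close>, whose two neighbours on
  the trail then coincide. Coinciding heads are treated in the same way.\<close>

lemma trail_inj:
  assumes "trail t h"
  shows t_eq_iff: "t n = t k \<longleftrightarrow> int radius dvd n - k" and h_eq_iff: "h n = h k \<longleftrightarrow> int radius dvd n - k"
proof -
  have "h n = h k" if "t n = t k"
  proof (rule ccontr)
    assume ne: "h n \<noteq> h k"
    have "h k = h (n - 1)"
      using that ne out_unique trailD(1,7)[OF assms, of n] trailD(1)[OF assms, of k] trailD(4)[OF assms, of "n - 1"]
      by (metis diff_add_cancel)
    then have *: "t (m + k) = t (n - m)" "h (m + k) = h (n - 1 - m)" for m
      using trail_unique[OF trail_shift[OF assms, of k] trail_rev[OF assms, of n], of 0 m] that by auto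
    show False
    proof (cases "even (n - k)")
      case True
      then obtain s where "n - k = 2 * s" by (elim evenE)
      then have "h (s + k) = h (s + k - 1)" using *(2)[of s] by (simp add: algebra_simps)
      then show False using trailD(4)[OF assms, of "s + k - 1"] by simp
    next
      case False
      then obtain s where "n - k = 2 * s + 1" by (elim oddE)
      then have "n - s = s + k + 1" by simp
      then have "t (s + k) = t (s + k + 1)" using *(1)[of s] by metis
      then show False using trailD(3)[OF assms, of "s + k"] by simp
    qed
  qed
  moreover have "t n = t k" if "h n = h k"
  proof (rule ccontr)
    assume ne: "t n \<noteq> t k"
    have "t k = t (n + 1)"
      using that ne in_unique trailD(1,2,3)[OF assms, of n] trailD(1)[OF assms, of k] by metis
    then have *: "t (m + k) = t (n + 1 - m)" "h (m + k) = h (n - m)" for m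
      using trail_unique[OF trail_shift[OF assms, of k] trail_rev[OF assms, of "n + 1"], of 0 m] that by auto
    show False
    proof (cases "even (n - k)")
      case True
      then obtain s where "n - k = 2 * s" by (elim evenE)
      then have "n + 1 - s = s + k + 1" by simp
      then have "t (s + k) = t (s + k + 1)" using *(1)[of s] by metis
      then show False using trailD(3)[OF assms, of "s + k"] by simp
    next
      case False
      then obtain s where "n - k = 2 * s + 1" by (elim oddE)
      then have "n - s = s + k + 1" by simp
      then have "h (s + k) = h (s + k + 1)" using *(2)[of s] by metis
      then show False using trailD(4)[OF assms, of "s + k"] by simp
    qed
  qed
  ultimately show "t n = t k \<longleftrightarrow> int radius dvd n - k" "h n = h k \<longleftrightarrow> int radius dvd n - k"
    using trail_period(1)[OF assms, of n k] by auto
qed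

lemma radius_ge_2:
  assumes "trail t h" shows "radius \<ge> 2"
proof -
  have "radius \<noteq> 1" using t_eq_iff[OF assms, of 1 0] trailD(3)[OF assms, of 0] by auto
  then show ?thesis using radius_pos[OF assms] by linarith
qed

section \<open>The dihedral action on one alternating cycle\<close>

lemma rotation_exists:
  assumes "trail t h" shows "\<exists>g\<in>G. \<forall>n. g (t n) = t (n + k) \<and> g (h n) = h (n + k)"
  using trail_G_image[OF assms trail_shift[OF assms]] by simp

lemma reflection_exists:
  assumes "trail t h" shows "\<exists>g\<in>G. \<forall>n. g (t n) = t (k - n) \<and> g (h n) = h (k - 1 - n)"
  using trail_G_image[OF assms trail_rev[OF assms]] by simp

text \<open>If a tail were a head, rotations would give \<open>h n = t (n + s)\<close> for all
  \<open>n\<close>, and a reflection would force \<open>2 * s = 1\<close> modulo the radius. Then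
  \<open>t 0\<close> and \<open>t s\<close> would be joined by arcs in both directions.\<close>

lemma t_neq_h:
  assumes "trail t h" shows "t a \<noteq> h b"
proof
  assume eq: "t a = h b"
  define s where "s = a - b"
  have hs: "h n = t (n + s)" for n
  proof -
    obtain g where g: "\<And>m. g (t m) = t (m + (n - b)) \<and> g (h m) = h (m + (n - b))"
      using rotation_exists[OF assms] by blast
    show ?thesis using g[of a] g[of b] eq by (simp add: s_def algebra_simps)
  qed
  obtain g where g: "\<And>m. g (t m) = t (0 - m) \<and> g (h m) = h (0 - 1 - m)"
    using reflection_exists[OF assms] by blast
  have "t (- a) = h (- 1 - b)" using g[of a] g[of b] eq by simp
  then have "t (- a) = t (- 1 - b + s)" using hs by simp
  then have "int radius dvd - a - (- 1 - b + s)" using t_eq_iff[OF assms] by blast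
  then have dv: "int radius dvd 1 - 2 * s" by (simp add: s_def algebra_simps)
  have "h (s - 1) = t (2 * s - 1)" using hs[of "s - 1"] by (simp add: algebra_simps)
  also have "\<dots> = t 0" using dv t_eq_iff[OF assms, of "2 * s - 1" 0] by (metis diff_zero dvd_minus_iff minus_diff_eq)
  finally have "(t s, t 0) \<in> D" using trailD(7)[OF assms, of s] by simp
  moreover have "(t 0, t s) \<in> D" using trailD(1)[OF assms, of 0] hs[of 0] by simp
  ultimately show False using asym by blast
qed

text \<open>The image of the trail is fixed by its first arc, and there are only two heads at
  \<open>t k\<close> to which \<open>h 0\<close> can go: one gives the rotation, the other the
  reflection.\<close>

lemma dihedral:
  assumes "trail t h" "g \<in> G" "g (t 0) = t k"
  shows "(\<forall>n. g (t n) = t (n + k) \<and> g (h n) = h (n + k)) \<or> (\<forall>n. g (t n) = t (k - n) \<and> g (h n) = h (k - 1 - n))"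
proof -
  note im = trail_image[OF assms(2,1)]
  have "(t k, g (h 0)) \<in> D" using trailD(1)[OF im, of 0] assms(3) by simp
  then have "g (h 0) = h k \<or> g (h 0) = h (k - 1)"
    using out_unique trailD(1,7)[OF assms(1), of k] trailD(4)[OF assms(1), of "k - 1"] by (metis diff_add_cancel)
  then show ?thesis
  proof
    assume "g (h 0) = h k"
    then show ?thesis using trail_unique[OF im trail_shift[OF assms(1), of k], of 0] assms(3) by auto
  next
    assume "g (h 0) = h (k - 1)"
    then show ?thesis using trail_unique[OF im trail_rev[OF assms(1), of k], of 0] assms(3) by auto
  qed
qed

section \<open>Vertex sets of alternating cycles that share a vertex\<close>

lemma range_shift: "range (\<lambda>n. f (n + k :: int)) = range f"
proof -
  have "range f = f ` range (\<lambda>n. n + k)" by simp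
  then show ?thesis by (simp only: image_image)
qed

lemma range_rev: "range (\<lambda>n. f (k - n :: int)) = range f"
proof -
  have "range f = f ` range (\<lambda>n. k - n)" by simp
  then show ?thesis by (simp only: image_image)
qed

lemma trail_same_tail:
  assumes "trail t h" "trail t' h'" "t' 0 = t k"
  shows "(\<forall>n. t' n = t (n + k) \<and> h' n = h (n + k)) \<or> (\<forall>n. t' n = t (k - n) \<and> h' n = h (k - 1 - n))"
proof -
  have "h' 0 = h k \<or> h' 0 = h (k - 1)"
    using out_unique trailD(1,7)[OF assms(1), of k] trailD(4)[OF assms(1), of "k - 1"] trailD(1)[OF assms(2), of 0]
      assms(3) by (metis diff_add_cancel)
  then show ?thesis
  proof
    assume "h' 0 = h k"
    then show ?thesis using trail_unique[OF assms(2) trail_shift[OF assms(1), of k], of 0] assms(3) by auto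
  next
    assume "h' 0 = h (k - 1)"
    then show ?thesis using trail_unique[OF assms(2) trail_rev[OF assms(1), of k], of 0] assms(3) by auto
  qed
qed

lemma same_tail_ranges:
  assumes "trail t h" "trail t' h'" "t' a = t b"
  shows "range t' = range t" "range h' = range h"
proof -
  have "t' (0 + a) = t b" using assms(3) by simp
  from trail_same_tail[OF assms(1) trail_shift[OF assms(2), of a] this]
  have "range (\<lambda>n. t' (n + a)) = range t \<and> range (\<lambda>n. h' (n + a)) = range h"
    by (elim disjE) (simp_all only: range_shift range_rev)
  then show "range t' = range t" "range h' = range h" by (auto simp only: range_shift)
qed

lemma same_head_ranges:
  assumes "trail t h" "trail t' h'" "h' a = h b"
  shows "range t' = range t" "range h' = range h"
proof -
  have "t' a = t b \<or> t' a = t (b + 1)"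
    using in_unique trailD(1,2,3)[OF assms(1), of b] trailD(1)[OF assms(2), of a] assms(3) by metis
  then show "range t' = range t" "range h' = range h" using same_tail_ranges[OF assms(1,2)] by blast+
qed

lemma range_eq_image:
  assumes "trail t h" shows "range t = t ` {0..<int radius}" "range h = h ` {0..<int radius}"
proof -
  have r: "radius > 0" using radius_pos[OF assms] .
  have "t n = t (n mod int radius)" "h n = h (n mod int radius)" for n
    using t_eq_iff[OF assms] h_eq_iff[OF assms] by (simp_all add: dvd_minus_mod)
  moreover have "n mod int radius \<in> {0..<int radius}" for n using r by simp
  ultimately show "range t = t ` {0..<int radius}" "range h = h ` {0..<int radius}" by blast+
qed

lemma inj_on_period:
  assumes "trail t h" shows "inj_on t {0..<int radius}" "inj_on h {0..<int radius}"
proof -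
  have "n = k" if "int radius dvd n - k" "n \<in> {0..<int radius}" "k \<in> {0..<int radius}" for n k
    using that by (metis atLeastLessThan_iff mod_eq_dvd_iff mod_pos_pos_trivial)
  then show "inj_on t {0..<int radius}" "inj_on h {0..<int radius}"
    using t_eq_iff[OF assms] h_eq_iff[OF assms] by (auto simp: inj_on_def)
qed

lemma card_ranges:
  assumes "trail t h" shows "card (range t) = radius" "card (range h) = radius"
  using range_eq_image[OF assms] inj_on_period[OF assms] by (simp_all add: card_image)

text \<open>A common vertex is a head of one cycle and a tail of the other; \<open>X\<close> and
  \<open>Y\<close> collect the indices of the two kinds along the second cycle. \<open>X\<close> is
  a subgroup generated by some \<open>d\<close>, and \<open>Y\<close> is empty or a coset of it.
  Each class has \<open>radius / d\<close> members in a period and the total is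
  \<open>radius\<close>, so either \<open>Y\<close> is empty and \<open>d = 1\<close>, which is the
  claim, or \<open>d = 2\<close>, which a reflection rules out.\<close>

lemma tight_imp_range_eq:
  assumes tr: "trail t h" and tr': "trail t' h'" and v: "h 0 = t' 0"
    and card: "card ((range t \<union> range h) \<inter> (range t' \<union> range h')) = radius"
  shows "range h = range t'"
proof -
  define X where "X = {n. t' n \<in> range h}"
  define Y where "Y = {n. h' n \<in> range t}"
  have no_t: "range t \<inter> range t' = {}"
    using same_tail_ranges(1)[OF tr tr'] t_neq_h[OF tr] v by (metis (no_types, lifting) disjoint_iff rangeE rangeI)
  have no_h: "range h \<inter> range h' = {}"
    using same_head_ranges(2)[OF tr tr'] t_neq_h[OF tr'] v by (metis (no_types, lifting) disjoint_iff rangeE rangeI)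
  have no_t_same_h: "range h \<inter> range t = {}" "range h' \<inter> range t' = {}"
    using t_neq_h[OF tr] t_neq_h[OF tr'] by (auto simp: disjoint_iff) metis+
  have fin: "finite (range t)" "finite (range h)" "finite (range t')" "finite (range h')"
    using range_eq_image[OF tr] range_eq_image[OF tr'] by (metis finite_imageI finite_atLeastLessThan_int)+
  have int_image: "f ` S \<inter> T = f ` {n \<in> S. f n \<in> T}" for f :: "int \<Rightarrow> 'a" and S T by auto
  have "(range t \<union> range h) \<inter> (range t' \<union> range h') = (range h \<inter> range t') \<union> (range t \<inter> range h')"
    using no_t no_h by auto
  moreover have "card ((range h \<inter> range t') \<union> (range t \<inter> range h')) = card (range h \<inter> range t') + card (range t \<inter> range h')"
    by (rule card_Un_disjoint) (use fin no_t_same_h in auto)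
  moreover have "range h \<inter> range t' = t' ` {n \<in> {0..<int radius}. n \<in> X}"
    using range_eq_image(1)[OF tr'] int_image[of t' "{0..<int radius}" "range h"]
    unfolding X_def mem_Collect_eq by (metis Int_commute)
  then have "card (range h \<inter> range t') = card {n \<in> {0..<int radius}. n \<in> X}"
    by (simp only:) (rule card_image[OF inj_on_subset[OF inj_on_period(1)[OF tr']]], auto)
  moreover have "range t \<inter> range h' = h' ` {n \<in> {0..<int radius}. n \<in> Y}"
    using range_eq_image(2)[OF tr'] int_image[of h' "{0..<int radius}" "range t"]
    unfolding Y_def mem_Collect_eq by (metis Int_commute)
  then have "card (range t \<inter> range h') = card {n \<in> {0..<int radius}. n \<in> Y}"
    by (simp only:) (rule card_image[OF inj_on_subset[OF inj_on_period(2)[OF tr']]], auto)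
  ultimately have sum: "card {n \<in> {0..<int radius}. n \<in> X} + card {n \<in> {0..<int radius}. n \<in> Y} = radius"
    using card by simp
  have inv: "g ` range t = range t" "g ` range h = range h"
    if "g \<in> G" "g (h a) = h b" for g a b
    using same_head_ranges[OF tr trail_image[OF that(1) tr], of a b] that(2) by (simp_all add: image_image)
  \<comment> \<open>A rotation of the second cycle that maps one common vertex to another of the
    same kind also maps the first cycle to itself, hence it shifts \<open>X\<close> and
    \<open>Y\<close> into themselves.\<close>
  have memX: "y \<in> X \<longleftrightarrow> y + (b - a) \<in> X" and memY: "y \<in> Y \<longleftrightarrow> y + (b - a) \<in> Y"
    if ab: "(a \<in> X \<and> b \<in> X) \<or> (a \<in> Y \<and> b \<in> Y)" for a b y
  proof -
    obtain g where g: "g \<in> G" "\<And>n. g (t' n) = t' (n + (b - a)) \<and> g (h' n) = h' (n + (b - a))"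
      using rotation_exists[OF tr'] by blast
    have rg: "g ` range t = range t \<and> g ` range h = range h"
    proof (cases "a \<in> X \<and> b \<in> X")
      case True
      then obtain c d where "t' a = h c" "t' b = h d" by (auto simp: X_def)
      then show ?thesis using inv[OF g(1), of c d] g(2)[of a] by simp
    next
      case False
      then obtain c d where "h' a = t c" "h' b = t d" using ab by (auto simp: Y_def)
      then show ?thesis using same_tail_ranges[OF tr trail_image[OF g(1) tr], of c d] g(2)[of a] by (simp add: image_image)
    qed
    have im: "g x \<in> g ` S \<longleftrightarrow> x \<in> S" if "x \<in> V" "S \<subseteq> V" for x S
      using that G_inj[OF g(1)] by blast
    have sub: "range t \<subseteq> V" "range h \<subseteq> V" using trailD(5,6)[OF tr] by auto
    show "y \<in> X \<longleftrightarrow> y + (b - a) \<in> X" using im[OF trailD(5)[OF tr'] sub(2), of y] rg g(2)[of y] by (simp add: X_def)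
    show "y \<in> Y \<longleftrightarrow> y + (b - a) \<in> Y" using im[OF trailD(6)[OF tr'] sub(1), of y] rg g(2)[of y] by (simp add: Y_def)
  qed
  have X0: "0 \<in> X" using v by (simp add: X_def) (metis rangeI)
  have Xd: "x - y \<in> X" if "x \<in> X" "y \<in> X" for x y using memX[of y x 0] X0 that by simp
  have Xr: "int radius \<in> X" using X0 t_eq_iff[OF tr', of "int radius" 0] by (simp add: X_def)
  from int_subgroup_eq_multiples[of X] obtain d where d: "d > 0" "X = {n. d dvd n}"
    using Xd Xr radius_pos[OF tr] by (metis of_nat_0_less_iff)
  have dr: "d dvd int radius" using Xr d by auto
  have cX: "int (card {n \<in> {0..<int radius}. n \<in> X}) * d = int radius"
    using card_residue_class[OF d(1) dr, of 0] d by simp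
  have "Y = {}"
  proof (rule ccontr)
    assume "Y \<noteq> {}"
    then obtain y where y: "y \<in> Y" by blast
    have Yeq: "n \<in> Y \<longleftrightarrow> d dvd n - y" for n
    proof
      assume "n \<in> Y" then have "n - y \<in> X" using memX[of y n 0] X0 y by simp
      then show "d dvd n - y" using d by auto
    next
      assume "d dvd n - y" then have "n - y \<in> X" using d by auto
      then show "n \<in> Y" using memY[of 0 "n - y" y] X0 y by simp
    qed
    have cY: "int (card {n \<in> {0..<int radius}. n \<in> Y}) * d = int radius"
      using card_residue_class[OF d(1) dr, of y] Yeq by simp
    have "int radius * d = 2 * int radius" using sum cX cY by (metis (no_types, lifting) distrib_right mult_2 of_nat_add)
    then have d2: "d = 2" using radius_pos[OF tr] by simp
    \<comment> \<open>This reflection fixes the common vertex \<open>t' 0 = h 0\<close>, so it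
      preserves both cycles and therefore \<open>Y\<close>. But it sends the index \<open>y\<close>
      to \<open>- 1 - y\<close>, which has the other parity.\<close>
    obtain g where g: "g \<in> G" "\<And>n. g (t' n) = t' (0 - n) \<and> g (h' n) = h' (0 - 1 - n)"
      using reflection_exists[OF tr'] by blast
    have "g (h 0) = h 0" using g(2)[of 0] v by simp
    then have "g (h' y) \<in> range t" using inv(1)[OF g(1)] y unfolding Y_def by blast
    then have "- 1 - y \<in> Y" using g(2)[of y] by (simp add: Y_def)
    then have "d dvd - 1 - y - y" using Yeq by blast
    then show False unfolding d2 by presburger
  qed
  then have "d = 1" using sum cX d radius_pos[OF tr] by simp
  then have "range t' \<subseteq> range h" using d by (auto simp: X_def)
  then show ?thesis using card_subset_eq[OF fin(2)] card_ranges[OF tr] card_ranges[OF tr'] by metis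
qed

end

section \<open>Coordinates from tight attachment\<close>

text \<open>Tight attachment enters in the form supplied by \<open>tight_imp_range_eq\<close>. A
  radius of at least 3 separates rotations from reflections: modulo 2 the maps \<open>n + k\<close>
  and \<open>k - n\<close> agree.\<close>

locale tight_half_transitive = half_transitive +
  assumes tight: "trail t h \<Longrightarrow> trail t' h' \<Longrightarrow> h 0 = t' 0 \<Longrightarrow> range h = range t'"
    and radius_ge_3: "radius \<ge> 3"
begin

lemma not_radius_dvd_2: "\<not> int radius dvd 2"
  using radius_ge_3 by (auto dest: zdvd_imp_le)

lemma trail_at: assumes "v \<in> V" shows "\<exists>t h. trail t h \<and> t 0 = v"
proof -
  have "{w. (v, w) \<in> D} \<noteq> {}" using out2[OF assms] by force
  then show ?thesis using trail_exists by blast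
qed

text \<open>The tails of the alternating cycle that leaves \<open>v\<close>. By \<open>tight\<close>
  they are also the heads of the alternating cycle that arrives at \<open>v\<close>, see
  \<open>layer_trail_head\<close>.\<close>

definition layer :: "'a \<Rightarrow> 'a set" where
  "layer v = {u. \<exists>t h n. trail t h \<and> t 0 = v \<and> t n = u}"

lemma layer_trail: assumes "trail t h" shows "layer (t n) = range t"
proof -
  have "range t' = range t" if "trail t' h'" "t' 0 = t n" for t' h'
    using same_tail_ranges(1)[OF assms that(1)] that(2) by blast
  moreover have "t k \<in> layer (t n)" for k
    unfolding layer_def using trail_shift[OF assms, of n]
    by (intro CollectI exI[of _ "\<lambda>k. t (k + n)"] exI[of _ "\<lambda>k. h (k + n)"] exI[of _ "k - n"]) simp
  ultimately show ?thesis unfolding layer_def by blast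
qed

lemma layer_trail_head: assumes "trail t h" shows "layer (h n) = range h"
proof -
  obtain t' h' where t': "trail t' h'" "t' 0 = h n" using trail_at trailD(6)[OF assms] by blast
  have "range (\<lambda>k. h (k + n)) = range t'"
    using tight[OF trail_shift[OF assms, of n] t'(1)] t'(2) by simp
  then show ?thesis using layer_trail[OF t'(1), of 0] t'(2) by (simp only: range_shift)
qed

text \<open>Trails with the same tails in the same order could differ only by a reversal. That would
  identify the tails at 1 and -1 and make the radius divide 2. The same holds for heads.\<close>

lemma trails_agree:
  assumes "trail t h" "trail t' h'"
  shows "(\<forall>n. t n = t' n) \<longleftrightarrow> (\<forall>n. h n = h' n)"
proof
  assume eq: "\<forall>n. t n = t' n"
  from trail_same_tail[OF assms, of 0] eq
  have "(\<forall>n. t' n = t (n + 0) \<and> h' n = h (n + 0)) \<or> (\<forall>n. t' n = t (0 - n) \<and> h' n = h (0 - 1 - n))"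
    by metis
  then show "\<forall>n. h n = h' n"
  proof
    assume "\<forall>n. t' n = t (0 - n) \<and> h' n = h (0 - 1 - n)"
    then have "t 1 = t (0 - 1)" using eq by metis
    then have "int radius dvd 2" using t_eq_iff[OF assms(1), of 1 "-1"] by simp
    then show ?thesis using not_radius_dvd_2 by blast
  qed simp
next
  assume eq: "\<forall>n. h n = h' n"
  have "t' 0 = t 0 \<or> t' 0 = t 1"
    using in_unique trailD(1,2,3)[OF assms(1), of 0] trailD(1)[OF assms(2), of 0] eq by (metis add_0)
  then show "\<forall>n. t n = t' n"
  proof
    assume "t' 0 = t 0"
    then show ?thesis using trail_unique[OF assms, of 0] eq by simp
  next
    assume "t' 0 = t 1"
    from trail_same_tail[OF assms this] show ?thesis
    proof
      assume "\<forall>n. t' n = t (n + 1) \<and> h' n = h (n + 1)"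
      then have "h (0 + 1) = h 0" using eq by metis
      then show ?thesis using trailD(4)[OF assms(1), of 0] by blast
    next
      assume "\<forall>n. t' n = t (1 - n) \<and> h' n = h (1 - 1 - n)"
      then have "h 1 = h (1 - 1 - 1)" using eq by metis
      then have "int radius dvd 2" using h_eq_iff[OF assms(1), of 1 "-1"] by simp
      then show ?thesis using not_radius_dvd_2 by blast
    qed
  qed
qed

text \<open>The tool for all identities between group elements: by \<open>trails_agree\<close>
  agreement on a layer passes across every arc to the adjacent layer, and connectedness does the
  rest.\<close>

lemma agree_on_class:
  assumes g: "g \<in> G" "k \<in> G" and v: "v \<in> V" "\<forall>u\<in>layer v. g u = k u" and w: "w \<in> V"
  shows "g w = k w"
proof -
  have P_iff: "(\<forall>u\<in>layer x. g u = k u) \<longleftrightarrow> (\<forall>u\<in>layer y. g u = k u)" if xy: "(x, y) \<in> D" for x y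
  proof -
    obtain t h where t: "trail t h" "t 0 = x" "h 0 = y" using trail_exists[OF xy] by blast
    have "layer x = range t" "layer y = range h" using layer_trail[OF t(1), of 0] layer_trail_head[OF t(1), of 0] t by auto
    then show ?thesis using trails_agree[OF trail_image[OF g(1) t(1)] trail_image[OF g(2) t(1)]] by auto
  qed
  have "\<forall>u\<in>layer w. g u = k u"
    by (rule D_induct[of v "\<lambda>v. \<forall>u\<in>layer v. g u = k u" w]) (use P_iff v w in blast)+
  moreover have "w \<in> layer w" using trail_at[OF w] layer_trail by (metis rangeI)
  ultimately show ?thesis by blast
qed

text \<open>Mapping one tail into the tails of a cycle maps the whole cycle to itself, hence also
  its heads, and conversely; so the property spreads along arcs.\<close>

lemma class_preserved:
  assumes g: "g \<in> G" and v: "v \<in> V" "g v \<in> layer v" and w: "w \<in> V"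
  shows "g w \<in> layer w"
proof -
  have P_iff: "g x \<in> layer x \<longleftrightarrow> g y \<in> layer y" if xy: "(x, y) \<in> D" for x y
  proof -
    obtain t h where t: "trail t h" "t 0 = x" "h 0 = y" using trail_exists[OF xy] by blast
    have c: "layer x = range t" "layer y = range h" using layer_trail[OF t(1), of 0] layer_trail_head[OF t(1), of 0] t by auto
    note im = trail_image[OF g t(1)]
    show ?thesis
    proof
      assume "g x \<in> layer x"
      then obtain b where "g (t 0) = t b" using c t by auto
      from same_tail_ranges(2)[OF t(1) im this] show "g y \<in> layer y" using c t by auto
    next
      assume "g y \<in> layer y"
      then obtain b where "g (h 0) = h b" using c t by auto
      from same_head_ranges(1)[OF t(1) im this] show "g x \<in> layer x" using c t by auto
    qed
  qed
  show ?thesis by (rule D_induct[of v "\<lambda>v. g v \<in> layer v" w]) (use P_iff v w in blast)+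
qed

lemma dihedral_all:
  assumes g: "g \<in> G" and v: "v \<in> V" "g v \<in> layer v" and t: "trail t h"
  shows "\<exists>k. (\<forall>n. g (t n) = t (n + k) \<and> g (h n) = h (n + k)) \<or> (\<forall>n. g (t n) = t (k - n) \<and> g (h n) = h (k - 1 - n))"
proof -
  have "g (t 0) \<in> range t" using class_preserved[OF g v trailD(5)[OF t]] layer_trail[OF t] by auto
  then show ?thesis using dihedral[OF t g] by auto
qed

section \<open>Rotations and reflections acting on all layers at once\<close>

lemma G_funpow: assumes "g \<in> G" shows "\<exists>k\<in>G. \<forall>v\<in>V. k v = (g ^^ n) v"
proof (induction n)
  case 0
  then show ?case using G_inv[OF assms] G_comp[OF assms] by (metis funpow_0)
next
  case (Suc n)
  then show ?case using G_comp[OF assms] by (metis funpow.simps(2) comp_apply)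
qed

lemma rotation_power:
  assumes g: "g \<in> G" and t: "trail t h" and gs: "\<forall>n. g (t n) = t (n + k) \<and> g (h n) = h (n + k)"
  shows "(g ^^ j) (t n) = t (n + k * int j) \<and> (g ^^ j) (h n) = h (n + k * int j)"
  by (induction j) (use gs in \<open>auto simp: algebra_simps\<close>)

text \<open>On the first layer \<open>g\<close> has order \<open>radius\<close>, and by
  \<open>agree_on_class\<close> a power that is trivial on one layer is trivial on all. So
  \<open>g\<close> has this order on every layer, which excludes reflections, whose square is
  trivial, and rotations by a non-unit.\<close>

lemma rotation_all:
  assumes g: "g \<in> G" and t: "trail t h" and gt: "\<forall>n. g (t n) = t (n + s) \<and> g (h n) = h (n + s)"
    and s: "coprime s (int radius)" and t': "trail t' h'"
  shows "\<exists>k. coprime k (int radius) \<and> (\<forall>n. g (t' n) = t' (n + k) \<and> g (h' n) = h' (n + k))"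
proof -
  have gV: "g (t 0) \<in> layer (t 0)" using gt layer_trail[OF t] by auto
  have fix_pow: "int radius dvd s * int j" if j: "\<forall>n. (g ^^ j) (t' n) = t' n" for j
  proof -
    obtain p where p: "p \<in> G" "\<forall>v\<in>V. p v = (g ^^ j) v" using G_funpow[OF g] by blast
    obtain e where e: "e \<in> G" "\<forall>v\<in>V. e v = v" using G_funpow[OF g, of 0] by auto
    have "\<forall>u\<in>layer (t' 0). p u = e u" using p e j layer_trail[OF t', of 0] trailD(5)[OF t'] by auto
    then have "p (t 0) = e (t 0)" using agree_on_class[OF p(1) e(1) trailD(5)[OF t']] trailD(5)[OF t] by blast
    then have "t (s * int j) = t 0"
      using p e trailD(5)[OF t, of 0] rotation_power[OF g t gt, of j 0] by simp
    then show ?thesis using t_eq_iff[OF t, of "s * int j" 0] by simp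
  qed
  obtain k where "(\<forall>n. g (t' n) = t' (n + k) \<and> g (h' n) = h' (n + k)) \<or> (\<forall>n. g (t' n) = t' (k - n) \<and> g (h' n) = h' (k - 1 - n))"
    using dihedral_all[OF g trailD(5)[OF t] gV t'] by blast
  then show ?thesis
  proof
    assume "\<forall>n. g (t' n) = t' (k - n) \<and> g (h' n) = h' (k - 1 - n)"
    then have "\<forall>n. (g ^^ 2) (t' n) = t' n" by (simp add: numeral_2_eq_2)
    from fix_pow[OF this] have "int radius dvd 2" using s by (simp add: coprime_dvd_mult_right_iff coprime_commute)
    then show ?thesis using not_radius_dvd_2 by blast
  next
    assume k: "\<forall>n. g (t' n) = t' (n + k) \<and> g (h' n) = h' (n + k)"
    \<comment> \<open>With \<open>d\<close> the gcd, the power with exponent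
      \<open>radius / d\<close> is trivial on this layer, which is possible only for
      \<open>d = 1\<close>.\<close>
    define d where "d = gcd k (int radius)"
    have r0: "int radius > 0" using radius_ge_3 by simp
    have d0: "d > 0" using r0 by (simp add: d_def gcd_pos_int)
    have dk: "d dvd k" "d dvd int radius" by (simp_all add: d_def)
    then obtain c where c: "int radius = d * c" by (elim dvdE)
    have c0: "c > 0" using c r0 d0 by (simp add: zero_less_mult_iff)
    have "int radius dvd k * int (nat c)" using c c0 dk(1) by (simp add: mult_dvd_mono)
    then have "\<forall>n. (g ^^ nat c) (t' n) = t' n"
      using rotation_power[OF g t' k, of "nat c"] t_eq_iff[OF t'] by simp
    from fix_pow[OF this] have "int radius dvd c" using s c0 by (simp add: coprime_dvd_mult_right_iff coprime_commute)
    then have "d * c \<le> c" using c c0 zdvd_imp_le by auto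
    then have "d \<le> 1" using c0 by simp
    then have "d = 1" using d0 by simp
    then have "coprime k (int radius)" by (simp add: d_def coprime_iff_gcd_eq_1)
    then show ?thesis using k by blast
  qed
qed

lemma rotations_exist:
  assumes t0: "trail t0 h0" and s: "coprime s (int radius)"
  obtains R where "\<And>j. \<exists>g\<in>G. \<forall>v\<in>V. g v = R j v"
    "\<And>t h. trail t h \<Longrightarrow> \<exists>k. coprime k (int radius) \<and> (\<forall>j n. R j (t n) = t (n + k * j) \<and> R j (h n) = h (n + k * j))"
    "\<And>j n. R j (t0 n) = t0 (n + s * j) \<and> R j (h0 n) = h0 (n + s * j)"
proof -
  obtain g where g: "g \<in> G" "\<forall>n. g (t0 n) = t0 (n + s) \<and> g (h0 n) = h0 (n + s)"
    using rotation_exists[OF t0] by blast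
  \<comment> \<open>\<open>funpow\<close> takes natural exponents; reducing modulo the radius makes
    the powers available for every integer \<open>j\<close>.\<close>
  define R where "R j = g ^^ nat (j mod int radius)" for j
  have r0: "int radius > 0" using radius_ge_3 by simp
  have act: "R j (t n) = t (n + k * j) \<and> R j (h n) = h (n + k * j)"
    if "trail t h" "\<forall>n. g (t n) = t (n + k) \<and> g (h n) = h (n + k)" for t h k j n
  proof -
    have "int radius dvd k * (j mod int radius - j)" by (simp add: mod_eq_dvd_iff[symmetric])
    then have "int radius dvd (n + k * (j mod int radius)) - (n + k * j)" by (simp add: algebra_simps)
    then show ?thesis using rotation_power[OF g(1) that, of "nat (j mod int radius)" n] t_eq_iff[OF that(1)] h_eq_iff[OF that(1)] r0
      by (simp add: R_def)
  qed
  show ?thesis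
  proof
    show "\<exists>g\<in>G. \<forall>v\<in>V. g v = R j v" for j using G_funpow[OF g(1)] by (simp add: R_def)
    show "\<exists>k. coprime k (int radius) \<and> (\<forall>j n. R j (t n) = t (n + k * j) \<and> R j (h n) = h (n + k * j))" if "trail t h" for t h
      using rotation_all[OF g(1) t0 g(2) s that] act[OF that] by blast
    show "R j (t0 n) = t0 (n + s * j) \<and> R j (h0 n) = h0 (n + s * j)" for j n using act[OF t0 g(2)] .
  qed
qed

text \<open>If \<open>\<tau>\<close> rotated some layer, it would commute there with the basic
  rotation, and then everywhere. On \<open>t0\<close> it inverts that rotation, so
  \<open>t0 1\<close> and \<open>t0 (- 1)\<close> would coincide.\<close>

lemma reflection_all:
  assumes t0: "trail t0 h0" and tau: "\<tau> \<in> G" "\<forall>n. \<tau> (t0 n) = t0 (- n) \<and> \<tau> (h0 n) = h0 (- 1 - n)"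
    and t: "trail t h"
  shows "\<exists>c. \<forall>n. \<tau> (t n) = t (c - n) \<and> \<tau> (h n) = h (c - 1 - n)"
proof -
  have tV: "\<tau> (t0 0) \<in> layer (t0 0)" using tau layer_trail[OF t0] by auto
  obtain R where R: "\<And>j. \<exists>g\<in>G. \<forall>v\<in>V. g v = R j v"
    "\<And>t h. trail t h \<Longrightarrow> \<exists>k. coprime k (int radius) \<and> (\<forall>j n. R j (t n) = t (n + k * j) \<and> R j (h n) = h (n + k * j))"
    "\<And>j n. R j (t0 n) = t0 (n + 1 * j) \<and> R j (h0 n) = h0 (n + 1 * j)"
    using rotations_exist[OF t0, of 1] by auto
  obtain c where "(\<forall>n. \<tau> (t n) = t (n + c) \<and> \<tau> (h n) = h (n + c)) \<or> (\<forall>n. \<tau> (t n) = t (c - n) \<and> \<tau> (h n) = h (c - 1 - n))"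
    using dihedral_all[OF tau(1) trailD(5)[OF t0] tV t] by blast
  then show ?thesis
  proof
    assume c: "\<forall>n. \<tau> (t n) = t (n + c) \<and> \<tau> (h n) = h (n + c)"
    obtain g where g: "g \<in> G" "\<forall>v\<in>V. g v = R 1 v" using R(1) by blast
    obtain a where a: "a \<in> G" "\<forall>v\<in>V. a v = \<tau> (g v)" using G_comp[OF tau(1) g(1)] by blast
    obtain b where b: "b \<in> G" "\<forall>v\<in>V. b v = g (\<tau> v)" using G_comp[OF g(1) tau(1)] by blast
    obtain k where k: "\<And>j n. R j (t n) = t (n + k * j) \<and> R j (h n) = h (n + k * j)" using R(2)[OF t] by blast
    have inV: "\<tau> v \<in> V" "g v \<in> V" if "v \<in> V" for v using that G_V tau(1) g(1) by auto
    have "\<forall>u\<in>layer (t 0). a u = b u"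
      using a b g k c trailD(5)[OF t] inV unfolding layer_trail[OF t] by (auto simp: algebra_simps)
    from agree_on_class[OF a(1) b(1) trailD(5)[OF t] this trailD(5)[OF t0, of 0]]
    have "\<tau> (R 1 (t0 0)) = R 1 (\<tau> (t0 0))" using a b g trailD(5)[OF t0, of 0] inV by auto
    then have "t0 (- 1) = t0 1" using R(3)[of 1 0] tau(2) by simp
    then have "int radius dvd 2" using t_eq_iff[OF t0, of 1 "-1"] by simp
    then show ?thesis using not_radius_dvd_2 by blast
  qed blast
qed

text \<open>
  For even radius, a reflection that fixes a vertex of some layer has fixed points in every second
  layer only, and this would make the graph bipartite.
\<close>

lemma odd_radius:
  assumes nonbip: "\<And>P :: 'a \<Rightarrow> bool. \<exists>x y. (x, y) \<in> D \<and> (P x \<longleftrightarrow> P y)"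
  shows "odd radius"
proof
  assume ev: "even radius"
  obtain t0 h0 where t0: "trail t0 h0" using trail_at V_ne by blast
  obtain \<tau> where tau: "\<tau> \<in> G" "\<forall>n. \<tau> (t0 n) = t0 (- n) \<and> \<tau> (h0 n) = h0 (- 1 - n)"
    using reflection_exists[OF t0, of 0] by auto
  \<comment> \<open>On tails \<open>\<tau>\<close> is \<open>c - n\<close>, on heads
    \<open>c - 1 - n\<close>. For even radius the former has a fixed point iff \<open>c\<close> is
    even and the latter iff \<open>c\<close> is odd, so a fixed vertex in the layer would be a
    proper 2-colouring.\<close>
  obtain x y where xy: "(x, y) \<in> D" "(\<exists>u\<in>layer x. \<tau> u = u) \<longleftrightarrow> (\<exists>u\<in>layer y. \<tau> u = u)"
    using nonbip[of "\<lambda>x. \<exists>u\<in>layer x. \<tau> u = u"] by blast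
  obtain t h where t: "trail t h" "t 0 = x" "h 0 = y" using trail_exists[OF xy(1)] by blast
  obtain c where c: "\<forall>n. \<tau> (t n) = t (c - n) \<and> \<tau> (h n) = h (c - 1 - n)"
    using reflection_all[OF t0 tau t(1)] by blast
  have r: "even a" if "int radius dvd a" for a using ev that by (meson dvd_trans even_of_nat)
  have "(\<exists>u\<in>layer x. \<tau> u = u) \<longleftrightarrow> (\<exists>n. int radius dvd c - n - n)"
    using c t_eq_iff[OF t(1)] layer_trail[OF t(1), of 0] t by simp
  also have "\<dots> \<longleftrightarrow> even c"
  proof
    assume "\<exists>n. int radius dvd c - n - n"
    then obtain n where "even (c - n - n)" using r by blast
    then show "even c" by presburger
  next
    assume "even c"
    then obtain n where "c = 2 * n" by (elim evenE)
    then show "\<exists>n. int radius dvd c - n - n" by (intro exI[of _ n]) simp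
  qed
  finally have 1: "(\<exists>u\<in>layer x. \<tau> u = u) \<longleftrightarrow> even c" .
  have "(\<exists>u\<in>layer y. \<tau> u = u) \<longleftrightarrow> (\<exists>n. int radius dvd c - 1 - n - n)"
    using c h_eq_iff[OF t(1)] layer_trail_head[OF t(1), of 0] t by simp
  also have "\<dots> \<longleftrightarrow> odd c"
  proof
    assume "\<exists>n. int radius dvd c - 1 - n - n"
    then obtain n where "even (c - 1 - n - n)" using r by blast
    then show "odd c" by presburger
  next
    assume "odd c"
    then obtain n where "c = 2 * n + 1" by (elim oddE)
    then show "\<exists>n. int radius dvd c - 1 - n - n" by (intro exI[of _ n]) simp
  qed
  finally show False using 1 xy(2) by blast
qed

text \<open>\<open>P i j\<close> is \<open>R j\<close> applied to the vertex of the
  \<open>i\<close>-th layer that \<open>\<tau>\<close> fixes. Conjugation by \<open>\<sigma>\<close>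
  turns \<open>R j\<close> into \<open>R (q * j)\<close>, which is where the powers of
  \<open>q\<close> come from. The absence of a 2-colouring is used for the odd radius.\<close>

lemma labelling:
  assumes nonbip: "\<And>P :: 'a \<Rightarrow> bool. \<exists>x y. (x, y) \<in> D \<and> (P x \<longleftrightarrow> P y)"
  obtains m q and P :: "nat \<Rightarrow> int \<Rightarrow> 'a" where "m > 0" "odd radius"
    "int radius dvd q ^ m - 1 \<or> int radius dvd q ^ m + 1"
    "\<And>i j i' j'. P i j = P i' j' \<longleftrightarrow> i mod m = i' mod m \<and> int radius dvd j - j'"
    "\<And>i j. P i j \<in> V" "\<And>v. v \<in> V \<Longrightarrow> \<exists>i j. v = P i j"
    "\<And>i j w. (P i j, w) \<in> D \<longleftrightarrow> w = P (Suc i) (j + q ^ i) \<or> w = P (Suc i) (j - q ^ i)"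
proof -
  have odd: "odd radius" by (rule odd_radius[OF nonbip])
  have dvd2: "int radius dvd a" if "int radius dvd 2 * a" for a
    using that odd by (simp add: coprime_dvd_mult_right_iff)
  define u where "u = (int radius - 1) div 2"
  have u: "2 * u + 1 = int radius" using odd by (simp add: u_def)
  \<comment> \<open>Modulo the radius, \<open>s\<close> is 1/2 and \<open>u\<close> is -1/2, so the two heads at \<open>y0\<close> are \<open>R 1 y1\<close> and \<open>R (-1) y1\<close>.\<close>
  define s where "s = u + 1"
  have s: "coprime s (int radius)"
  proof -
    have "2 * s - int radius = 1" using u by (simp add: s_def)
    then show ?thesis by (metis coprime_def dvd_diff dvd_mult)
  qed
  obtain t0 h0 where t0: "trail t0 h0" using trail_at V_ne by blast
  obtain R where R_G: "\<And>j. \<exists>g\<in>G. \<forall>v\<in>V. g v = R j v"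
    and R_trail: "\<And>t h. trail t h \<Longrightarrow> \<exists>k. coprime k (int radius) \<and> (\<forall>j n. R j (t n) = t (n + k * j) \<and> R j (h n) = h (n + k * j))"
    and R0: "\<And>j n. R j (t0 n) = t0 (n + s * j) \<and> R j (h0 n) = h0 (n + s * j)"
    using rotations_exist[OF t0 s] by blast
  obtain \<tau> where tau: "\<tau> \<in> G" "\<forall>n. \<tau> (t0 n) = t0 (- n) \<and> \<tau> (h0 n) = h0 (- 1 - n)"
    using reflection_exists[OF t0, of 0] by auto
  \<comment> \<open>\<open>\<tau>\<close> sends the index \<open>n\<close> of a head to
    \<open>- 1 - n\<close>, and modulo the radius the solution of \<open>n = - 1 - n\<close> is
    \<open>u\<close>.\<close>
  define y0 y1 where "y0 = t0 0" and "y1 = h0 u"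
  have y: "y0 \<in> V" "y1 \<in> V" using trailD[OF t0] by (simp_all add: y0_def y1_def)
  have tau_y: "\<tau> y0 = y0" "\<tau> y1 = y1"
  proof -
    have "- 1 - u - u = - int radius" using u by simp
    then have "int radius dvd - 1 - u - u" by simp
    then show "\<tau> y0 = y0" "\<tau> y1 = y1" using tau(2) h_eq_iff[OF t0] by (simp_all add: y0_def y1_def)
  qed
  \<comment> \<open>Vertex-transitivity offers many elements that lead to the next layer; one that
    maps a fixed vertex of \<open>\<tau>\<close> to a fixed vertex commutes with
    \<open>\<tau>\<close>.\<close>
  obtain \<sigma> where sig: "\<sigma> \<in> G" "\<sigma> y0 = y1" using V_trans[OF y] by blast
  define t1 h1 where "t1 = (\<lambda>n. \<sigma> (t0 n))" and "h1 = (\<lambda>n. \<sigma> (h0 n))"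
  have t1: "trail t1 h1" using trail_image[OF sig(1) t0] by (simp add: t1_def h1_def)
  have V_act: "\<tau> v \<in> V" "\<sigma> v \<in> V" "R j v \<in> V" if "v \<in> V" for v j
    using that G_V tau(1) sig(1) R_G[of j] by metis+

  have R_at: "\<exists>t h k. trail t h \<and> t 0 = v \<and> coprime k (int radius) \<and> (\<forall>j n. R j (t n) = t (n + k * j) \<and> R j (h n) = h (n + k * j))"
    if "v \<in> V" for v using trail_at[OF that] R_trail by metis
  have R_add: "R i (R j v) = R (i + j) v" if "v \<in> V" for v i j
  proof -
    obtain t h k where t: "t 0 = v" and k: "\<forall>j n. R j (t n) = t (n + k * j)" using R_at[OF \<open>v \<in> V\<close>] by blast
    have "R i (R j (t 0)) = R (i + j) (t 0)" by (simp add: k algebra_simps)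
    then show ?thesis by (simp add: t)
  qed
  have R_eq: "R i v = R j v \<longleftrightarrow> int radius dvd i - j" if "v \<in> V" for v i j
  proof -
    obtain t h k where t: "trail t h" "t 0 = v" and k: "coprime k (int radius)" "\<forall>j n. R j (t n) = t (n + k * j)"
      using R_at[OF \<open>v \<in> V\<close>] by blast
    have "R i v = R j v \<longleftrightarrow> int radius dvd k * (i - j)"
      using k(2) t_eq_iff[OF t(1), of "k * i" "k * j"] t(2)[symmetric] by (simp add: algebra_simps)
    then show ?thesis using k(1) by (simp add: coprime_dvd_mult_right_iff coprime_commute)
  qed
  have R_0: "R 0 v = v" if "v \<in> V" for v
  proof -
    obtain t h k where t: "trail t h" "t 0 = v" and k: "\<forall>j n. R j (t n) = t (n + k * j)" using R_at[OF \<open>v \<in> V\<close>] by blast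
    have "R 0 (t 0) = t (0 + k * 0)" using k by blast
    then show ?thesis by (simp add: t)
  qed
  have layer_R: "w \<in> layer v \<longleftrightarrow> (\<exists>j. w = R j v)" if "v \<in> V" for v w
  proof -
    obtain t h k where t: "trail t h" "t 0 = v" and k: "coprime k (int radius)" "\<forall>j n. R j (t n) = t (n + k * j)"
      using R_at[OF \<open>v \<in> V\<close>] by blast
    have "\<exists>j. t n = R j v" for n
    proof -
      obtain x where "[k * x = 1] (mod int radius)" using k(1) cong_solve_coprime_int by blast
      then have "[k * (x * n) = n] (mod int radius)" by (metis cong_scalar_right mult.assoc mult_1)
      then have "int radius dvd k * (x * n) - n" by (simp add: cong_iff_dvd_diff)
      then have "t (k * (x * n)) = t n" using t_eq_iff[OF t(1)] by blast
      then have "R (x * n) v = t n" using k(2) t(2)[symmetric] by simp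
      then show ?thesis by metis
    qed
    moreover have "R j v \<in> range t" for j using k(2) t(2)[symmetric] by simp
    ultimately show ?thesis using layer_trail[OF t(1), of 0] t(2) by auto
  qed
  have R_D: "(v, w) \<in> D \<Longrightarrow> (R j v, R j w) \<in> D" for v w j
    using R_G[of j] G_D D_verts by metis
  have tau_R: "\<tau> (R j v) = R (- j) (\<tau> v)" if v: "v \<in> V" for v j
  proof -
    obtain g where g: "g \<in> G" "\<forall>v\<in>V. g v = R j v" using R_G by blast
    obtain g' where g': "g' \<in> G" "\<forall>v\<in>V. g' v = R (- j) v" using R_G by blast
    obtain a where a: "a \<in> G" "\<forall>v\<in>V. a v = \<tau> (g v)" using G_comp[OF tau(1) g(1)] by blast
    obtain b where b: "b \<in> G" "\<forall>v\<in>V. b v = g' (\<tau> v)" using G_comp[OF g'(1) tau(1)] by blast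
    have "\<forall>u\<in>layer (t0 0). a u = b u"
    proof
      fix u assume "u \<in> layer (t0 0)"
      then obtain n where n: "u = t0 n" using layer_trail[OF t0] by auto
      have "\<tau> (R j (t0 n)) = R (- j) (\<tau> (t0 n))" using R0 tau(2) by (simp add: algebra_simps)
      then show "a u = b u" using a b g g' n trailD(5)[OF t0] V_act by simp
    qed
    from agree_on_class[OF a(1) b(1) trailD(5)[OF t0] this v]
    show ?thesis using a b g g' v V_act by simp
  qed
  \<comment> \<open>\<open>\<tau>\<close> inverts \<open>R\<close>, so a second fixed vertex
    \<open>R j v\<close> has \<open>2 * j = 0\<close> modulo the radius, and the radius is
    odd.\<close>
  have tau_fixed_unique: "w = v" if v: "v \<in> V" "\<tau> v = v" and w: "w \<in> layer v" "\<tau> w = w" for v w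
  proof -
    obtain j where j: "w = R j v" using layer_R[OF v(1)] w(1) by blast
    then have "R (- j) v = R j v" using tau_R[OF v(1)] v(2) w(2) by simp
    then have "int radius dvd - j - j" using R_eq[OF v(1)] by blast
    then have "int radius dvd j" using dvd2[of j] by (metis dvd_minus_iff minus_diff_eq diff_minus_eq_add mult_2)
    then show ?thesis using j R_eq[OF v(1), of j 0] R_0[OF v(1)] by simp
  qed
  have sig_tau: "\<sigma> (\<tau> v) = \<tau> (\<sigma> v)" if v: "v \<in> V" for v
  proof -
    obtain a where a: "a \<in> G" "\<forall>v\<in>V. a v = \<sigma> (\<tau> v)" using G_comp[OF sig(1) tau(1)] by blast
    obtain b where b: "b \<in> G" "\<forall>v\<in>V. b v = \<tau> (\<sigma> v)" using G_comp[OF tau(1) sig(1)] by blast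
    \<comment> \<open>\<open>\<tau>\<close> reflects the image trail \<open>t1\<close> too. Since it
      fixes \<open>t1 0 = y1\<close>, the centre \<open>c\<close> vanishes modulo the radius, and
      the identity becomes index arithmetic on the layer of \<open>t0\<close>.\<close>
    obtain c where c: "\<forall>n. \<tau> (t1 n) = t1 (c - n) \<and> \<tau> (h1 n) = h1 (c - 1 - n)" using reflection_all[OF t0 tau t1] by blast
    have "t1 c = t1 0" using spec[OF c, of 0] tau_y sig(2) by (simp add: t1_def y0_def)
    then have "int radius dvd c" using t_eq_iff[OF t1] by (metis diff_zero)
    then have "t1 (c - n) = t1 (- n)" for n using t_eq_iff[OF t1] by simp
    then have "\<sigma> (\<tau> (t0 n)) = \<tau> (\<sigma> (t0 n))" for n using c tau(2) by (simp add: t1_def)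
    then have "\<forall>u\<in>layer (t0 0). a u = b u" using a b trailD(5)[OF t0] unfolding layer_trail[OF t0] by auto
    from agree_on_class[OF a(1) b(1) trailD(5)[OF t0] this v] show ?thesis using a b v by simp
  qed
  \<comment> \<open>\<open>R\<close> advances \<open>t0\<close> by \<open>s\<close> and
    \<open>t1\<close>, the image of \<open>t0\<close> under \<open>\<sigma>\<close>, by some unit
    \<open>k\<close>. Hence \<open>q\<close> is \<open>s / k\<close> modulo the radius.\<close>
  obtain q where q: "coprime q (int radius)" and sig_R: "\<And>v j. v \<in> V \<Longrightarrow> \<sigma> (R j v) = R (q * j) (\<sigma> v)"
  proof -
    obtain k where k: "coprime k (int radius)" "\<And>j n. R j (t1 n) = t1 (n + k * j) \<and> R j (h1 n) = h1 (n + k * j)"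
      using R_trail[OF t1] by blast
    obtain x where x: "[k * x = 1] (mod int radius)" using k(1) cong_solve_coprime_int by blast
    define q where "q = x * s"
    have kq: "[k * q = s] (mod int radius)" using cong_scalar_right[OF x, of s] by (simp add: q_def mult.assoc)
    have "coprime x (int radius)" using x by (metis coprime_iff_invertible_int mult.commute)
    then have "coprime q (int radius)" using s by (simp add: q_def)
    moreover have "\<sigma> (R j v) = R (q * j) (\<sigma> v)" if v: "v \<in> V" for v j
    proof -
      obtain g where g: "g \<in> G" "\<forall>v\<in>V. g v = R j v" using R_G by blast
      obtain g' where g': "g' \<in> G" "\<forall>v\<in>V. g' v = R (q * j) v" using R_G by blast
      obtain a where a: "a \<in> G" "\<forall>v\<in>V. a v = \<sigma> (g v)" using G_comp[OF sig(1) g(1)] by blast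
      obtain b where b: "b \<in> G" "\<forall>v\<in>V. b v = g' (\<sigma> v)" using G_comp[OF g'(1) sig(1)] by blast
      have "\<sigma> (R j (t0 n)) = R (q * j) (\<sigma> (t0 n))" for n
      proof -
        have "int radius dvd (k * q - s) * j" using kq by (simp add: cong_iff_dvd_diff)
        then have "t1 (n + k * (q * j)) = t1 (n + s * j)" using t_eq_iff[OF t1] by (simp add: algebra_simps)
        then show ?thesis using k(2)[of "q * j" n] R0 by (simp add: t1_def)
      qed
      then have "\<forall>u\<in>layer (t0 0). a u = b u"
        using a b g g' trailD(5)[OF t0] V_act unfolding layer_trail[OF t0] by auto
      from agree_on_class[OF a(1) b(1) trailD(5)[OF t0] this v] show ?thesis using a b g g' v V_act by simp
    qed
    ultimately show ?thesis using that by blast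
  qed

  define Y where "Y i = (\<sigma> ^^ i) y0" for i
  have Y_Suc: "Y (Suc i) = \<sigma> (Y i)" for i by (simp add: Y_def)
  have Y_V: "Y i \<in> V" for i by (induction i) (use y V_act in \<open>auto simp: Y_def\<close>)
  have Y_01: "Y 0 = y0" "Y 1 = y1" using sig by (simp_all add: Y_def)
  have Y_tau: "\<tau> (Y i) = Y i" for i
  proof (induction i)
    case (Suc i)
    then show ?case using sig_tau[OF Y_V[of i]] by (simp add: Y_Suc)
  qed (use Y_01 tau_y in simp)
  \<comment> \<open>At the start the heads at \<open>y0\<close> have indices 0 and -1, which are
    \<open>u + s\<close> and \<open>u - s\<close> modulo the radius. Each application of
    \<open>\<sigma>\<close> multiplies the exponents of \<open>R\<close> by
    \<open>q\<close>.\<close>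
  have D_Y: "(Y i, R (q ^ i) (Y (Suc i))) \<in> D \<and> (Y i, R (- (q ^ i)) (Y (Suc i))) \<in> D" for i
  proof (induction i)
    case 0
    have "h0 (u + s) = h0 0" using u h_eq_iff[OF t0, of "u + s" 0] by (simp add: s_def)
    moreover have "h0 (u - s) = h0 (- 1)" by (simp add: s_def)
    ultimately have "R 1 y1 = h0 0" "R (- 1) y1 = h0 (- 1)" using R0[of _ u] by (simp_all add: y1_def)
    then show ?case using trailD(1)[OF t0, of 0] trailD(7)[OF t0, of 0] Y_01 by (simp add: y0_def)
  next
    case (Suc i)
    then have "(\<sigma> (Y i), \<sigma> (R (q ^ i) (Y (Suc i)))) \<in> D" "(\<sigma> (Y i), \<sigma> (R (- (q ^ i)) (Y (Suc i)))) \<in> D"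
      using G_D[OF sig(1)] by auto
    then show ?case using sig_R[OF Y_V[of "Suc i"]] by (simp add: Y_Suc)
  qed
  have arcs1: "(R j (Y i), R (j + q ^ i) (Y (Suc i))) \<in> D" "(R j (Y i), R (j - q ^ i) (Y (Suc i))) \<in> D" for i j
    using R_D[of "Y i" _ j] D_Y[of i] R_add[OF Y_V] by fastforce+
  have q_pow: "coprime (q ^ i) (int radius)" for i using q by simp
  have ne: "\<not> int radius dvd 2 * q ^ i" for i
  proof
    assume "int radius dvd 2 * q ^ i"
    then have "int radius dvd 2" using q_pow[of i] by (simp add: coprime_dvd_mult_left_iff coprime_commute)
    then show False using not_radius_dvd_2 by blast
  qed
  have out_arcs: "(R j (Y i), w) \<in> D \<longleftrightarrow> w = R (j + q ^ i) (Y (Suc i)) \<or> w = R (j - q ^ i) (Y (Suc i))" for i j w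
  proof -
    have "R (j + q ^ i) (Y (Suc i)) \<noteq> R (j - q ^ i) (Y (Suc i))" using ne[of i] R_eq[OF Y_V] by simp
    then show ?thesis using arcs1[of j i] out_unique by metis
  qed
  have in_arcs: "(w, R j (Y (Suc i))) \<in> D \<longleftrightarrow> w = R (j + q ^ i) (Y i) \<or> w = R (j - q ^ i) (Y i)" for i j w
  proof -
    have "R (j + q ^ i) (Y i) \<noteq> R (j - q ^ i) (Y i)" using ne[of i] R_eq[OF Y_V] by simp
    moreover have "(R (j + q ^ i) (Y i), R j (Y (Suc i))) \<in> D" "(R (j - q ^ i) (Y i), R j (Y (Suc i))) \<in> D"
      using arcs1(2)[of "j + q ^ i" i] arcs1(1)[of "j - q ^ i" i] by simp_all
    ultimately show ?thesis using in_unique by metis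
  qed
  have pow_inj: "(\<sigma> ^^ a) v = (\<sigma> ^^ a) w \<Longrightarrow> v = w" if "v \<in> V" "w \<in> V" for a v w
    using G_funpow[OF sig(1), of a] G_inj that by metis
  have Y_add: "Y (a + b) = (\<sigma> ^^ a) (Y b)" for a b by (simp add: Y_def funpow_add)
  have per: "\<exists>m>0. Y m = Y 0"
  proof -
    have "\<not> inj Y" using finite_V Y_V by (metis finite_subset image_subsetI infinite_UNIV_nat finite_imageD)
    then obtain a b where "Y a = Y b" "a < b" by (metis injI linorder_neqE_nat)
    then have "Y (a + 0) = Y (a + (b - a))" by simp
    then have "Y 0 = Y (b - a)" using pow_inj[OF Y_V Y_V] unfolding Y_add by blast
    then show ?thesis using \<open>a < b\<close> by (metis zero_less_diff)
  qed
  define m where "m = (LEAST m. m > 0 \<and> Y m = Y 0)"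
  have m: "m > 0" "Y m = Y 0" using LeastI_ex[OF per] by (simp_all add: m_def)
  have Y_m: "Y (i + m) = Y i" for i using Y_add[of i m] Y_add[of i 0] m(2) by simp
  have "Y (i + m * k) = Y i" for i k
    by (induction k) (use Y_m in \<open>simp_all add: add.assoc[symmetric]\<close>, metis Y_m add.assoc add.commute)
  then have Y_mod: "Y (i mod m) = Y i" for i by (metis mod_mult_div_eq)
  have Y_inj: "Y i = Y i' \<longleftrightarrow> i mod m = i' mod m" for i i'
  proof
    have *: "\<not> (a < b \<and> b < m \<and> Y a = Y b)" for a b
    proof
      assume ab: "a < b \<and> b < m \<and> Y a = Y b"
      then have "Y (a + 0) = Y (a + (b - a))" by simp
      then have "Y (b - a) = Y 0" using pow_inj[OF Y_V Y_V] unfolding Y_add by metis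
      moreover have "b - a < m" "b - a > 0" using ab by linarith+
      ultimately show False using not_less_Least[of "b - a" "\<lambda>m. m > 0 \<and> Y m = Y 0"] by (simp add: m_def[symmetric])
    qed
    assume "Y i = Y i'"
    then have "Y (i mod m) = Y (i' mod m)" using Y_mod by simp
    then show "i mod m = i' mod m" using *[of "i mod m" "i' mod m"] *[of "i' mod m" "i mod m"] m(1)
      by (metis linorder_neqE_nat mod_less_divisor)
  qed (metis Y_mod)
  define P where "P i j = R j (Y i)" for i j
  have P_eq: "P i j = P i' j' \<longleftrightarrow> i mod m = i' mod m \<and> int radius dvd j - j'" for i j i' j'
  proof
    assume eq: "P i j = P i' j'"
    then have "R (j' - j) (Y i') = R (- j) (R j' (Y i'))" using R_add[OF Y_V[of i']] by simp
    also have "\<dots> = R (- j) (R j (Y i))" using eq by (simp add: P_def)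
    also have "\<dots> = Y i" using R_add[OF Y_V[of i]] R_0[OF Y_V] by simp
    finally have "Y i \<in> layer (Y i')" using layer_R[OF Y_V] by metis
    \<comment> \<open>This is where the fixed points pay off: two of them in the same layer are
      equal, so no shift can occur when the layers close up.\<close>
    then have "Y i = Y i'" using tau_fixed_unique[OF Y_V Y_tau _ Y_tau] by blast
    moreover from this have "R j (Y i) = R j' (Y i)" using eq by (simp add: P_def)
    ultimately show "i mod m = i' mod m \<and> int radius dvd j - j'" using Y_inj R_eq[OF Y_V] by blast
  next
    assume "i mod m = i' mod m \<and> int radius dvd j - j'"
    then show "P i j = P i' j'" using Y_inj[of i i'] R_eq[OF Y_V] by (simp add: P_def)
  qed
  have P_V: "P i j \<in> V" for i j using V_act(3)[OF Y_V] by (simp add: P_def)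
  have P_surj: "\<exists>i j. v = P i j" if v: "v \<in> V" for v
  proof (rule D_induct[of "P 0 0" "\<lambda>v. \<exists>i j. v = P i j" v])
    show "\<exists>i j. y = P i j" if "\<exists>i j. x = P i j" "(x, y) \<in> D" for x y
      using that out_arcs by (auto simp: P_def) blast+
    show "\<exists>i j. x = P i j" if ex: "\<exists>i j. y = P i j" and xy: "(x, y) \<in> D" for x y
    proof -
      obtain i j where "y = P i j" using ex by blast
      \<comment> \<open>Adding \<open>m\<close> provides a predecessor index also for
        \<open>i = 0\<close>.\<close>
      then have "y = R j (Y (Suc (i + m - 1)))" using Y_m m(1) by (simp add: P_def)
      then show ?thesis using xy in_arcs unfolding P_def by metis
    qed
  qed (use P_V v in auto)
  \<comment> \<open>After one turn \<open>Y m = Y 0\<close>, so the pair of out-neighbours at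
    exponents \<open>q ^ m\<close> and \<open>- (q ^ m)\<close> is the pair at 1 and -1.\<close>
  have "R (q ^ m) (Y 1) = R 1 (Y 1) \<or> R (q ^ m) (Y 1) = R (- 1) (Y 1)"
  proof -
    have "Y (Suc m) = Y 1" using Y_m[of 1] by simp
    then have "(Y 0, R (q ^ m) (Y 1)) \<in> D" using D_Y[of m] m(2) by simp
    then show ?thesis using out_arcs[of 0 0] R_0[OF Y_V] by simp
  qed
  then have "int radius dvd q ^ m - 1 \<or> int radius dvd q ^ m + 1" using R_eq[OF Y_V] by simp
  then show ?thesis using that[OF m(1) odd _ P_eq P_V P_surj] out_arcs unfolding P_def by blast
qed

end

section \<open>Half-arc-transitive groups on tetravalent graphs\<close>

locale connected_graph =
  fixes \<Gamma> :: "'a pair_pre_digraph"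
  assumes graph: "pair_graph \<Gamma>" and conn: "Digraph_Component.connected (with_proj \<Gamma>)"
begin

lemma finite_verts: "finite (pverts \<Gamma>)" and finite_arcs: "finite (parcs \<Gamma>)"
  using graph by (simp_all add: pair_graph_def pair_digraph_def pair_fin_digraph_def pair_fin_digraph_axioms_def)

lemma wf: "pair_wf_digraph \<Gamma>"
  using graph by (simp add: pair_graph_def pair_digraph_def pair_fin_digraph_def)

lemma arc_verts: "(u, v) \<in> parcs \<Gamma> \<Longrightarrow> u \<in> pverts \<Gamma> \<and> v \<in> pverts \<Gamma>"
  using pair_wf_digraph.in_arcsD1[OF wf] pair_wf_digraph.in_arcsD2[OF wf] by blast

lemma no_loop: "(u, u) \<notin> parcs \<Gamma>"
  using graph pair_loopfree_digraph.no_loops' unfolding pair_graph_def pair_digraph_def by metis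

lemma arc_sym: "(u, v) \<in> parcs \<Gamma> \<Longrightarrow> (v, u) \<in> parcs \<Gamma>"
  using graph pair_sym_digraph.arcs_symmetric unfolding pair_graph_def pair_pseudo_graph_def by metis

lemma verts_ne: "pverts \<Gamma> \<noteq> {}"
  using conn by (simp add: connected_conv)

lemma connected_induct:
  assumes "u \<in> pverts \<Gamma>" "P u" "\<And>x y. P x \<Longrightarrow> (x, y) \<in> parcs \<Gamma> \<Longrightarrow> P y" "v \<in> pverts \<Gamma>"
  shows "P v"
proof -
  have "(u, v) \<in> rtrancl_on (pverts \<Gamma>) ((parcs \<Gamma>)\<^sup>s)" using conn assms(1,4) by (simp add: connected_conv)
  then show ?thesis
    by (induction rule: rtrancl_on_induct) (use assms(2,3) arc_sym in \<open>auto simp: symcl_def\<close>)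
qed

section \<open>The automorphism group, its subgroups and pointwise composition\<close>

lemma subgroup_graph_auto: "subgroup (graph_auto \<Gamma>) (BijGroup (pverts \<Gamma>))"
proof (rule group.subgroupI[OF group_BijGroup])
  let ?V = "pverts \<Gamma>"
  have mem: "f v \<in> ?V" if "f \<in> graph_auto \<Gamma>" "v \<in> ?V" for f v
    using that bij_betwE by (force simp: graph_auto_def Bij_def)
  show "graph_auto \<Gamma> \<subseteq> carrier (BijGroup ?V)" by (auto simp: graph_auto_def BijGroup_def)
  have "(\<lambda>x\<in>?V. x) \<in> graph_auto \<Gamma>" using id_Bij by (auto simp: graph_auto_def)
  then show "graph_auto \<Gamma> \<noteq> {}" by blast
  show "inv\<^bsub>BijGroup ?V\<^esub> f \<in> graph_auto \<Gamma>" if f: "f \<in> graph_auto \<Gamma>" for f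
  proof -
    have B: "f \<in> Bij ?V" using f by (simp add: graph_auto_def)
    then have bij: "bij_betw f ?V ?V" by (simp add: Bij_def)
    have "(inv_into ?V f u, inv_into ?V f v) \<in> parcs \<Gamma> \<longleftrightarrow> (u, v) \<in> parcs \<Gamma>" if "u \<in> ?V" "v \<in> ?V" for u v
    proof -
      have "inv_into ?V f u \<in> ?V" "inv_into ?V f v \<in> ?V" using Bij_inv_into_mem[OF B] that by auto
      moreover have "f (inv_into ?V f u) = u" "f (inv_into ?V f v) = v" using bij_betw_inv_into_right[OF bij] that by auto
      ultimately show ?thesis using f unfolding graph_auto_def by (metis (mono_tags, lifting) mem_Collect_eq)
    qed
    then show ?thesis using restrict_inv_into_Bij[OF B] by (simp add: inv_BijGroup[OF B] graph_auto_def)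
  qed
  show "f \<otimes>\<^bsub>BijGroup ?V\<^esub> g \<in> graph_auto \<Gamma>" if "f \<in> graph_auto \<Gamma>" "g \<in> graph_auto \<Gamma>" for f g
    using that mem compose_Bij by (auto simp: graph_auto_def BijGroup_def compose_eq)
qed

lemma group_Aut: "group (Aut \<Gamma>)"
  unfolding Aut_def by (rule subgroup.subgroup_is_group[OF subgroup_graph_auto group_BijGroup])

lemma carrier_Aut: "carrier (Aut \<Gamma>) = graph_auto \<Gamma>"
  by (simp add: Aut_def)

lemma auto_mem: "f \<in> graph_auto \<Gamma> \<Longrightarrow> v \<in> pverts \<Gamma> \<Longrightarrow> f v \<in> pverts \<Gamma>"
  using bij_betwE by (force simp: graph_auto_def Bij_def)

lemma auto_arc_iff:
  "f \<in> graph_auto \<Gamma> \<Longrightarrow> u \<in> pverts \<Gamma> \<Longrightarrow> v \<in> pverts \<Gamma> \<Longrightarrow> (f u, f v) \<in> parcs \<Gamma> \<longleftrightarrow> (u, v) \<in> parcs \<Gamma>"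
  by (simp add: graph_auto_def)

lemma auto_inj: "f \<in> graph_auto \<Gamma> \<Longrightarrow> u \<in> pverts \<Gamma> \<Longrightarrow> v \<in> pverts \<Gamma> \<Longrightarrow> f u = f v \<longleftrightarrow> u = v"
  by (auto simp: graph_auto_def Bij_def bij_betw_def inj_on_def)

lemma auto_surj: "f \<in> graph_auto \<Gamma> \<Longrightarrow> v \<in> pverts \<Gamma> \<Longrightarrow> \<exists>u\<in>pverts \<Gamma>. f u = v"
  by (simp add: graph_auto_def Bij_def bij_betw_def) (metis imageE)

lemma restrict_auto:
  assumes "bij_betw f (pverts \<Gamma>) (pverts \<Gamma>)"
    and "\<And>u v. u \<in> pverts \<Gamma> \<Longrightarrow> v \<in> pverts \<Gamma> \<Longrightarrow> (f u, f v) \<in> parcs \<Gamma> \<longleftrightarrow> (u, v) \<in> parcs \<Gamma>"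
  shows "restrict f (pverts \<Gamma>) \<in> graph_auto \<Gamma>"
  using assms by (simp add: graph_auto_def Bij_def)

lemma subgroup_comp:
  assumes "subgroup G (Aut \<Gamma>)" "g \<in> G" "h \<in> G"
  shows "\<exists>k\<in>G. \<forall>v\<in>pverts \<Gamma>. k v = g (h v)"
proof -
  have sub: "G \<subseteq> graph_auto \<Gamma>" using subgroup.subset[OF assms(1)] carrier_Aut by simp
  then have "g \<in> Bij (pverts \<Gamma>)" "h \<in> Bij (pverts \<Gamma>)" using assms by (auto simp: graph_auto_def)
  then have "\<forall>v\<in>pverts \<Gamma>. (g \<otimes>\<^bsub>Aut \<Gamma>\<^esub> h) v = g (h v)" by (simp add: Aut_def BijGroup_def compose_eq)
  then show ?thesis using subgroup.m_closed[OF assms] by blast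
qed

lemma subgroup_inv:
  assumes "subgroup G (Aut \<Gamma>)" "g \<in> G"
  shows "\<exists>k\<in>G. \<forall>v\<in>pverts \<Gamma>. k (g v) = v \<and> g (k v) = v"
proof -
  interpret group "Aut \<Gamma>" by (rule group_Aut)
  let ?k = "inv\<^bsub>Aut \<Gamma>\<^esub> g"
  have sub: "G \<subseteq> graph_auto \<Gamma>" using subgroup.subset[OF assms(1)] carrier_Aut by simp
  have k: "?k \<in> G" by (rule subgroup.m_inv_closed[OF assms])
  then have B: "g \<in> Bij (pverts \<Gamma>)" "?k \<in> Bij (pverts \<Gamma>)" using assms sub by (auto simp: graph_auto_def)
  have g: "g \<in> carrier (Aut \<Gamma>)" using assms(2) sub carrier_Aut by auto
  have "?k (g v) = v \<and> g (?k v) = v" if v: "v \<in> pverts \<Gamma>" for v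
  proof -
    have "(?k \<otimes>\<^bsub>Aut \<Gamma>\<^esub> g) v = \<one>\<^bsub>Aut \<Gamma>\<^esub> v" "(g \<otimes>\<^bsub>Aut \<Gamma>\<^esub> ?k) v = \<one>\<^bsub>Aut \<Gamma>\<^esub> v"
      using l_inv[OF g] r_inv[OF g] by simp_all
    then show ?thesis using v B by (simp add: Aut_def BijGroup_def compose_eq)
  qed
  then show ?thesis using k by blast
qed

text \<open>Replaces the recursive walk predicates by conditions on cyclic indices. Distinctness may
  be moved from heads to tails because the list of heads is the rotated list of tails.\<close>

lemma graph_cycle_iff:
  "graph_cycle \<Gamma> p \<longleftrightarrow> 3 \<le> length p \<and> set p \<subseteq> parcs \<Gamma> \<and> distinct (map fst p) \<and>
     (\<forall>k<length p. snd (p ! k) = fst (p ! (Suc k mod length p)))"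
proof (cases "3 \<le> length p")
  case True
  then have ne: "p \<noteq> []" by auto
  have all0: "(\<forall>k. Q k) \<longleftrightarrow> Q 0 \<and> (\<forall>k. Q (Suc k))" for Q :: "nat \<Rightarrow> bool" by (metis not0_implies_Suc)
  have cas: "pcas u p v \<longleftrightarrow> fst (hd p) = u \<and> snd (last p) = v \<and> (\<forall>k. Suc k < length p \<longrightarrow> snd (p ! k) = fst (p ! Suc k))"
    if "p \<noteq> []" for u v and p :: "('a \<times> 'a) list"
    using that
  proof (induction p arbitrary: u)
    case (Cons e p)
    show ?case
    proof (cases "p = []")
      case False
      have "(\<forall>k. Suc k < length (e # p) \<longrightarrow> snd ((e # p) ! k) = fst ((e # p) ! Suc k)) \<longleftrightarrow>
          snd e = fst (hd p) \<and> (\<forall>k. Suc k < length p \<longrightarrow> snd (p ! k) = fst (p ! Suc k))"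
        using False by (subst all0) (auto simp: hd_conv_nth)
      then show ?thesis using Cons.IH[OF False, of "snd e"] False by auto
    qed auto
  qed simp
  have wrap: "(\<forall>k<length p. snd (p ! k) = fst (p ! (Suc k mod length p))) \<longleftrightarrow>
      fst (hd p) = snd (last p) \<and> (\<forall>k. Suc k < length p \<longrightarrow> snd (p ! k) = fst (p ! Suc k))"
    (is "?L \<longleftrightarrow> ?R")
  proof
    assume L: ?L
    then have "snd (p ! (length p - 1)) = fst (p ! (Suc (length p - 1) mod length p))" using ne by simp
    then show ?R using L ne by (auto simp: hd_conv_nth last_conv_nth)
  next
    assume R: ?R
    show ?L
    proof (intro allI impI)
      fix k assume k: "k < length p"
      show "snd (p ! k) = fst (p ! (Suc k mod length p))"
      proof (cases "Suc k = length p")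
        case True
        then have "k = length p - 1" by simp
        then show ?thesis using R ne True by (simp add: hd_conv_nth last_conv_nth)
      qed (use R k in auto)
    qed
  qed
  have rot: "map snd p = rotate1 (map fst p)" if "\<forall>k<length p. snd (p ! k) = fst (p ! (Suc k mod length p))"
    by (rule nth_equalityI) (use that ne in \<open>auto simp: nth_rotate1\<close>)
  have "graph_cycle \<Gamma> p \<longleftrightarrow> (\<exists>u. u \<in> pverts \<Gamma> \<and> set p \<subseteq> parcs \<Gamma> \<and> pcas u p u \<and> distinct (tl (pawalk_verts u p)))"
    using True ne by (auto simp: graph_cycle_def pre_digraph.cycle_def pre_digraph.awalk_def cas_with_proj_eq awalk_verts_with_proj_eq)
  also have "\<dots> \<longleftrightarrow> (\<exists>u. u \<in> pverts \<Gamma> \<and> set p \<subseteq> parcs \<Gamma> \<and> pcas u p u \<and> distinct (map snd p))"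
  proof -
    have "tl (pawalk_verts u p) = map snd p" if "pcas u p u" for u
      using pre_digraph.awalk_verts_conv'[of "with_proj \<Gamma>" u p u] that ne
      by (simp add: cas_with_proj_eq awalk_verts_with_proj_eq)
    then show ?thesis by metis
  qed
  also have "\<dots> \<longleftrightarrow> set p \<subseteq> parcs \<Gamma> \<and> fst (hd p) = snd (last p) \<and>
      (\<forall>k. Suc k < length p \<longrightarrow> snd (p ! k) = fst (p ! Suc k)) \<and> distinct (map snd p)"
  proof -
    have "fst (hd p) \<in> pverts \<Gamma>" if "set p \<subseteq> parcs \<Gamma>"
      using that ne arc_verts hd_in_set by (metis prod.collapse subsetD)
    then show ?thesis unfolding cas[OF ne] by auto
  qed
  also have "\<dots> \<longleftrightarrow> set p \<subseteq> parcs \<Gamma> \<and> distinct (map fst p) \<and>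
      (\<forall>k<length p. snd (p ! k) = fst (p ! (Suc k mod length p)))"
    using wrap rot by (metis distinct1_rotate)
  finally show ?thesis using True by blast
qed (simp add: graph_cycle_def)

lemma graph_cycleI:
  assumes n: "3 \<le> n" and inj: "inj_on w {..<n}" and arcs: "\<And>k. k < n \<Longrightarrow> (w k, w (Suc k mod n)) \<in> parcs \<Gamma>"
  shows "graph_cycle \<Gamma> (map (\<lambda>k. (w k, w (Suc k mod n))) [0..<n])"
  using assms unfolding graph_cycle_iff by (auto simp: distinct_map o_def atLeast0LessThan)

lemma graph_cycle_fun:
  assumes "graph_cycle \<Gamma> p"
  defines "w \<equiv> \<lambda>k. fst (p ! (k mod length p))"
  shows "3 \<le> length p" "k < length p \<Longrightarrow> p ! k = (w k, w (Suc k))" "(w k, w (Suc k)) \<in> parcs \<Gamma>"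
    "w a = w b \<longleftrightarrow> a mod length p = b mod length p"
proof -
  note p = assms(1)[unfolded graph_cycle_iff]
  show "3 \<le> length p" using p by blast
  then have pos: "length p > 0" by linarith
  show nth: "p ! k = (w k, w (Suc k))" if "k < length p" for k
    using p that by (simp add: w_def prod_eq_iff)
  have "(w (k mod length p), w (Suc (k mod length p))) \<in> parcs \<Gamma>"
    using nth[of "k mod length p"] p nth_mem[of "k mod length p" p] pos by auto
  then show "(w k, w (Suc k)) \<in> parcs \<Gamma>" by (simp add: w_def mod_Suc_eq)
  show "w a = w b \<longleftrightarrow> a mod length p = b mod length p"
    using p pos nth_eq_iff_index_eq[of "map fst p" "a mod length p" "b mod length p"] by (simp add: w_def)
qed

lemma girth_eq_5_iff:
  "girth \<Gamma> = 5 \<longleftrightarrow> (\<exists>p. graph_cycle \<Gamma> p \<and> length p = 5) \<and> (\<forall>p. graph_cycle \<Gamma> p \<longrightarrow> 5 \<le> length p)"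
proof
  assume g: "girth \<Gamma> = 5"
  have ge: "5 \<le> length p" if "graph_cycle \<Gamma> p" for p
  proof -
    have "girth \<Gamma> \<le> enat (length p)" unfolding girth_def by (rule INF_lower) (use that in simp)
    then show ?thesis using g by (simp add: numeral_eq_enat)
  qed
  \<comment> \<open>Without any cycle the infimum would be infinite; otherwise it is
    attained.\<close>
  have "(\<lambda>p. enat (length p)) ` {p. graph_cycle \<Gamma> p} \<noteq> {}"
  proof
    assume "(\<lambda>p. enat (length p)) ` {p. graph_cycle \<Gamma> p} = {}"
    then have "girth \<Gamma> = Inf {}" unfolding girth_def by (simp only:)
    then show False using g by (simp add: Inf_enat_def numeral_eq_enat)
  qed
  then have "girth \<Gamma> \<in> (\<lambda>p. enat (length p)) ` {p. graph_cycle \<Gamma> p}"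
    unfolding girth_def by (simp add: Inf_enat_def) (metis (mono_tags, lifting) LeastI_ex all_not_in_conv image_iff mem_Collect_eq)
  then show "(\<exists>p. graph_cycle \<Gamma> p \<and> length p = 5) \<and> (\<forall>p. graph_cycle \<Gamma> p \<longrightarrow> 5 \<le> length p)"
    using g ge by (auto simp: numeral_eq_enat)
next
  assume *: "(\<exists>p. graph_cycle \<Gamma> p \<and> length p = 5) \<and> (\<forall>p. graph_cycle \<Gamma> p \<longrightarrow> 5 \<le> length p)"
  show "girth \<Gamma> = 5" unfolding girth_def
  proof (rule antisym)
    show "(INF p\<in>{p. graph_cycle \<Gamma> p}. enat (length p)) \<le> 5"
      using * by (auto simp: numeral_eq_enat intro: INF_lower2)
    show "5 \<le> (INF p\<in>{p. graph_cycle \<Gamma> p}. enat (length p))"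
      using * by (intro INF_greatest) (auto simp: numeral_eq_enat)
  qed
qed

end

locale half_arc_graph = connected_graph +
  fixes G D
  assumes tetravalent: "tetravalent \<Gamma>" and hat: "half_arc_transitive \<Gamma> G" and orient: "D \<in> induced_orientations \<Gamma> G"
begin

section \<open>The orientation induced by a half-arc-transitive group\<close>

lemma G_sub: "subgroup G (Aut \<Gamma>)" and G_auto: "G \<subseteq> graph_auto \<Gamma>"
  using hat subgroup.subset carrier_Aut by (auto simp: half_arc_transitive_def)

lemma D_sub: "D \<subseteq> parcs \<Gamma>"
proof -
  obtain a where a: "a \<in> parcs \<Gamma>" "D = {map_prod g g a | g. g \<in> G}" using orient by (auto simp: induced_orientations_def)
  then show ?thesis using G_auto auto_arc_iff arc_verts[of "fst a" "snd a"] by (fastforce simp: map_prod_def split_beta)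
qed

lemma D_image: "g \<in> G \<Longrightarrow> (u, v) \<in> D \<Longrightarrow> (g u, g v) \<in> D"
  and D_trans: "(u, v) \<in> D \<Longrightarrow> (u', v') \<in> D \<Longrightarrow> \<exists>g\<in>G. g u = u' \<and> g v = v'"
proof -
  obtain x y where a: "(x, y) \<in> parcs \<Gamma>" "D = {map_prod g g (x, y) | g. g \<in> G}" using orient by (auto simp: induced_orientations_def)
  have xy: "x \<in> pverts \<Gamma>" "y \<in> pverts \<Gamma>" using arc_verts a by auto
  have D_iff: "(u, v) \<in> D \<longleftrightarrow> (\<exists>g\<in>G. u = g x \<and> v = g y)" for u v using a(2) by auto
  show "(g u, g v) \<in> D" if "g \<in> G" "(u, v) \<in> D"
    using that subgroup_comp[OF G_sub] xy unfolding D_iff by metis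
  show "\<exists>g\<in>G. g u = u' \<and> g v = v'" if uv: "(u, v) \<in> D" "(u', v') \<in> D"
  proof -
    obtain a b where a: "a \<in> G" "u = a x" "v = a y" and b: "b \<in> G" "u' = b x" "v' = b y" using uv D_iff by metis
    obtain a' where a': "a' \<in> G" "\<forall>v\<in>pverts \<Gamma>. a' (a v) = v \<and> a (a' v) = v" using subgroup_inv[OF G_sub a(1)] by blast
    obtain k where k: "k \<in> G" "\<forall>v\<in>pverts \<Gamma>. k v = b (a' v)" using subgroup_comp[OF G_sub b(1) a'(1)] by blast
    have "a x \<in> pverts \<Gamma>" "a y \<in> pverts \<Gamma>" using a(1) G_auto auto_mem xy by auto
    then have "k u = u'" "k v = v'" using a b a' k xy by simp_all
    then show ?thesis using k(1) by blast
  qed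
qed

text \<open>One arc of \<open>D\<close> whose converse is in \<open>D\<close> would, by transitivity
  of \<open>G\<close> on \<open>D\<close>, close \<open>D\<close> under converses. Edge-transitivity
  then makes \<open>D\<close> the set of all arcs, and \<open>G\<close> would be
  arc-transitive.\<close>

lemma D_asym: "(u, v) \<in> D \<Longrightarrow> (v, u) \<notin> D" and D_total: "parcs \<Gamma> = D \<union> D\<inverse>"
proof -
  obtain x y where a: "(x, y) \<in> parcs \<Gamma>" "D = {map_prod g g (x, y) | g. g \<in> G}" using orient by (auto simp: induced_orientations_def)
  have D_iff: "(u, v) \<in> D \<longleftrightarrow> (\<exists>g\<in>G. u = g x \<and> v = g y)" for u v using a(2) by auto
  have tot: "(u, v) \<in> D \<or> (v, u) \<in> D" if "(u, v) \<in> parcs \<Gamma>" for u v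
  proof -
    have "{x, y} \<in> edges \<Gamma>" "{u, v} \<in> edges \<Gamma>" using a(1) that by (force simp: edges_def)+
    then obtain g where g: "g \<in> G" "g ` {x, y} = {u, v}" using hat unfolding half_arc_transitive_def transitive_on_def by meson
    then show ?thesis unfolding D_iff by (auto simp: doubleton_eq_iff)
  qed
  show "parcs \<Gamma> = D \<union> D\<inverse>" using tot D_sub arc_sym by auto
  show "(v, u) \<notin> D" if uv: "(u, v) \<in> D"
  proof
    assume vu: "(v, u) \<in> D"
    have "(b, a) \<in> D" if "(a, b) \<in> D" for a b using D_trans[OF uv that] D_image vu by metis
    then have "D = parcs \<Gamma>" using tot D_sub by auto
    then have "transitive_on G (\<lambda>g. map_prod g g) (parcs \<Gamma>)"
      unfolding transitive_on_def using D_trans by (auto simp: map_prod_def)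
    then show False using hat by (simp add: half_arc_transitive_def)
  qed
qed

text \<open>The point is valency 2 in both directions: vertex-transitivity makes the out-valency a
  constant \<open>c\<close> and the in-valency \<open>4 - c\<close>, and counting the arcs by tails
  and by heads equates the two.\<close>

sublocale half_transitive "pverts \<Gamma>" D G
proof
  let ?V = "pverts \<Gamma>"
  show "finite ?V" by (rule finite_verts)
  show "pverts \<Gamma> \<noteq> {}" by (rule verts_ne)
  show Dv: "(u, v) \<in> D \<Longrightarrow> u \<in> ?V \<and> v \<in> ?V" for u v using D_sub arc_verts by blast
  show GV: "g \<in> G \<Longrightarrow> v \<in> ?V \<Longrightarrow> g v \<in> ?V" for g v using G_auto auto_mem by blast
  show comp: "g \<in> G \<Longrightarrow> h \<in> G \<Longrightarrow> \<exists>k\<in>G. \<forall>v\<in>?V. k v = g (h v)" for g h by (rule subgroup_comp[OF G_sub])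
  show inv: "g \<in> G \<Longrightarrow> \<exists>k\<in>G. \<forall>v\<in>?V. k (g v) = v \<and> g (k v) = v" for g by (rule subgroup_inv[OF G_sub])
  show Vt: "\<And>u v. u \<in> ?V \<Longrightarrow> v \<in> ?V \<Longrightarrow> \<exists>g\<in>G. g u = v" using hat by (auto simp: half_arc_transitive_def transitive_on_def)
  have fin: "finite {w. (v, w) \<in> D}" "finite {w. (w, v) \<in> D}" for v
    by (rule finite_subset[OF _ finite_verts], use Dv in blast)+
  have deg: "card {w. (v, w) \<in> D} + card {w. (w, v) \<in> D} = 4" if "v \<in> ?V" for v
  proof -
    have "card (out_arcs (with_proj \<Gamma>) v) = 4"
      using tetravalent that by (simp add: tetravalent_def out_degree_def)
    moreover have "out_arcs (with_proj \<Gamma>) v = Pair v ` ({w. (v, w) \<in> D} \<union> {w. (w, v) \<in> D})"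
      using D_total by (auto simp: out_arcs_def)
    moreover have "inj_on (Pair v) X" for X :: "'a set" by (simp add: inj_on_def)
    moreover have "card ({w. (v, w) \<in> D} \<union> {w. (w, v) \<in> D}) = card {w. (v, w) \<in> D} + card {w. (w, v) \<in> D}"
      by (rule card_Un_disjoint) (use fin D_asym in auto)
    ultimately show ?thesis by (simp add: card_image)
  qed
  have out_image: "card {w. (g v, w) \<in> D} = card {w. (v, w) \<in> D}" if g: "g \<in> G" and v: "v \<in> ?V" for g v
  proof -
    obtain k where k: "k \<in> G" "\<forall>v\<in>?V. k (g v) = v \<and> g (k v) = v" using inv[OF g] by blast
    have "bij_betw g {w. (v, w) \<in> D} {w. (g v, w) \<in> D}"
      by (rule bij_betw_byWitness[where f' = k]) (use k v Dv D_image[OF g] D_image[OF k(1)] in \<open>auto, metis\<close>)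
    then show ?thesis by (metis bij_betw_same_card)
  qed
  obtain v0 where v0: "v0 \<in> ?V" using verts_ne by blast
  define c where "c = card {w. (v0, w) \<in> D}"
  have c: "card {w. (v, w) \<in> D} = c" if "v \<in> ?V" for v
    using Vt[OF v0 that] out_image v0 by (auto simp: c_def)
  have finD: "finite D" by (rule finite_subset[OF D_sub finite_arcs])
  have "card D = (\<Sum>v\<in>?V. card {w. (v, w) \<in> D})"
  proof -
    have "D = (SIGMA v:?V. {w. (v, w) \<in> D})" using Dv by auto
    then show ?thesis using card_SigmaI[OF finite_verts, of "\<lambda>v. {w. (v, w) \<in> D}"] fin by metis
  qed
  moreover have "card D = (\<Sum>v\<in>?V. card {w. (w, v) \<in> D})"
  proof -
    have "D\<inverse> = (SIGMA v:?V. {w. (w, v) \<in> D})" using Dv by auto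
    moreover have "card (D\<inverse>) = card D" by (rule card_inverse)
    ultimately show ?thesis using card_SigmaI[OF finite_verts, of "\<lambda>v. {w. (w, v) \<in> D}"] fin by metis
  qed
  moreover have "(\<Sum>v\<in>?V. card {w. (w, v) \<in> D}) = (\<Sum>v\<in>?V. 4 - c)"
    by (rule sum.cong) (use deg c in fastforce)+
  moreover have "(\<Sum>v\<in>?V. card {w. (v, w) \<in> D}) = card ?V * c" using c by simp
  ultimately have "card ?V * c = (\<Sum>v\<in>?V. 4 - c)" by linarith
  then have "card ?V * c = card ?V * (4 - c)" by simp
  moreover have "card ?V \<noteq> 0" using finite_verts verts_ne by simp
  ultimately have "c = 4 - c" by (metis mult_cancel1)
  then have "c = 2" by simp
  then show "card {w. (v, w) \<in> D} = 2" "card {w. (w, v) \<in> D} = 2" if "v \<in> ?V" for v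
    using c[OF that] deg[OF that] by auto
  show "\<And>u v. (u, v) \<in> D \<Longrightarrow> (v, u) \<notin> D" by (rule D_asym)
  show "\<And>g u v. g \<in> G \<Longrightarrow> (u, v) \<in> D \<Longrightarrow> (g u, g v) \<in> D" by (rule D_image)
  show "\<And>u v u' v'. (u, v) \<in> D \<Longrightarrow> (u', v') \<in> D \<Longrightarrow> \<exists>g\<in>G. g u = u' \<and> g v = v'" by (rule D_trans)
  show "P v" if u: "u \<in> ?V" "P u" and fw: "\<And>x y. P x \<Longrightarrow> (x, y) \<in> D \<Longrightarrow> P y"
    and bw: "\<And>x y. P y \<Longrightarrow> (x, y) \<in> D \<Longrightarrow> P x" and v: "v \<in> ?V" for u v P
  proof (rule connected_induct[of u P v])
    fix x y assume x: "P x" "(x, y) \<in> parcs \<Gamma>"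
    then have "(x, y) \<in> D \<or> (y, x) \<in> D" using D_total by auto
    then show "P y" using x(1) fw bw by blast
  qed (use u v in auto)
qed

lemma orientations: "D' \<in> induced_orientations \<Gamma> G \<Longrightarrow> D' = D \<or> D' = D\<inverse>"
proof -
  assume "D' \<in> induced_orientations \<Gamma> G"
  then obtain a b where ab: "(a, b) \<in> parcs \<Gamma>" "D' = {map_prod g g (a, b) | g. g \<in> G}"
    by (auto simp: induced_orientations_def)
  have D'_iff: "(u, v) \<in> D' \<longleftrightarrow> (\<exists>g\<in>G. u = g a \<and> v = g b)" for u v using ab(2) by auto
  have "(a, b) \<in> D \<or> (b, a) \<in> D" using ab(1) D_total by auto
  then show ?thesis
  proof
    assume *: "(a, b) \<in> D"
    have "(u, v) \<in> D' \<longleftrightarrow> (u, v) \<in> D" for u v unfolding D'_iff using D_trans[OF *] D_image[OF _ *] by metis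
    then show ?thesis by auto
  next
    assume *: "(b, a) \<in> D"
    have "(u, v) \<in> D' \<longleftrightarrow> (v, u) \<in> D" for u v unfolding D'_iff using D_trans[OF *] D_image[OF _ *] by metis
    then show ?thesis by auto
  qed
qed

lemma alternating_cycle_iff: "alternating_cycle \<Gamma> G p \<longleftrightarrow> graph_cycle \<Gamma> p \<and> alternating_wrt D p"
proof -
  have "alternating_wrt (D\<inverse>) p \<longleftrightarrow> alternating_wrt D p"
  proof -
    have "(e \<in> D\<inverse> \<and> prod.swap e' \<in> D\<inverse>) \<or> (prod.swap e \<in> D\<inverse> \<and> e' \<in> D\<inverse>) \<longleftrightarrow>
        (e \<in> D \<and> prod.swap e' \<in> D) \<or> (prod.swap e \<in> D \<and> e' \<in> D)" for e e' :: "'a \<times> 'a"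
      by (cases e; cases e') auto
    then show ?thesis unfolding alternating_wrt_def Let_def by (simp only:)
  qed
  then show ?thesis using orientations orient by (metis alternating_cycle_def)
qed

text \<open>The tails alone determine the edges, because both arcs that leave a tail belong to the
  same alternating cycle.\<close>

definition trail_edges :: "(int \<Rightarrow> 'a) \<Rightarrow> 'a set set" where
  "trail_edges t = {{u, v} | u v. u \<in> range t \<and> (u, v) \<in> D}"

text \<open>From a position \<open>s\<close> whose vertex is a tail, the vertices of the cycle are
  alternately tails and heads. Uniqueness of the other neighbour identifies them, by induction, with
  the trail that starts with the same arc.\<close>

lemma alternating_cycle_trail:
  assumes p: "alternating_cycle \<Gamma> G p"
  obtains t h where "trail t h" "length p = 2 * radius" "cycle_verts p = range t \<union> range h"
    "cycle_edges p = trail_edges t"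
proof -
  define n where "n = length p"
  define w where "w k = fst (p ! (k mod n))" for k
  have gc: "graph_cycle \<Gamma> p" and alt: "alternating_wrt D p" using p alternating_cycle_iff by auto
  note w_props = graph_cycle_fun[OF gc, folded n_def, folded w_def]
  have n3: "3 \<le> n" and nth: "\<And>k. k < n \<Longrightarrow> p ! k = (w k, w (Suc k))" and w_eq: "\<And>a b. w a = w b \<longleftrightarrow> a mod n = b mod n"
    using w_props by blast+
  have w_alt: "((w k, w (Suc k)) \<in> D \<and> (w (Suc (Suc k)), w (Suc k)) \<in> D) \<or>
      ((w (Suc k), w k) \<in> D \<and> (w (Suc k), w (Suc (Suc k))) \<in> D)" for k
  proof -
    have lt: "k mod n < n" "Suc k mod n < n" using n3 by auto
    have e1: "p ! (k mod n) = (w k, w (Suc k))"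
      using nth[OF lt(1)] w_eq[of "k mod n" k] w_eq[of "Suc (k mod n)" "Suc k"] by (simp add: mod_Suc_eq)
    have e2: "p ! (Suc (k mod n) mod n) = (w (Suc k), w (Suc (Suc k)))"
      using nth[OF lt(2)] w_eq[of "Suc k mod n" "Suc k"] w_eq[of "Suc (Suc k mod n)" "Suc (Suc k)"] by (simp add: mod_Suc_eq)
    show ?thesis using alt lt(1) e1 e2 unfolding alternating_wrt_def n_def[symmetric] Let_def by fastforce
  qed
  have w_ne: "w (Suc (Suc k)) \<noteq> w k" for k
  proof
    assume "w (Suc (Suc k)) = w k"
    then have "(k + 2) mod n = k mod n" using w_eq by simp
    then have "n dvd 2" by (metis add_diff_cancel_left' mod_eq_dvd_iff_nat le_add1)
    then show False using n3 by (auto dest: dvd_imp_le)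
  qed
  obtain s where s: "(w s, w (Suc s)) \<in> D"
    using w_alt[of 0] by blast
  have sD: "(w (s + 2 * k), w (Suc (s + 2 * k))) \<in> D \<and> (w (s + 2 * k + 2), w (Suc (s + 2 * k))) \<in> D" for k
  proof (induction k)
    case 0
    then show ?case using w_alt[of s] s D_asym by auto
  next
    case (Suc k)
    then show ?case using w_alt[of "s + 2 * k + 1"] w_alt[of "s + 2 * k + 2"] D_asym by (auto simp: numeral_2_eq_2)
  qed
  obtain t h where t: "trail t h" "t 0 = w s" "h 0 = w (Suc s)" using trail_exists[OF s] by blast
  have th: "t (int k) = w (s + 2 * k) \<and> h (int k) = w (Suc (s + 2 * k))" for k
  proof (induction k)
    case 0
    then show ?case using t by simp
  next
    case (Suc k)
    define a where "a = s + 2 * k"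
    have a: "s + 2 * Suc k = Suc (Suc a)" "s + 2 * k = a" "s + 2 * k + 2 = Suc (Suc a)" by (simp_all add: a_def)
    have *: "t (int k) = w a" "h (int k) = w (Suc a)" using Suc a by simp_all
    have tk: "t (int k + 1) = w (Suc (Suc a))"
      by (rule in_unique[of "w a" "w (Suc a)"])
        (use trailD(2,3)[OF t(1), of "int k"] sD[of k] w_ne[of a] * in \<open>simp_all add: a_def\<close>)
    have "h (int k + 1) = w (Suc (Suc (Suc a)))"
      by (rule out_unique[of "w (Suc (Suc a))" "w (Suc a)"])
        (use trailD(4)[OF t(1), of "int k"] trailD(1)[OF t(1), of "int k + 1"] sD[of "Suc k"] sD[of k] w_ne[of "Suc a"] * tk
          in \<open>simp_all add: a_def\<close>)
    then show ?case using tk by (simp add: a_def add.commute)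
  qed
  have per: "w (k + n) = w k" for k using w_eq by simp
  \<comment> \<open>An odd length would identify a tail with a head on one trail.\<close>
  have "even n"
  proof (rule ccontr)
    assume "odd n"
    then obtain c where "n = 2 * c + 1" by (elim oddE)
    then have "t (int (Suc c)) = w (Suc s + n)" using th[of "Suc c"] by (simp add: algebra_simps)
    then have "t (int (Suc c)) = h 0" using per t(3) by metis
    then show False using t_neq_h[OF t(1)] by blast
  qed
  then obtain c where c: "n = 2 * c" by (elim evenE)
  have "t (int c) = t 0" using th[of c] per[of s] t(2) c by (simp add: algebra_simps)
  \<comment> \<open>Half the length is a period of the trail, and the radius gives a period of the
    cycle, so the two divide each other.\<close>
  then have d1: "radius dvd c" using t_eq_iff[OF t(1), of "int c" 0] by simp
  have "t (int radius) = t 0" using t_eq_iff[OF t(1), of "int radius" 0] by simp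
  then have "(s + 2 * radius) mod n = s mod n" using th[of radius] t(2) w_eq by simp
  then have "n dvd 2 * radius" by (metis add_diff_cancel_left' mod_eq_dvd_iff_nat le_add1)
  then have "c dvd radius" using c by simp
  then have len: "length p = 2 * radius" using d1 c dvd_antisym n_def by metis
  have tn: "\<exists>k. x = w (s + 2 * k) \<and> x = t (int k)" if "x \<in> range t" for x
  proof -
    have "x \<in> t ` {0..<int radius}" using that range_eq_image(1)[OF t(1)] by blast
    then show ?thesis using th by (metis (no_types, lifting) atLeastLessThan_iff imageE zero_le_imp_eq_int)
  qed
  have hn: "\<exists>k. x = w (Suc (s + 2 * k)) \<and> x = h (int k)" if "x \<in> range h" for x
  proof -
    have "x \<in> h ` {0..<int radius}" using that range_eq_image(2)[OF t(1)] by blast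
    then show ?thesis using th by (metis (no_types, lifting) atLeastLessThan_iff imageE zero_le_imp_eq_int)
  qed
  \<comment> \<open>A multiple of the length lifts any position beyond \<open>s\<close>, from where
    the parity of the distance tells tails from heads.\<close>
  have shift: "\<exists>j. (\<forall>i. w (k + i) = w (s + 2 * j + i)) \<or> (\<forall>i. w (k + i) = w (Suc (s + 2 * j) + i))" for k
  proof -
    have "w (x + n * m) = w x" for x m using w_eq by simp
    then have *: "w (k + i) = w (k + n * s + i)" for i by (metis add.assoc add.commute)
    have "s \<le> k + n * s" using n3 by (metis le_add2 mult_le_mono1 nat_mult_1 order.trans le_trans one_le_numeral)
    then obtain d where d: "k + n * s = s + d" by (metis le_Suc_ex)
    show ?thesis
    proof (cases "even d")
      case True
      then obtain j where "d = 2 * j" by (elim evenE)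
      then show ?thesis using * d by metis
    next
      case False
      then obtain j where "d = 2 * j + 1" by (elim oddE)
      then have "k + n * s = Suc (s + 2 * j)" using d by simp
      then show ?thesis using * by metis
    qed
  qed
  have set_p: "set p = (\<lambda>k. p ! k) ` {..<n}" by (auto simp: set_conv_nth n_def)
  have verts: "cycle_verts p = range w"
  proof -
    have "cycle_verts p = fst ` (\<lambda>k. p ! k) ` {..<n}" by (simp only: cycle_verts_def set_p)
    also have "\<dots> = w ` {..<n}" using nth by (auto simp: image_image)
    also have "\<dots> = range w"
    proof -
      have "w k = w (k mod n) \<and> k mod n \<in> {..<n}" for k using w_eq n3 by simp
      then show ?thesis by blast
    qed
    finally show ?thesis .
  qed
  have edges: "cycle_edges p = range (\<lambda>k. {w k, w (Suc k)})"
  proof -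
    have "cycle_edges p = (\<lambda>(u, v). {u, v}) ` (\<lambda>k. p ! k) ` {..<n}"
      by (simp only: cycle_edges_def set_p)
    also have "\<dots> = (\<lambda>k. {w k, w (Suc k)}) ` {..<n}" using nth by (auto simp: image_image)
    also have "\<dots> = range (\<lambda>k. {w k, w (Suc k)})"
    proof -
      have "w k = w (k mod n) \<and> w (Suc k) = w (Suc (k mod n)) \<and> k mod n \<in> {..<n}" for k using w_eq n3 by (simp add: mod_Suc_eq)
      then have "{w k, w (Suc k)} \<in> (\<lambda>k. {w k, w (Suc k)}) ` {..<n}" for k
        by (intro image_eqI[of _ _ "k mod n"]) simp_all
      then show ?thesis by blast
    qed
    finally show ?thesis .
  qed
  show ?thesis
  proof
    show "trail t h" by fact
    show "length p = 2 * radius" by fact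
    show "cycle_verts p = range t \<union> range h"
    proof (intro equalityI subsetI)
      fix x assume "x \<in> cycle_verts p"
      then obtain k where k: "x = w (k + 0)" using verts by auto
      then show "x \<in> range t \<union> range h" using shift[of k] th by (metis UnCI add.right_neutral rangeI)
    next
      fix x assume "x \<in> range t \<union> range h"
      then show "x \<in> cycle_verts p" using tn hn verts by (metis UnE rangeI)
    qed
    show "cycle_edges p = trail_edges t"
    proof (intro equalityI subsetI)
      fix e assume "e \<in> cycle_edges p"
      then obtain k where k: "e = {w (k + 0), w (k + 1)}" using edges by auto
      from shift[of k] obtain j where "(\<forall>i. w (k + i) = w (s + 2 * j + i)) \<or> (\<forall>i. w (k + i) = w (Suc (s + 2 * j) + i))" by blast
      then show "e \<in> trail_edges t"
      proof
        assume *: "\<forall>i. w (k + i) = w (s + 2 * j + i)"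
        then have "e = {t (int j), h (int j)}" using k th[of j] *[rule_format, of 0] *[rule_format, of 1] by simp
        then show ?thesis using trailD(1)[OF t(1)] unfolding trail_edges_def by blast
      next
        assume *: "\<forall>i. w (k + i) = w (Suc (s + 2 * j) + i)"
        then have "w (k + 0) = h (int j)" "w (k + 1) = t (int (Suc j))"
            using th[of j] th[of "Suc j"] *[rule_format, of 0] *[rule_format, of 1] by simp_all
        then have "e = {t (int j + 1), h (int j)}" using k by (auto simp: add.commute)
        then show ?thesis using trailD(2)[OF t(1)] unfolding trail_edges_def by blast
      qed
    next
      fix e assume "e \<in> trail_edges t"
      then obtain u v where uv: "e = {u, v}" "u \<in> range t" "(u, v) \<in> D" by (auto simp: trail_edges_def)
      then obtain x where "u = t x" by blast
      \<comment> \<open>The index of \<open>u\<close> is moved to a positive natural number, so that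
        both it and its predecessor are positions on the cycle.\<close>
      define k where "k = nat (x mod int radius) + radius"
      have r: "radius > 0" using radius_pos[OF t(1)] .
      have k1: "int k = x mod int radius + int radius" "k > 0" using r by (simp_all add: k_def)
      have "int radius dvd int k - x" using k1(1) by (simp add: mod_eq_dvd_iff[symmetric])
      then have ut: "u = t (int k)" using \<open>u = t x\<close> t_eq_iff[OF t(1)] by metis
      have "v = h (int k) \<or> v = h (int k - 1)"
        using out_unique trailD(1,7)[OF t(1), of "int k"] trailD(4)[OF t(1), of "int k - 1"] uv(3) ut by (metis diff_add_cancel)
      then show "e \<in> cycle_edges p"
      proof
        assume "v = h (int k)"
        then have "e = {w (s + 2 * k), w (Suc (s + 2 * k))}" using uv(1) ut th by simp
        then show ?thesis using edges by blast
      next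
        assume v: "v = h (int k - 1)"
        obtain j where j: "k = Suc j" using k1(2) by (metis gr0_conv_Suc)
        then have "e = {w (Suc (s + 2 * j)), w (Suc (Suc (s + 2 * j)))}" using uv(1) ut th[of k] th[of j] v by auto
        then show ?thesis using edges by blast
      qed
    qed
  qed
qed

lemma trail_alternating_cycle:
  assumes t: "trail t h"
  obtains p where "alternating_cycle \<Gamma> G p" "length p = 2 * radius" "cycle_verts p = range t \<union> range h"
    "cycle_edges p = trail_edges t"
proof -
  have r2: "radius \<ge> 2" using radius_ge_2[OF t] .
  define w where "w k = (if even k then t (int (k div 2)) else h (int (k div 2)))" for k
  define n where "n = 2 * radius"
  define p where "p = map (\<lambda>k. (w k, w (Suc k mod n))) [0..<n]"
  have t0: "t (int radius) = t 0" using t_eq_iff[OF t, of "int radius" 0] by simp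
  have w_mod: "w (Suc k mod n) = w (Suc k)" if "k < n" for k
  proof (cases "Suc k = n")
    case True
    then show ?thesis using t0 by (simp add: w_def n_def)
  qed (use that in simp)
  have arcs: "if even k then (w k, w (Suc k)) \<in> D else (w (Suc k), w k) \<in> D" for k
  proof (cases "even k")
    case True
    then show ?thesis using trailD(1)[OF t] by (simp add: w_def)
  next
    case False
    then have "int (Suc k div 2) = int (k div 2) + 1" by presburger
    then show ?thesis using False trailD(2)[OF t, of "int (k div 2)"] by (simp add: w_def add.commute)
  qed
  have inj: "inj_on w {..<n}"
  proof (rule inj_onI)
    fix a b assume ab: "a \<in> {..<n}" "b \<in> {..<n}" "w a = w b"
    have par: "even a \<longleftrightarrow> even b" using ab(3) t_neq_h[OF t] by (auto simp: w_def split: if_splits) metis+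
    have "a div 2 < radius" "b div 2 < radius" using ab by (auto simp: n_def)
    moreover have "int radius dvd int (a div 2) - int (b div 2)"
      using ab(3) par t_eq_iff[OF t] h_eq_iff[OF t] by (auto simp: w_def split: if_splits)
    then have "int (a div 2) mod int radius = int (b div 2) mod int radius" by (simp only: mod_eq_dvd_iff)
    ultimately have "a div 2 = b div 2" by (metis mod_less of_nat_eq_iff zmod_int)
    then show "a = b" using par by presburger
  qed
  have "(w k, w (Suc k mod n)) \<in> parcs \<Gamma>" if "k < n" for k
    using arcs[of k] w_mod[OF that] D_total by (auto split: if_splits)
  then have "graph_cycle \<Gamma> p" unfolding p_def using graph_cycleI[of n w] inj r2 by (simp add: n_def)
  moreover have "alternating_wrt D p"
    unfolding alternating_wrt_def Let_def
  proof (intro allI impI)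
    fix i assume i: "i < length p"
    then have i': "i < n" "Suc i mod n < n" "length p = n" by (simp_all add: p_def)
    have e1: "p ! i = (w i, w (Suc i))" using i' w_mod by (simp add: p_def)
    have e2: "p ! (Suc i mod length p) = (w (Suc i mod n), w (Suc (Suc i mod n)))" using i' w_mod by (simp add: p_def)
    have e3: "w (Suc i mod n) = w (Suc i)" "even (Suc i mod n) \<longleftrightarrow> even (Suc i)"
      using w_mod i' by (simp_all add: n_def dvd_mod_iff)
    show "p ! i \<in> D \<and> prod.swap (p ! (Suc i mod length p)) \<in> D \<or> prod.swap (p ! i) \<in> D \<and> p ! (Suc i mod length p) \<in> D"
      using arcs[of i] arcs[of "Suc i mod n"] e1 e2 e3 by (auto split: if_splits)
  qed
  ultimately have p: "alternating_cycle \<Gamma> G p" using alternating_cycle_iff by blast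
  \<comment> \<open>Length, vertices and edges of \<open>p\<close> come from applying
    \<open>alternating_cycle_trail\<close> to \<open>p\<close>; the trail obtained shares a tail
    with the given one and so has the same ranges.\<close>
  obtain t' h' where t': "trail t' h'" "length p = 2 * radius" "cycle_verts p = range t' \<union> range h'" "cycle_edges p = trail_edges t'"
    using alternating_cycle_trail[OF p] by blast
  have "p ! 0 = (t 0, h 0)" "0 < length p" using r2 w_mod[of 0] by (simp_all add: p_def n_def w_def)
  then have "{t 0, h 0} \<in> cycle_edges p" unfolding cycle_edges_def by (metis (mono_tags, lifting) case_prod_conv image_eqI nth_mem)
  then obtain u v where "{t 0, h 0} = {u, v}" "u \<in> range t'" "(u, v) \<in> D" using t'(4) by (auto simp: trail_edges_def)
  then have "t 0 \<in> range t'" using trailD(1)[OF t, of 0] D_asym by (auto simp: doubleton_eq_iff)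
  then have "range t = range t'" "range h = range h'" using same_tail_ranges[OF t'(1) t] by blast+
  then show ?thesis using that[OF p t'(2)] t'(3,4) by (simp add: trail_edges_def)
qed

section \<open>Radius and attachment number in terms of trails\<close>

lemma G_radius_eq: "G_radius \<Gamma> G = radius"
proof -
  obtain t h where t: "trail t h"
    using verts_ne out2 trail_exists by (metis Collect_empty_eq card.empty ex_in_conv zero_neq_numeral)
  show ?thesis unfolding G_radius_def
  proof (rule the_equality)
    show "\<exists>p. alternating_cycle \<Gamma> G p \<and> length p = 2 * radius" using trail_alternating_cycle[OF t] by metis
    show "r = radius" if "\<exists>p. alternating_cycle \<Gamma> G p \<and> length p = 2 * r" for r
      using that alternating_cycle_trail by (metis mult_cancel1 zero_neq_numeral)
  qed
qed

text \<open>At a vertex there is one cycle with it as a head and one with it as a tail. A group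
  element that moves the first meeting point to the second therefore carries the first pair of
  cycles to the second pair.\<close>

lemma common_verts_invariant:
  assumes "trail t h" "trail t' h'" "h a = t' b" "trail x y" "trail x' y'" "y c = x' d"
  shows "card ((range t \<union> range h) \<inter> (range t' \<union> range h')) = card ((range x \<union> range y) \<inter> (range x' \<union> range y'))"
proof -
  obtain g where g: "g \<in> G" "g (t' b) = x' d" using V_trans trailD(5) assms by metis
  have r1: "range x = g ` range t" "range y = g ` range h"
    using same_head_ranges[OF trail_image[OF g(1) assms(1)] assms(4), of c a] g assms(3,6) by (simp_all add: image_image)
  have r2: "range x' = g ` range t'" "range y' = g ` range h'"
    using same_tail_ranges[OF trail_image[OF g(1) assms(2)] assms(5), of d b] g by (simp_all add: image_image)
  have inj: "inj_on g (pverts \<Gamma>)" using G_inj[OF g(1)] by (auto simp: inj_on_def)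
  have sub: "range t \<union> range h \<subseteq> pverts \<Gamma>" "range t' \<union> range h' \<subseteq> pverts \<Gamma>" using trailD(5,6) assms by blast+
  have "(range x \<union> range y) \<inter> (range x' \<union> range y') = g ` ((range t \<union> range h) \<inter> (range t' \<union> range h'))"
    unfolding r1 r2 image_Un[symmetric] using inj_on_image_Int[OF inj sub] by simp
  then show ?thesis using card_image inj_on_subset[OF inj] sub by (metis inf.coboundedI1)
qed

text \<open>Reduces the definite description to one pair. Distinct cycles that meet cannot share a
  tail or share a head, so they meet as in \<open>common_verts_invariant\<close> and give the same
  number.\<close>

lemma tightly_attached_iff:
  assumes t: "trail t h" and t': "trail t' h'" and v: "h 0 = t' 0"
  shows "tightly_attached \<Gamma> G \<longleftrightarrow> card ((range t \<union> range h) \<inter> (range t' \<union> range h')) = radius"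
proof -
  have distinct: "trail_edges t \<noteq> trail_edges t'"
  proof
    assume "trail_edges t = trail_edges t'"
    moreover have "{t 0, h 0} \<in> trail_edges t" using trailD(1)[OF t, of 0] unfolding trail_edges_def by blast
    ultimately have "{t 0, h 0} \<in> trail_edges t'" by simp
    then have "t 0 \<in> range t'" using trailD(1)[OF t, of 0] D_asym by (auto simp: trail_edges_def doubleton_eq_iff)
    then have "range t = range t'" using same_tail_ranges[OF t' t] by blast
    then show False using v t_neq_h[OF t] by (metis rangeE rangeI)
  qed
  have "G_attachment_number \<Gamma> G = card ((range t \<union> range h) \<inter> (range t' \<union> range h'))"
    unfolding G_attachment_number_def
  proof (rule the_equality)
    obtain p where p: "alternating_cycle \<Gamma> G p" "cycle_verts p = range t \<union> range h" "cycle_edges p = trail_edges t"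
      using trail_alternating_cycle[OF t] by metis
    obtain p' where p': "alternating_cycle \<Gamma> G p'" "cycle_verts p' = range t' \<union> range h'" "cycle_edges p' = trail_edges t'"
      using trail_alternating_cycle[OF t'] by metis
    have "h 0 \<in> range h" by (rule rangeI)
    moreover have "h 0 \<in> range t'" unfolding v by (rule rangeI)
    ultimately have "cycle_verts p \<inter> cycle_verts p' \<noteq> {}" using p(2) p'(2) by blast
    then show "\<exists>p p'. alternating_cycle \<Gamma> G p \<and> alternating_cycle \<Gamma> G p' \<and> cycle_edges p \<noteq> cycle_edges p' \<and>
        cycle_verts p \<inter> cycle_verts p' \<noteq> {} \<and> card (cycle_verts p \<inter> cycle_verts p') = card ((range t \<union> range h) \<inter> (range t' \<union> range h'))"
      using p(1) p'(1) distinct unfolding p(2,3)[symmetric] p'(2,3)[symmetric] by blast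
  next
    fix a assume "\<exists>p p'. alternating_cycle \<Gamma> G p \<and> alternating_cycle \<Gamma> G p' \<and> cycle_edges p \<noteq> cycle_edges p' \<and>
        cycle_verts p \<inter> cycle_verts p' \<noteq> {} \<and> card (cycle_verts p \<inter> cycle_verts p') = a"
    then obtain p p' x where p: "alternating_cycle \<Gamma> G p" "alternating_cycle \<Gamma> G p'" "cycle_edges p \<noteq> cycle_edges p'"
      "x \<in> cycle_verts p" "x \<in> cycle_verts p'" and a: "card (cycle_verts p \<inter> cycle_verts p') = a" by blast
    obtain s k where s: "trail s k" "cycle_verts p = range s \<union> range k" "cycle_edges p = trail_edges s"
      by (rule alternating_cycle_trail[OF p(1)])
    obtain s' k' where s': "trail s' k'" "cycle_verts p' = range s' \<union> range k'" "cycle_edges p' = trail_edges s'"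
      by (rule alternating_cycle_trail[OF p(2)])
    have ne: "range s \<noteq> range s'"
    proof
      assume "range s = range s'"
      then have "trail_edges s = trail_edges s'" by (simp only: trail_edges_def)
      then show False using p(3) s(3) s'(3) by simp
    qed
    have "\<not> (x \<in> range s \<and> x \<in> range s')" "\<not> (x \<in> range k \<and> x \<in> range k')"
      using same_tail_ranges(1)[OF s(1) s'(1)] same_head_ranges(1)[OF s(1) s'(1)] ne by (metis rangeE)+
    then consider "x \<in> range k" "x \<in> range s'" | "x \<in> range k'" "x \<in> range s" using p(4,5) s(2) s'(2) by blast
    then show "a = card ((range t \<union> range h) \<inter> (range t' \<union> range h'))"
    proof cases
      case 1
      then obtain i j where "k i = s' j" by (metis rangeE)
      from common_verts_invariant[OF s(1) s'(1) this t t' v] show ?thesis using a s(2) s'(2) by simp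
    next
      case 2
      then obtain i j where "k' i = s j" by (metis rangeE)
      from common_verts_invariant[OF s'(1) s(1) this t t' v] show ?thesis using a s(2) s'(2) by (simp add: Int_commute)
    qed
  qed
  then show ?thesis by (simp add: tightly_attached_def G_radius_eq)
qed

end

section \<open>Walks as words\<close>

text \<open>
  A letter \<open>(d, c)\<close> of a word is a step of a walk that leads from layer \<open>i\<close> to layer \<open>i + d\<close> along an
  edge of sign \<open>c\<close>. The edges between the layers \<open>i\<close> and \<open>i + 1\<close> carry the power \<open>q ^ i\<close>, hence the
  exponent \<open>i - 1\<close> for a step down. Closedness of a word is tested at layer 0 only: whether a walk
  closes does not depend on where it starts.
\<close>

definition pw :: "nat \<Rightarrow> int \<Rightarrow> int \<Rightarrow> int" where
  "pw m q i = q ^ nat (i mod int m)"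

fun disp :: "nat \<Rightarrow> int \<Rightarrow> (int \<times> int) list \<Rightarrow> int \<Rightarrow> int" where
  "disp m q [] i = 0"
| "disp m q ((d, c) # w) i = d * c * pw m q (if d = 1 then i else i - 1) + disp m q w (i + d)"

definition closed_word :: "nat \<Rightarrow> nat \<Rightarrow> int \<Rightarrow> (int \<times> int) list \<Rightarrow> bool" where
  "closed_word m r q w \<longleftrightarrow> int m dvd sum_list (map fst w) \<and> int r dvd disp m q w 0"

abbreviation sgns :: "int set" where "sgns \<equiv> {1, -1}"

lemma sgns_mult: "a \<in> sgns \<Longrightarrow> b \<in> sgns \<Longrightarrow> a * b \<in> sgns" and sgns_neg: "a \<in> sgns \<Longrightarrow> - a \<in> sgns"
  by auto

lemma all_less_5: "(\<forall>k<5. Q k) \<longleftrightarrow> Q 0 \<and> Q 1 \<and> Q 2 \<and> Q 3 \<and> Q (4::nat)"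
proof -
  have "k < 5 \<longleftrightarrow> k = 0 \<or> k = 1 \<or> k = 2 \<or> k = 3 \<or> k = 4" for k :: nat by presburger
  then show ?thesis by (simp only: imp_disjL all_conj_distrib simp_thms)
qed

lemma all_less_4: "(\<forall>k<4. Q k) \<longleftrightarrow> Q 0 \<and> Q 1 \<and> Q 2 \<and> Q (3::nat)"
proof -
  have "k < 4 \<longleftrightarrow> k = 0 \<or> k = 1 \<or> k = 2 \<or> k = 3" for k :: nat by presburger
  then show ?thesis by (simp only: imp_disjL all_conj_distrib simp_thms)
qed

context connected_graph
begin

text \<open>Only the diagonals are required to have distinct ends; consecutive vertices are distinct
  because there are no loops.\<close>

definition pentagon :: "'a \<Rightarrow> 'a \<Rightarrow> 'a \<Rightarrow> 'a \<Rightarrow> 'a \<Rightarrow> bool" where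
  "pentagon v0 v1 v2 v3 v4 \<longleftrightarrow>
     (v0, v1) \<in> parcs \<Gamma> \<and> (v1, v2) \<in> parcs \<Gamma> \<and> (v2, v3) \<in> parcs \<Gamma> \<and> (v3, v4) \<in> parcs \<Gamma> \<and> (v4, v0) \<in> parcs \<Gamma> \<and>
     v0 \<noteq> v2 \<and> v1 \<noteq> v3 \<and> v2 \<noteq> v4 \<and> v3 \<noteq> v0 \<and> v4 \<noteq> v1"

lemma arc_ne: "(u, v) \<in> parcs \<Gamma> \<Longrightarrow> u \<noteq> v"
  using no_loop by auto

lemma pentagon_cycle:
  assumes P: "pentagon v0 v1 v2 v3 v4"
  shows "graph_cycle \<Gamma> [(v0, v1), (v1, v2), (v2, v3), (v3, v4), (v4, v0)]"
proof -
  have "v0 \<noteq> v1" "v1 \<noteq> v2" "v2 \<noteq> v3" "v3 \<noteq> v4" "v4 \<noteq> v0" using P arc_ne unfolding pentagon_def by blast+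
  moreover have "length [(v0, v1), (v1, v2), (v2, v3), (v3, v4), (v4, v0)] = 5" by simp
  ultimately show ?thesis using P unfolding graph_cycle_iff pentagon_def by (simp only: all_less_5) auto
qed

lemma cycle_pentagon:
  assumes "graph_cycle \<Gamma> p" "length p = 5"
  obtains v0 v1 v2 v3 v4 where "pentagon v0 v1 v2 v3 v4" "p = [(v0, v1), (v1, v2), (v2, v3), (v3, v4), (v4, v0)]"
proof -
  define w where "w k = fst (p ! (k mod length p))" for k
  note W = graph_cycle_fun[OF assms(1), folded w_def]
  have S: "Suc 0 = 1" "Suc 1 = 2" "Suc 2 = 3" "Suc 3 = 4" "Suc 4 = 5" by simp_all
  have w5: "w 5 = w 0" using W(4)[of 5 0] assms(2) by simp
  have "w 0 \<noteq> w 2" "w 1 \<noteq> w 3" "w 2 \<noteq> w 4" "w 3 \<noteq> w 0" "w 4 \<noteq> w 1"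
    unfolding W(4) assms(2) by simp_all
  then have "pentagon (w 0) (w 1) (w 2) (w 3) (w 4)"
    using W(3)[of 0] W(3)[of 1] W(3)[of 2] W(3)[of 3] W(3)[of 4] unfolding pentagon_def S w5 by simp
  moreover have "p ! 0 = (w 0, w 1)" "p ! 1 = (w 1, w 2)" "p ! 2 = (w 2, w 3)" "p ! 3 = (w 3, w 4)" "p ! 4 = (w 4, w 0)"
    using W(2)[of 0] W(2)[of 1] W(2)[of 2] W(2)[of 3] W(2)[of 4] unfolding S w5 assms(2) by simp_all
  moreover have "p = [p ! 0, p ! 1, p ! 2, p ! 3, p ! 4]"
    using assms(2) by (cases p; cases "tl p"; cases "tl (tl p)"; cases "tl (tl (tl p))"; cases "tl (tl (tl (tl p)))") auto
  ultimately show ?thesis using that by metis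
qed

lemma pentagon_rotate: "pentagon v0 v1 v2 v3 v4 \<Longrightarrow> pentagon v1 v2 v3 v4 v0"
  and pentagon_reverse: "pentagon v0 v1 v2 v3 v4 \<Longrightarrow> pentagon v4 v3 v2 v1 v0"
  unfolding pentagon_def using arc_sym by auto

lemma auto_pentagon:
  assumes f: "f \<in> graph_auto \<Gamma>" and V: "{v0, v1, v2, v3, v4} \<subseteq> pverts \<Gamma>"
  shows "pentagon (f v0) (f v1) (f v2) (f v3) (f v4) \<longleftrightarrow> pentagon v0 v1 v2 v3 v4"
  using auto_arc_iff[OF f] auto_inj[OF f] V by (simp add: pentagon_def)

lemma pentagon_verts: "pentagon v0 v1 v2 v3 v4 \<Longrightarrow> {v0, v1, v2, v3, v4} \<subseteq> pverts \<Gamma>"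
  using arc_verts unfolding pentagon_def by blast

lemma quadrangle_cycle:
  assumes "(v0, v1) \<in> parcs \<Gamma>" "(v1, v2) \<in> parcs \<Gamma>" "(v2, v3) \<in> parcs \<Gamma>" "(v3, v0) \<in> parcs \<Gamma>" "v0 \<noteq> v2" "v1 \<noteq> v3"
  shows "graph_cycle \<Gamma> [(v0, v1), (v1, v2), (v2, v3), (v3, v0)]"
proof -
  have "v0 \<noteq> v1" "v1 \<noteq> v2" "v2 \<noteq> v3" "v3 \<noteq> v0" using assms arc_ne by blast+
  moreover have "length [(v0, v1), (v1, v2), (v2, v3), (v3, v0)] = 4" by simp
  ultimately show ?thesis using assms unfolding graph_cycle_iff by (simp only: all_less_4) auto
qed

end

text \<open>
  The arguments of \<open>pt\<close> are arbitrary integers that stand for their residues modulo \<open>m\<close> and \<open>r\<close>. Only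
  \<open>q ^ m = 1\<close> is considered: for odd \<open>m\<close> the case \<open>q ^ m = -1\<close> reduces to it by negating \<open>q\<close>.
\<close>

locale labelled_graph = connected_graph +
  fixes m r :: nat and q :: int and pt :: "int \<Rightarrow> int \<Rightarrow> 'a"
  assumes m_ge_3: "m \<ge> 3" and r_ge_3: "r \<ge> 3" and r_odd: "odd r" and q_m: "int r dvd q ^ m - 1"
    and pt_eq: "pt i j = pt i' j' \<longleftrightarrow> int m dvd i - i' \<and> int r dvd j - j'"
    and pt_V: "pt i j \<in> pverts \<Gamma>" and pt_surj: "v \<in> pverts \<Gamma> \<Longrightarrow> \<exists>i j. v = pt i j"
    and pt_arc: "(pt i j, v) \<in> parcs \<Gamma> \<longleftrightarrow>
      (\<exists>c\<in>sgns. v = pt (i + 1) (j + c * pw m q i) \<or> v = pt (i - 1) (j - c * pw m q (i - 1)))"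
begin

abbreviation p :: "int \<Rightarrow> int" where "p \<equiv> pw m q"

section \<open>Steps and closed walks in coordinates\<close>

lemma not_dvd_2: "\<not> int r dvd 2" and not_dvd_1: "\<not> int r dvd 1"
  using r_ge_3 by (auto dest: zdvd_imp_le)

lemma q_coprime: "coprime q (int r)"
proof (rule coprimeI)
  fix c assume c: "c dvd q" "c dvd int r"
  then have "c dvd q ^ m - 1" using q_m dvd_trans by blast
  moreover have "c dvd q ^ m" using c(1) m_ge_3 dvd_power_same[of c q m] dvd_trans[of c "c ^ m"] by (simp add: dvd_power)
  ultimately show "is_unit c" by (metis dvd_diff_commute dvd_add_right_iff diff_add_cancel)
qed

lemma p_coprime: "coprime (p i) (int r)"
  by (simp add: pw_def q_coprime)

lemma p_cong: "int m dvd i - i' \<Longrightarrow> p i = p i'"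
  using mod_eq_dvd_iff[of i "int m" i'] by (simp add: pw_def)

lemma q_pow_mod: "int r dvd q ^ k - q ^ (k mod m)"
proof -
  have "[q ^ m = 1] (mod int r)" using q_m by (simp add: cong_iff_dvd_diff)
  then have "[(q ^ m) ^ (k div m) * q ^ (k mod m) = 1 ^ (k div m) * q ^ (k mod m)] (mod int r)"
    by (intro cong_mult cong_pow cong_refl)
  then show ?thesis by (simp add: cong_iff_dvd_diff flip: power_mult power_add)
qed

text \<open>Since \<open>q ^ m = 1\<close> modulo \<open>r\<close>, reducing exponents modulo
  \<open>m\<close> does not disturb the law of powers.\<close>

lemma p_add: "int r dvd p (i + k) - p i * p k"
proof -
  have m: "int m > 0" using m_ge_3 by simp
  have "nat ((i + k) mod int m) = (nat (i mod int m) + nat (k mod int m)) mod m"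
    using m by (simp add: nat_add_distrib[symmetric] nat_mod_as_int mod_add_eq)
  then show ?thesis
    using q_pow_mod[of "nat (i mod int m) + nat (k mod int m)"] by (simp add: pw_def power_add dvd_diff_commute)
qed

lemma p_dvd_cancel: "int r dvd p i * x \<longleftrightarrow> int r dvd x"
  using p_coprime[of i] by (simp add: coprime_dvd_mult_right_iff coprime_commute)

text \<open>A vertex has many labels; one is picked by \<open>SOME\<close>, and
  \<open>stp_pt\<close> shows that the choice does not matter. The signs are arranged so that a step
  down with sign \<open>c\<close> undoes the step up with sign \<open>c\<close>.\<close>

definition stp :: "int \<Rightarrow> int \<Rightarrow> 'a \<Rightarrow> 'a" where
  "stp d c v = (let (i, j) = (SOME (i, j). v = pt i j) in pt (i + d) (j + d * c * p (if d = 1 then i else i - 1)))"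

lemma stp_pt: "stp d c (pt i j) = pt (i + d) (j + d * c * p (if d = 1 then i else i - 1))"
proof -
  define x where "x = (SOME (i', j'). pt i j = pt i' j')"
  have "case x of (i', j') \<Rightarrow> pt i j = pt i' j'" unfolding x_def by (rule someI[of _ "(i, j)"]) simp
  then have x: "pt i j = pt (fst x) (snd x)" by (simp add: case_prod_beta)
  then have *: "int m dvd i - fst x" "int r dvd j - snd x" using pt_eq by auto
  then have "p i = p (fst x)" "p (i - 1) = p (fst x - 1)" using p_cong[of i "fst x"] p_cong[of "i - 1" "fst x - 1"] by simp_all
  then show ?thesis using * unfolding stp_def x_def[symmetric] by (auto simp: pt_eq case_prod_beta dvd_diff_commute)
qed

lemma stp_V: "v \<in> pverts \<Gamma> \<Longrightarrow> stp d c v \<in> pverts \<Gamma>"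
  using pt_surj stp_pt pt_V by metis

lemma stp_inv: "v \<in> pverts \<Gamma> \<Longrightarrow> d \<in> sgns \<Longrightarrow> stp (- d) c (stp d c v) = v"
  using pt_surj[of v] by (auto simp: stp_pt)

lemma stp_inj:
  assumes "v \<in> pverts \<Gamma>" "d \<in> sgns" "c \<in> sgns" "d' \<in> sgns" "c' \<in> sgns"
  shows "stp d c v = stp d' c' v \<longleftrightarrow> d = d' \<and> c = c'"
proof
  assume eq: "stp d c v = stp d' c' v"
  obtain i j where v: "v = pt i j" using pt_surj assms(1) by blast
  have "int m dvd d - d'" using eq unfolding v stp_pt pt_eq by simp
  moreover have "\<not> int m dvd 2" using m_ge_3 by (auto dest: zdvd_imp_le)
  ultimately have d: "d = d'" using assms by auto
  define x where "x = p (if d = 1 then i else i - 1)"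
  have "int r dvd d * c * x - d * c' * x" using eq unfolding v stp_pt pt_eq x_def d by simp
  then have "int r dvd x * (d * (c - c'))" by (simp add: algebra_simps)
  then have "int r dvd d * (c - c')" unfolding x_def p_dvd_cancel .
  then have "c = c'" using assms not_dvd_2 by auto
  then show "d = d' \<and> c = c'" using d by simp
qed simp

lemma arc_iff_stp:
  assumes "v \<in> pverts \<Gamma>"
  shows "(v, w) \<in> parcs \<Gamma> \<longleftrightarrow> (\<exists>d\<in>sgns. \<exists>c\<in>sgns. w = stp d c v)"
  using pt_surj[OF assms] by (auto simp: pt_arc stp_pt)

lemma stp_arc: "v \<in> pverts \<Gamma> \<Longrightarrow> d \<in> sgns \<Longrightarrow> c \<in> sgns \<Longrightarrow> (v, stp d c v) \<in> parcs \<Gamma>"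
  using arc_iff_stp by blast

lemma step_exists: "(v, w) \<in> parcs \<Gamma> \<Longrightarrow> \<exists>d\<in>sgns. \<exists>c\<in>sgns. w = stp d c v"
  using arc_verts arc_iff_stp by blast

definition run :: "(int \<times> int) list \<Rightarrow> 'a \<Rightarrow> 'a" where
  "run w v = fold (\<lambda>(d, c). stp d c) w v"

lemma run_simps [simp]: "run [] v = v" "run ((d, c) # w) v = run w (stp d c v)"
  by (simp_all add: run_def)

lemma run_pt: "run w (pt i j) = pt (i + sum_list (map fst w)) (j + disp m q w i)"
  by (induction w arbitrary: i j) (auto simp: stp_pt algebra_simps)

text \<open>A start \<open>i\<close> layers higher adds \<open>i\<close> to the exponent of every
  step, and \<open>p_add\<close> turns this into a common factor, which is a unit modulo
  \<open>r\<close>.\<close>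

lemma disp_shift: "int r dvd disp m q w (i + k) - p i * disp m q w k"
proof (induction w arbitrary: k)
  case (Cons x w)
  obtain d c where x: "x = (d, c)" by force
  define k' where "k' = (if d = 1 then k else k - 1)"
  have k': "(if d = 1 then i + k else i + k - 1) = i + k'" by (simp add: k'_def)
  have "disp m q (x # w) (i + k) - p i * disp m q (x # w) k =
      d * c * (p (i + k') - p i * p k') + (disp m q w (i + (k + d)) - p i * disp m q w (k + d))"
    unfolding x disp.simps k' k'_def[symmetric] by (simp add: algebra_simps)
  then show ?case using Cons.IH[of "k + d"] p_add[of i k'] by simp
qed simp

lemma run_closed_iff: "v \<in> pverts \<Gamma> \<Longrightarrow> run w v = v \<longleftrightarrow> closed_word m r q w"
proof -
  assume "v \<in> pverts \<Gamma>"
  then obtain i j where v: "v = pt i j" using pt_surj by blast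
  have "int r dvd disp m q w i \<longleftrightarrow> int r dvd p i * disp m q w 0"
    using disp_shift[of w i 0] by (metis add.right_neutral dvd_diff_commute dvd_add_right_iff diff_add_cancel)
  then show ?thesis by (simp add: v run_pt pt_eq closed_word_def p_dvd_cancel)
qed

lemma pentagon_word:
  assumes "pentagon v0 v1 v2 v3 v4"
  obtains d0 c0 d1 c1 d2 c2 d3 c3 d4 c4 where
    "{d0, c0, d1, c1, d2, c2, d3, c3, d4, c4} \<subseteq> sgns"
    "v1 = stp d0 c0 v0" "v2 = stp d1 c1 v1" "v3 = stp d2 c2 v2" "v4 = stp d3 c3 v3" "v0 = stp d4 c4 v4"
    "closed_word m r q [(d0, c0), (d1, c1), (d2, c2), (d3, c3), (d4, c4)]"
    "(d1, c1) \<noteq> (- d0, c0)" "(d2, c2) \<noteq> (- d1, c1)" "(d3, c3) \<noteq> (- d2, c2)" "(d4, c4) \<noteq> (- d3, c3)" "(d0, c0) \<noteq> (- d4, c4)"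
proof -
  have V: "v0 \<in> pverts \<Gamma>" "v1 \<in> pverts \<Gamma>" "v2 \<in> pverts \<Gamma>" "v3 \<in> pverts \<Gamma>" "v4 \<in> pverts \<Gamma>"
    using pentagon_verts[OF assms] by auto
  note P = assms[unfolded pentagon_def]
  obtain d0 c0 where 0: "d0 \<in> sgns" "c0 \<in> sgns" "v1 = stp d0 c0 v0" using step_exists[of v0 v1] P by (elim conjE) blast
  obtain d1 c1 where 1: "d1 \<in> sgns" "c1 \<in> sgns" "v2 = stp d1 c1 v1" using step_exists[of v1 v2] P by (elim conjE) blast
  obtain d2 c2 where 2: "d2 \<in> sgns" "c2 \<in> sgns" "v3 = stp d2 c2 v2" using step_exists[of v2 v3] P by (elim conjE) blast
  obtain d3 c3 where 3: "d3 \<in> sgns" "c3 \<in> sgns" "v4 = stp d3 c3 v3" using step_exists[of v3 v4] P by (elim conjE) blast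
  obtain d4 c4 where 4: "d4 \<in> sgns" "c4 \<in> sgns" "v0 = stp d4 c4 v4" using step_exists[of v4 v0] P by (elim conjE) blast
  have "run [(d0, c0), (d1, c1), (d2, c2), (d3, c3), (d4, c4)] v0 = v0"
    by (simp only: run_simps 0(3)[symmetric] 1(3)[symmetric] 2(3)[symmetric] 3(3)[symmetric] 4(3)[symmetric])
  then have cl: "closed_word m r q [(d0, c0), (d1, c1), (d2, c2), (d3, c3), (d4, c4)]" using run_closed_iff V by blast
  have nobt: "(d', c') \<noteq> (- d, c)" if "d \<in> sgns" "u \<in> pverts \<Gamma>" "v = stp d c u" "w = stp d' c' v" "w \<noteq> u" for d c d' c' u v w
    using that stp_inv by force
  have n0: "(d1, c1) \<noteq> (- d0, c0)" by (rule nobt[OF 0(1) V(1) 0(3) 1(3)]) (use P in blast)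
  have n1: "(d2, c2) \<noteq> (- d1, c1)" by (rule nobt[OF 1(1) V(2) 1(3) 2(3)]) (use P in blast)
  have n2: "(d3, c3) \<noteq> (- d2, c2)" by (rule nobt[OF 2(1) V(3) 2(3) 3(3)]) (use P in blast)
  have n3: "(d4, c4) \<noteq> (- d3, c3)" by (rule nobt[OF 3(1) V(4) 3(3) 4(3)]) (use P in blast)
  have n4: "(d0, c0) \<noteq> (- d4, c4)" by (rule nobt[OF 4(1) V(5) 4(3) 0(3)]) (use P in blast)
  have S: "{d0, c0, d1, c1, d2, c2, d3, c3, d4, c4} \<subseteq> sgns" using 0(1,2) 1(1,2) 2(1,2) 3(1,2) 4(1,2) by simp
  show ?thesis by (rule that[OF S 0(3) 1(3) 2(3) 3(3) 4(3) cl n0 n1 n2 n3 n4])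
qed

lemma word_pentagon:
  assumes v: "v \<in> pverts \<Gamma>" and s: "{d0, c0, d1, c1, d2, c2, d3, c3, d4, c4} \<subseteq> sgns"
    and closed: "closed_word m r q [(d0, c0), (d1, c1), (d2, c2), (d3, c3), (d4, c4)]"
    and nb: "(d1, c1) \<noteq> (- d0, c0)" "(d2, c2) \<noteq> (- d1, c1)" "(d3, c3) \<noteq> (- d2, c2)" "(d4, c4) \<noteq> (- d3, c3)" "(d0, c0) \<noteq> (- d4, c4)"
  shows "pentagon v (stp d0 c0 v) (stp d1 c1 (stp d0 c0 v)) (stp d2 c2 (stp d1 c1 (stp d0 c0 v)))
     (stp d3 c3 (stp d2 c2 (stp d1 c1 (stp d0 c0 v))))"
proof -
  define v1 v2 v3 v4 where "v1 = stp d0 c0 v" and "v2 = stp d1 c1 v1" and "v3 = stp d2 c2 v2" and "v4 = stp d3 c3 v3"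
  note defs = v1_def v2_def v3_def v4_def
  have V: "v1 \<in> pverts \<Gamma>" "v2 \<in> pverts \<Gamma>" "v3 \<in> pverts \<Gamma>" "v4 \<in> pverts \<Gamma>" using v stp_V by (simp_all add: defs)
  have v0: "v = stp d4 c4 v4"
    using run_closed_iff[OF v, of "[(d0, c0), (d1, c1), (d2, c2), (d3, c3), (d4, c4)]"] closed by (simp add: defs)
  have ne: "w \<noteq> u" if "u \<in> pverts \<Gamma>" "x = stp d c u" "w = stp d' c' x" "{d, c, d', c'} \<subseteq> sgns" "(d', c') \<noteq> (- d, c)" for d c d' c' u w x
  proof
    assume "w = u"
    have x: "x \<in> pverts \<Gamma>" unfolding that(2) by (rule stp_V[OF that(1)])
    have "stp (- d) c x = u" unfolding that(2) by (rule stp_inv[OF that(1)]) (use that(4) in simp)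
    then have eq: "stp d' c' x = stp (- d) c x" using \<open>w = u\<close> that(3) by simp
    have "d' = - d \<and> c' = c" by (rule iffD1[OF stp_inj[OF x] eq]) (use that(4) in auto)
    then show False using that(5) by simp
  qed
  have "v2 \<noteq> v" by (rule ne[OF v v1_def v2_def _ nb(1)]) (use s in auto)
  moreover have "v3 \<noteq> v1" by (rule ne[OF V(1) v2_def v3_def _ nb(2)]) (use s in auto)
  moreover have "v4 \<noteq> v2" by (rule ne[OF V(2) v3_def v4_def _ nb(3)]) (use s in auto)
  moreover have "v \<noteq> v3" by (rule ne[OF V(3) v4_def v0 _ nb(4)]) (use s in auto)
  moreover have "v1 \<noteq> v4" by (rule ne[OF V(4) v0 v1_def _ nb(5)]) (use s in auto)
  moreover have "(v, v1) \<in> parcs \<Gamma>" "(v1, v2) \<in> parcs \<Gamma>" "(v2, v3) \<in> parcs \<Gamma>" "(v3, v4) \<in> parcs \<Gamma>"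
    using stp_arc v V s unfolding defs by auto
  moreover have "(v4, v) \<in> parcs \<Gamma>" using stp_arc[OF V(4), of d4 c4] s v0 by auto
  ultimately show ?thesis unfolding defs[symmetric] pentagon_def by auto
qed

section \<open>The orientation from layer to layer, and the action on lines of constant sign\<close>

definition forward :: "'a rel" where
  "forward = {(u, stp 1 c u) | u c. u \<in> pverts \<Gamma> \<and> c \<in> sgns}"

definition straight :: "('a \<Rightarrow> 'a) \<Rightarrow> bool" where
  "straight f \<longleftrightarrow> (\<forall>v\<in>pverts \<Gamma>. \<forall>d\<in>sgns. \<forall>c\<in>sgns. \<exists>d'\<in>sgns. \<exists>c'\<in>sgns.
     f (stp d c v) = stp d' c' (f v) \<and> f (stp d c (stp d c v)) = stp d' c' (stp d' c' (f v)))"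

text \<open>
  The line of sign \<open>c\<close> through \<open>v\<close> is mapped to a line of sign \<open>\<kappa> * c\<close>, in the same direction if
  \<open>\<epsilon> v c = 1\<close> and reversed if \<open>\<epsilon> v c = -1\<close>.
\<close>

definition sign_data :: "('a \<Rightarrow> 'a) \<Rightarrow> int \<Rightarrow> ('a \<Rightarrow> int \<Rightarrow> int) \<Rightarrow> bool" where
  "sign_data f \<kappa> \<epsilon> \<longleftrightarrow> \<kappa> \<in> sgns \<and> (\<forall>v\<in>pverts \<Gamma>. \<forall>c\<in>sgns. \<epsilon> v c \<in> sgns) \<and>
     (\<forall>v\<in>pverts \<Gamma>. \<forall>d\<in>sgns. \<forall>c\<in>sgns. f (stp d c v) = stp (d * \<epsilon> v c) (\<kappa> * c) (f v)) \<and>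
     (\<forall>v\<in>pverts \<Gamma>. \<forall>d\<in>sgns. \<forall>c\<in>sgns. \<epsilon> (stp d c v) c = \<epsilon> v c)"

lemma sign_dataD:
  assumes "sign_data f \<kappa> \<epsilon>"
  shows "\<kappa> \<in> sgns" "v \<in> pverts \<Gamma> \<Longrightarrow> c \<in> sgns \<Longrightarrow> \<epsilon> v c \<in> sgns"
    "v \<in> pverts \<Gamma> \<Longrightarrow> d \<in> sgns \<Longrightarrow> c \<in> sgns \<Longrightarrow> f (stp d c v) = stp (d * \<epsilon> v c) (\<kappa> * c) (f v)"
    "v \<in> pverts \<Gamma> \<Longrightarrow> d \<in> sgns \<Longrightarrow> c \<in> sgns \<Longrightarrow> \<epsilon> (stp d c v) c = \<epsilon> v c"
  using assms unfolding sign_data_def by blast+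

text \<open>Overlapping 2-paths on a line have images with the same letter, so direction and sign of
  the image are constant along the line. Two lines through a vertex have image signs that are
  opposite, and this makes the factor \<open>\<kappa>\<close> the same for both lines and, by
  connectedness, for all vertices.\<close>

lemma straight_signs:
  assumes f: "f \<in> graph_auto \<Gamma>" and st: "straight f"
  shows "\<exists>\<kappa> \<epsilon>. sign_data f \<kappa> \<epsilon>"
proof -
  let ?V = "pverts \<Gamma>"
  define Q where "Q v d c x \<longleftrightarrow> fst x \<in> sgns \<and> snd x \<in> sgns \<and> f (stp d c v) = stp (fst x) (snd x) (f v) \<and>
      f (stp d c (stp d c v)) = stp (fst x) (snd x) (stp (fst x) (snd x) (f v))" for v d c x
  define D C where "D v d c = fst (SOME x. Q v d c x)" and "C v d c = snd (SOME x. Q v d c x)" for v d c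
  have DC: "D v d c \<in> sgns \<and> C v d c \<in> sgns \<and>
      f (stp d c v) = stp (D v d c) (C v d c) (f v) \<and>
      f (stp d c (stp d c v)) = stp (D v d c) (C v d c) (stp (D v d c) (C v d c) (f v))"
    if v: "v \<in> ?V" and s: "d \<in> sgns" "c \<in> sgns" for v d c
  proof -
    have "\<exists>d'\<in>sgns. \<exists>c'\<in>sgns. f (stp d c v) = stp d' c' (f v) \<and> f (stp d c (stp d c v)) = stp d' c' (stp d' c' (f v))"
      using st v s unfolding straight_def by blast
    then obtain d' c' where "d' \<in> sgns" "c' \<in> sgns" "f (stp d c v) = stp d' c' (f v)"
      "f (stp d c (stp d c v)) = stp d' c' (stp d' c' (f v))" by blast
    then have "Q v d c (d', c')" by (simp only: Q_def fst_conv snd_conv simp_thms)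
    then have Q: "Q v d c (SOME x. Q v d c x)" by (rule someI)
    define z where "z = (SOME x. Q v d c x)"
    have eq: "D v d c = fst z" "C v d c = snd z" by (simp_all add: D_def C_def z_def)
    have "Q v d c z" using Q by (simp only: z_def)
    then show ?thesis unfolding eq by (simp only: Q_def[of v d c z])
  qed
  have fV: "f v \<in> ?V" if "v \<in> ?V" for v using auto_mem[OF f that] .
  have next_eq: "D (stp d c v) d c = D v d c \<and> C (stp d c v) d c = C v d c" if v: "v \<in> ?V" and s: "d \<in> sgns" "c \<in> sgns" for v d c
    using DC[OF v s] DC[OF stp_V[OF v, of d c] s] stp_inj[OF fV[OF stp_V[OF v, of d c]]] by metis
  have inv_eq: "D v (- d) c = - D v d c \<and> C v (- d) c = C v d c" if v: "v \<in> ?V" and s: "d \<in> sgns" "c \<in> sgns" for v d c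
  proof -
    define u where "u = stp (- d) c v"
    have u: "u \<in> ?V" "stp d c u = v" using stp_V[OF v] stp_inv[OF v sgns_neg[OF s(1)], of c] by (simp_all add: u_def)
    have eq: "D v d c = D u d c" "C v d c = C u d c" using next_eq[OF u(1) s] u(2) by simp_all
    have "f v = stp (D u d c) (C u d c) (f u)" using DC[OF u(1) s] u(2) by simp
    then have "f u = stp (- D u d c) (C u d c) (f v)" using stp_inv[OF fV[OF u(1)]] DC[OF u(1) s] by simp
    then have E: "stp (D v (- d) c) (C v (- d) c) (f v) = stp (- D v d c) (C v d c) (f v)"
      using DC[OF v sgns_neg[OF s(1)] s(2)] eq by (simp add: u_def)
    have S: "D v d c \<in> sgns" "C v d c \<in> sgns" "D v (- d) c \<in> sgns" "C v (- d) c \<in> sgns"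
      using DC[OF v s] DC[OF v sgns_neg[OF s(1)] s(2)] by blast+
    show ?thesis by (rule iffD1[OF stp_inj[OF fV[OF v] S(3,4) sgns_neg[OF S(1)] S(2)] E])
  qed
  define \<epsilon> where "\<epsilon> v c = D v 1 c" for v c
  have D_eq: "D v d c = d * \<epsilon> v c" "C v d c = C v 1 c" if "v \<in> ?V" "d \<in> sgns" "c \<in> sgns" for v d c
    using inv_eq[of v 1 c] that by (auto simp: \<epsilon>_def)
  \<comment> \<open>With equal image signs, a step along one line and a suitably directed step along
    the other would have the same image.\<close>
  have C_ne: "C v 1 (-1) = - C v 1 1" if v: "v \<in> ?V" for v
  proof (rule ccontr)
    assume ne: "C v 1 (-1) \<noteq> - C v 1 1"
    then have eq: "C v 1 (-1) = C v 1 1" using DC[OF v, of 1 1] DC[OF v, of 1 "-1"] by auto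
    define d where "d = \<epsilon> v 1 * \<epsilon> v (-1)"
    have d: "d \<in> sgns" "d * \<epsilon> v (-1) = \<epsilon> v 1" using DC[OF v, of 1 1] DC[OF v, of 1 "-1"] by (auto simp: d_def \<epsilon>_def)
    have "f (stp d (-1) v) = f (stp 1 1 v)"
      using DC[OF v d(1), of "-1"] DC[OF v, of 1 1] D_eq[OF v d(1), of "-1"] d(2) eq by (simp add: \<epsilon>_def)
    then have "stp d (-1) v = stp 1 1 v" using auto_inj[OF f] stp_V[OF v] by blast
    then show False using stp_inj[OF v d(1), of "-1" 1 1] by simp
  qed
  define \<kappa>' where "\<kappa>' v = C v 1 1" for v
  have C_eq: "C v d c = \<kappa>' v * c" if "v \<in> ?V" "d \<in> sgns" "c \<in> sgns" for v d c
    using D_eq(2)[OF that] C_ne that by (auto simp: \<kappa>'_def)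
  have "\<kappa>' (stp d c v) = \<kappa>' v" if v: "v \<in> ?V" and s: "d \<in> sgns" "c \<in> sgns" for v d c
    using next_eq[OF v s] C_eq[OF v s] C_eq[OF stp_V[OF v] s, of d c] s(2) by auto
  then have "\<kappa>' y = \<kappa>' x" if "(x, y) \<in> parcs \<Gamma>" for x y
    using that arc_verts[OF that] arc_iff_stp by metis
  then have const: "\<kappa>' v = \<kappa>' (pt 0 0)" if "v \<in> ?V" for v
    using connected_induct[of "pt 0 0" "\<lambda>v. \<kappa>' v = \<kappa>' (pt 0 0)" v] pt_V that by metis
  define \<kappa> where "\<kappa> = \<kappa>' (pt 0 0)"
  show ?thesis
    unfolding sign_data_def
  proof (intro exI[of _ \<kappa>] exI[of _ \<epsilon>] conjI ballI)
    show "\<kappa> \<in> sgns" using DC[OF pt_V, of 1 1] by (simp add: \<kappa>_def \<kappa>'_def)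
    show "\<epsilon> v c \<in> sgns" if "v \<in> ?V" "c \<in> sgns" for v c using DC[of v 1 c] that by (simp add: \<epsilon>_def)
    show "f (stp d c v) = stp (d * \<epsilon> v c) (\<kappa> * c) (f v)" if "v \<in> ?V" "d \<in> sgns" "c \<in> sgns" for v d c
      using DC[OF that] D_eq[OF that] C_eq[OF that] const[OF that(1)] by (simp add: \<kappa>_def)
    show "\<epsilon> (stp d c v) c = \<epsilon> v c" if "v \<in> ?V" "d \<in> sgns" "c \<in> sgns" for v d c
      using next_eq[OF that] D_eq[OF that] D_eq[OF stp_V[OF that(1)] that(2,3), of d c] that(2) by auto
  qed
qed

end

section \<open>The case of five layers\<close>

lemma odd_dvd_double: "odd r \<Longrightarrow> int r dvd 2 * a \<longleftrightarrow> int r dvd a"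
  by (simp add: coprime_dvd_mult_right_iff)

lemma dvd_sgns_mult: "s \<in> sgns \<Longrightarrow> d dvd s * a \<longleftrightarrow> d dvd a"
  for a d :: int by auto

text \<open>
  Multiplication by \<open>q\<close> rotates the signs, so up to rotation and negation only three sign patterns have
  to be excluded. For each of them, $2(x-1)$ is an integral combination of its polynomial and $x^5-1$.
\<close>

lemma sum_of_signed_powers:
  fixes r :: nat and q :: int
  assumes r: "odd r" and q5: "int r dvd q ^ 5 - 1" and q1: "\<not> int r dvd q - 1"
    and c: "c0 \<in> sgns" "c1 \<in> sgns" "c2 \<in> sgns" "c3 \<in> sgns" "c4 \<in> sgns"
    and S: "int r dvd c0 + c1 * q + c2 * q ^ 2 + c3 * q ^ 3 + c4 * q ^ 4"
  shows "c1 = c0 \<and> c2 = c0 \<and> c3 = c0 \<and> c4 = c0"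
proof -
  define P where "P a b c d e \<longleftrightarrow> int r dvd a + b * q + c * q ^ 2 + d * q ^ 3 + e * q ^ 4" for a b c d e
  have rot: "P e a b c d" if "P a b c d e" for a b c d e
  proof -
    have "e + a * q + b * q ^ 2 + c * q ^ 3 + d * q ^ 4 =
        q * (a + b * q + c * q ^ 2 + d * q ^ 3 + e * q ^ 4) - e * (q ^ 5 - 1)" by algebra
    then show ?thesis using that q5 unfolding P_def by simp
  qed
  have neg: "P (-a) (-b) (-c) (-d) (-e) \<longleftrightarrow> P a b c d e" for a b c d e
  proof -
    have "-a + -b * q + -c * q ^ 2 + -d * q ^ 3 + -e * q ^ 4 = - (a + b * q + c * q ^ 2 + d * q ^ 3 + e * q ^ 4)" by algebra
    then show ?thesis unfolding P_def by (simp only: dvd_minus_iff)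
  qed
  have two: "\<not> P a b c d e" if "2 * (q - 1) = A * (a + b * q + c * q ^ 2 + d * q ^ 3 + e * q ^ 4) + B * (q ^ 5 - 1)" for A B a b c d e
  proof
    assume "P a b c d e"
    then have "int r dvd 2 * (q - 1)" unfolding P_def that using q5 by simp
    then show False using q1 odd_dvd_double[OF r] by blast
  qed
  have N1: "\<not> P 1 1 1 1 (-1)" by (rule two[of "q - q ^ 2" _ _ _ _ _ "2 - q"]) algebra
  have N2: "\<not> P 1 1 1 (-1) (-1)" by (rule two[of "- 1 + q - q ^ 3 + q ^ 4" _ _ _ _ _ "1 - 2 * q + q ^ 3"]) algebra
  have N3: "\<not> P 1 1 (-1) 1 (-1)" by (rule two[of "q - q ^ 4" _ _ _ _ _ "2 - q + q ^ 2 - q ^ 3"]) algebra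
  note N = N1 N2 N3 neg[of 1 1 1 1 "-1"] neg[of 1 1 1 "-1" "-1"] neg[of 1 1 "-1" 1 "-1"]
  have P0: "P c0 c1 c2 c3 c4" using S by (simp add: P_def)
  note P1 = rot[OF P0] note P2 = rot[OF P1] note P3 = rot[OF P2] note P4 = rot[OF P3]
  show ?thesis using c P0 P1 P2 P3 P4 N by (elim insertE emptyE; simp)
qed

locale labelled_5 = labelled_graph \<Gamma> 5 r q pt for \<Gamma> :: "'a pair_pre_digraph" and r q pt +
  assumes q_ne_1: "\<not> int r dvd q - 1"
begin

lemma p_values: "pw 5 q 0 = 1" "pw 5 q 1 = q" "pw 5 q 2 = q ^ 2" "pw 5 q 3 = q ^ 3" "pw 5 q 4 = q ^ 4"
  "pw 5 q (-1) = q ^ 4" "pw 5 q (-2) = q ^ 3" "pw 5 q (-3) = q ^ 2" "pw 5 q (-4) = q" "pw 5 q (-5) = 1"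
  by (simp_all add: pw_def)

text \<open>A sum of five signs divisible by 5 has all signs equal, so the walk goes once through
  all layers. Then \<open>sum_of_signed_powers\<close> applies to the signs of the edges.\<close>

lemma pentagon_steps:
  assumes "pentagon v0 v1 v2 v3 v4"
  shows "int r dvd 1 + q + q ^ 2 + q ^ 3 + q ^ 4 \<and> (\<exists>d\<in>sgns. \<exists>c\<in>sgns. v1 = stp d c v0 \<and> v2 = stp d c v1 \<and> v3 = stp d c v2 \<and> v4 = stp d c v3 \<and> v0 = stp d c v4)"
proof -
  from pentagon_word[OF assms] obtain d0 c0 d1 c1 d2 c2 d3 c3 d4 c4 where
    s: "{d0, c0, d1, c1, d2, c2, d3, c3, d4, c4} \<subseteq> sgns"
    and v: "v1 = stp d0 c0 v0" "v2 = stp d1 c1 v1" "v3 = stp d2 c2 v2" "v4 = stp d3 c3 v3" "v0 = stp d4 c4 v4"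
    and cl: "closed_word 5 r q [(d0, c0), (d1, c1), (d2, c2), (d3, c3), (d4, c4)]" by metis
  have sd: "d0 \<in> sgns" "d1 \<in> sgns" "d2 \<in> sgns" "d3 \<in> sgns" "d4 \<in> sgns"
    and sc: "c0 \<in> sgns" "c1 \<in> sgns" "c2 \<in> sgns" "c3 \<in> sgns" "c4 \<in> sgns" using s by simp_all
  have "5 dvd d0 + d1 + d2 + d3 + d4" using cl by (simp add: closed_word_def add.assoc)
  then have d: "d1 = d0 \<and> d2 = d0 \<and> d3 = d0 \<and> d4 = d0" using sd by (elim insertE emptyE; simp)
  have eq: "c1 = c0 \<and> c2 = c0 \<and> c3 = c0 \<and> c4 = c0 \<and> int r dvd c0 * (1 + q + q ^ 2 + q ^ 3 + q ^ 4)"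
  proof (cases "d0 = 1")
    case True
    then have S: "int r dvd c0 + c1 * q + c2 * q ^ 2 + c3 * q ^ 3 + c4 * q ^ 4"
      using cl d by (simp add: closed_word_def p_values add.assoc)
    from sum_of_signed_powers[OF r_odd q_m q_ne_1 sc S] have c: "c1 = c0" "c2 = c0" "c3 = c0" "c4 = c0" by auto
    show ?thesis using S unfolding c by (simp add: algebra_simps)
  next
    case False
    \<comment> \<open>Going down from layer 0 meets the powers of \<open>q\<close> in the order 4,
      3, 2, 1, 0.\<close>
    then have "d0 = -1" using sd by simp
    then have "int r dvd - (c4 + c3 * q + c2 * q ^ 2 + c1 * q ^ 3 + c0 * q ^ 4)"
      using cl d by (simp add: closed_word_def p_values algebra_simps)
    then have S: "int r dvd c4 + c3 * q + c2 * q ^ 2 + c1 * q ^ 3 + c0 * q ^ 4" by (simp only: dvd_minus_iff)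
    from sum_of_signed_powers[OF r_odd q_m q_ne_1 sc(5,4,3,2,1) S] have c: "c1 = c0" "c2 = c0" "c3 = c0" "c4 = c0" by auto
    show ?thesis using S unfolding c by (simp add: algebra_simps)
  qed
  then have "int r dvd 1 + q + q ^ 2 + q ^ 3 + q ^ 4" using dvd_sgns_mult[OF sc(1)] by blast
  then show ?thesis using v d eq sd(1) sc(1) by metis
qed

end

locale labelled_5_cyclic = labelled_5 +
  assumes cyclotomic: "int r dvd 1 + q + q ^ 2 + q ^ 3 + q ^ 4"
begin

section \<open>Automorphisms preserve the lines, then their directions\<close>

lemma straight_pentagon:
  assumes "v \<in> pverts \<Gamma>" "d \<in> sgns" "c \<in> sgns"
  shows "pentagon v (stp d c v) (stp d c (stp d c v)) (stp d c (stp d c (stp d c v))) (stp d c (stp d c (stp d c (stp d c v))))"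
proof (rule word_pentagon[where ?d4.0 = d and ?c4.0 = c])
  have "d * c * (1 + q + q ^ 2 + q ^ 3 + q ^ 4) = disp 5 q [(d, c), (d, c), (d, c), (d, c), (d, c)] 0"
    using assms(2) by (elim insertE emptyE) (simp_all add: p_values algebra_simps)
  then have "int r dvd disp 5 q [(d, c), (d, c), (d, c), (d, c), (d, c)] 0"
    using cyclotomic by (metis dvd_mult)
  then show "closed_word 5 r q [(d, c), (d, c), (d, c), (d, c), (d, c)]" by (simp add: closed_word_def)
qed (use assms in auto)

text \<open>A straight 2-path extends to a straight 5-cycle, and the image of this 5-cycle is
  straight by \<open>pentagon_steps\<close>.\<close>

lemma straight_auto:
  assumes f: "f \<in> graph_auto \<Gamma>" shows "straight f"
  unfolding straight_def
proof (intro ballI)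
  fix v d c assume v: "v \<in> pverts \<Gamma>" and s: "d \<in> sgns" "c \<in> sgns"
  note P = straight_pentagon[OF v s]
  from pentagon_steps[OF iffD2[OF auto_pentagon[OF f pentagon_verts[OF P]] P]]
  show "\<exists>d'\<in>sgns. \<exists>c'\<in>sgns. f (stp d c v) = stp d' c' (f v) \<and> f (stp d c (stp d c v)) = stp d' c' (stp d' c' (f v))"
    by metis
qed

text \<open>Together with \<open>q ^ 5 = 1\<close>, either congruence gives \<open>q ^ 4 = 1\<close>
  and so \<open>q = 1\<close> modulo \<open>r\<close>.\<close>

lemma power_5_cases: "int r dvd q ^ 2 - 1 \<Longrightarrow> False" "int r dvd q ^ 2 + 1 \<Longrightarrow> False"
proof -
  show False if "int r dvd q ^ 2 - 1"
  proof -
    have "q - 1 = (q ^ 5 - 1) - (q ^ 3 + q) * (q ^ 2 - 1)" by algebra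
    then show False using that q_m q_ne_1 by (metis dvd_diff dvd_mult)
  qed
  show False if "int r dvd q ^ 2 + 1"
  proof -
    have "q - 1 = (q ^ 5 - 1) - (q ^ 3 - q) * (q ^ 2 + 1)" by algebra
    then show False using that q_m q_ne_1 by (metis dvd_diff dvd_mult)
  qed
qed

text \<open>The image of the octagon when exactly one line is reversed at \<open>v\<close> but not
  at the next vertex. The sum of the directions must vanish modulo 5, which forces
  \<open>y = z = - \<sigma>\<close> and \<open>w = \<sigma>\<close>; the displacement is then
  \<open>2 * q * (q ^ 2 + 1)\<close> up to sign.\<close>

lemma octagon_mixed:
  assumes "{\<sigma>, y, z, w, c} \<subseteq> sgns"
  shows "\<not> closed_word 5 r q [(-\<sigma>, -c), (-\<sigma>, -c), (-y, c), (-z, -c), (w, c), (w, c), (-\<sigma>, -c), (-\<sigma>, c)]"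
proof
  assume cl: "closed_word 5 r q [(-\<sigma>, -c), (-\<sigma>, -c), (-y, c), (-z, -c), (w, c), (w, c), (-\<sigma>, -c), (-\<sigma>, c)]"
  have s: "\<sigma> \<in> sgns" "y \<in> sgns" "z \<in> sgns" "w \<in> sgns" "c \<in> sgns" using assms by simp_all
  have eq: "y = - \<sigma> \<and> z = - \<sigma> \<and> w = \<sigma>"
  proof -
    have "5 dvd 2 * w - 4 * \<sigma> - y - z" using cl by (simp add: closed_word_def algebra_simps)
    then show ?thesis using s(1-4) by (elim insertE emptyE; simp)
  qed
  have "disp 5 q [(-\<sigma>, -c), (-\<sigma>, -c), (\<sigma>, c), (\<sigma>, -c), (\<sigma>, c), (\<sigma>, c), (-\<sigma>, -c), (-\<sigma>, c)] 0 = 2 * (\<sigma> * c * (q * (q ^ 2 + 1)))"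
    using s(1) by (elim insertE emptyE) (simp_all add: p_values algebra_simps power2_eq_square power3_eq_cube)
  then have "int r dvd 2 * (\<sigma> * c * (q * (q ^ 2 + 1)))" using cl eq by (simp add: closed_word_def)
  then have "int r dvd q * (q ^ 2 + 1)"
    using odd_dvd_double[OF r_odd] dvd_sgns_mult[OF sgns_mult[OF s(1,5)]] by blast
  then have "int r dvd q ^ 2 + 1" using q_coprime by (simp add: coprime_dvd_mult_right_iff coprime_commute)
  then show False by (rule power_5_cases(2))
qed

text \<open>The image of the octagon when at every vertex the lines of one fixed sign are the
  reversed ones. Its displacement and the cyclotomic sum generate 5, hence \<open>r = 5\<close>.
  Modulo 5 the cyclotomic sum is \<open>(q - 1) ^ 4\<close>, so \<open>q = 1\<close>, which is
  excluded.\<close>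

lemma octagon_alternating:
  assumes "{\<sigma>, c} \<subseteq> sgns"
  shows "\<not> closed_word 5 r q [(-\<sigma>, -c), (-\<sigma>, -c), (-\<sigma>, c), (\<sigma>, -c), (\<sigma>, c), (\<sigma>, c), (\<sigma>, -c), (-\<sigma>, c)]"
proof
  assume cl: "closed_word 5 r q [(-\<sigma>, -c), (-\<sigma>, -c), (-\<sigma>, c), (\<sigma>, -c), (\<sigma>, c), (\<sigma>, c), (\<sigma>, -c), (-\<sigma>, c)]"
  have s: "\<sigma> \<in> sgns" "c \<in> sgns" using assms by simp_all
  have "int r dvd 5"
  proof (cases "\<sigma> = 1")
    case True
    then have "disp 5 q [(-\<sigma>, -c), (-\<sigma>, -c), (-\<sigma>, c), (\<sigma>, -c), (\<sigma>, c), (\<sigma>, c), (\<sigma>, -c), (-\<sigma>, c)] 0 = c * (2 * (q ^ 4 + q ^ 3 - q ^ 2 - 1))"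
      by (simp add: p_values algebra_simps)
    then have "int r dvd q ^ 4 + q ^ 3 - q ^ 2 - 1"
      using cl dvd_sgns_mult[OF s(2)] odd_dvd_double[OF r_odd] unfolding closed_word_def by metis
    then show ?thesis using cyclotomic by algebra
  next
    case False
    then have "\<sigma> = -1" using s(1) by simp
    then have "disp 5 q [(-\<sigma>, -c), (-\<sigma>, -c), (-\<sigma>, c), (\<sigma>, -c), (\<sigma>, c), (\<sigma>, c), (\<sigma>, -c), (-\<sigma>, c)] 0 = c * (2 * (q ^ 4 + q ^ 2 - q - 1))"
      by (simp add: p_values algebra_simps)
    then have "int r dvd q ^ 4 + q ^ 2 - q - 1"
      using cl dvd_sgns_mult[OF s(2)] odd_dvd_double[OF r_odd] unfolding closed_word_def by metis
    then show ?thesis using cyclotomic by algebra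
  qed
  then have r5: "r dvd 5" by (metis of_nat_dvd_iff of_nat_numeral)
  then have "r \<le> 5" by (auto dest: dvd_imp_le)
  then have "r = 3 \<or> r = 4 \<or> r = 5" using r_ge_3 by linarith
  then have r5: "r = 5" using r5 by auto
  have "(q - 1) ^ 4 = (1 + q + q ^ 2 + q ^ 3 + q ^ 4) - 5 * (q ^ 3 - q ^ 2 + q)" by algebra
  then have "5 dvd (q - 1) ^ 4" using cyclotomic r5 by (metis dvd_diff dvd_triv_left of_nat_numeral)
  then have "5 dvd q - 1" using prime_dvd_power[of "5::int" "q - 1" 4] by simp
  then show False using q_ne_1 r5 by simp
qed

text \<open>
  The word \<open>(1,-c) (1,-c) (-1,c) (-1,-c) (1,c) (1,c) (-1,-c) (-1,c)\<close> is closed for every \<open>q\<close>; the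
  conclusion is its image under \<open>f\<close>.
\<close>

lemma octagon:
  assumes V: "v \<in> pverts \<Gamma>" and c: "c \<in> sgns" and f: "f \<in> graph_auto \<Gamma>" and sd: "sign_data f \<kappa> \<epsilon>"
  obtains v2 v3 v4 where "v2 \<in> pverts \<Gamma>" "v3 \<in> pverts \<Gamma>" "v4 \<in> pverts \<Gamma>"
    "closed_word 5 r q [(\<epsilon> v (-c), - (\<kappa> * c)), (\<epsilon> v (-c), - (\<kappa> * c)), (- \<epsilon> v2 c, \<kappa> * c), (- \<epsilon> v3 (-c), - (\<kappa> * c)),
       (\<epsilon> v4 c, \<kappa> * c), (\<epsilon> v4 c, \<kappa> * c), (- \<epsilon> (stp 1 c v) (-c), - (\<kappa> * c)), (- \<epsilon> v c, \<kappa> * c)]"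
proof -
  note F = sign_dataD(3)[OF sd] and E = sign_dataD(4)[OF sd]
  have c': "-c \<in> sgns" using c by (rule sgns_neg)
  have d: "1 \<in> sgns" "-1 \<in> sgns" by simp_all
  define v1 v2 v3 v4 v5 v6 v7 where defs: "v1 = stp 1 (-c) v" "v2 = stp 1 (-c) v1" "v3 = stp (-1) c v2"
    "v4 = stp (-1) (-c) v3" "v5 = stp 1 c v4" "v6 = stp 1 c v5" "v7 = stp (-1) (-c) v6"
  have V1: "v1 \<in> pverts \<Gamma>" unfolding defs by (rule stp_V[OF V])
  have V2: "v2 \<in> pverts \<Gamma>" unfolding defs(2) by (rule stp_V[OF V1])
  have V3: "v3 \<in> pverts \<Gamma>" unfolding defs(3) by (rule stp_V[OF V2])
  have V4: "v4 \<in> pverts \<Gamma>" unfolding defs(4) by (rule stp_V[OF V3])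
  have V5: "v5 \<in> pverts \<Gamma>" unfolding defs(5) by (rule stp_V[OF V4])
  have V6: "v6 \<in> pverts \<Gamma>" unfolding defs(6) by (rule stp_V[OF V5])
  have V7: "v7 \<in> pverts \<Gamma>" unfolding defs(7) by (rule stp_V[OF V6])
  have "closed_word 5 r q [(1, -c), (1, -c), (-1, c), (-1, -c), (1, c), (1, c), (-1, -c), (-1, c)]"
    by (simp add: closed_word_def p_values)
  from iffD2[OF run_closed_iff[OF V] this] have v8: "stp (-1) c v7 = v" by (simp only: run_simps defs)
  \<comment> \<open>Read backwards from \<open>v\<close>, the last two steps place \<open>v7\<close>
    and \<open>v6\<close> on lines through \<open>v\<close> and \<open>stp 1 c v\<close>, so the
    values of \<open>\<epsilon>\<close> there are known.\<close>
  have v7: "v7 = stp 1 c v" using stp_inv[OF V7 d(2), of c] v8 by simp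
  have v6: "v6 = stp 1 (-c) v7" using stp_inv[OF V6 d(2), of "-c"] defs(7) by simp
  have e1: "\<epsilon> v1 (-c) = \<epsilon> v (-c)" unfolding defs(1) by (rule E[OF V d(1) c'])
  have e5: "\<epsilon> v5 c = \<epsilon> v4 c" unfolding defs(5) by (rule E[OF V4 d(1) c])
  have e6: "\<epsilon> v6 (-c) = \<epsilon> (stp 1 c v) (-c)" unfolding v6 v7[symmetric] by (rule E[OF V7 d(1) c'])
  have e7: "\<epsilon> v7 c = \<epsilon> v c" unfolding v7 by (rule E[OF V d(1) c])
  have F': "f v1 = stp (\<epsilon> v (-c)) (- (\<kappa> * c)) (f v)" "f v2 = stp (\<epsilon> v (-c)) (- (\<kappa> * c)) (f v1)"
    "f v3 = stp (- \<epsilon> v2 c) (\<kappa> * c) (f v2)" "f v4 = stp (- \<epsilon> v3 (-c)) (- (\<kappa> * c)) (f v3)"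
    "f v5 = stp (\<epsilon> v4 c) (\<kappa> * c) (f v4)" "f v6 = stp (\<epsilon> v4 c) (\<kappa> * c) (f v5)"
    "f v7 = stp (- \<epsilon> (stp 1 c v) (-c)) (- (\<kappa> * c)) (f v6)" "f v = stp (- \<epsilon> v c) (\<kappa> * c) (f v7)"
    using F[OF V d(1) c'] F[OF V1 d(1) c'] F[OF V2 d(2) c] F[OF V3 d(2) c'] F[OF V4 d(1) c] F[OF V5 d(1) c] F[OF V6 d(2) c'] F[OF V7 d(2) c]
    unfolding defs[symmetric] v8 e1 e5 e6 e7 by simp_all
  have "run [(\<epsilon> v (-c), - (\<kappa> * c)), (\<epsilon> v (-c), - (\<kappa> * c)), (- \<epsilon> v2 c, \<kappa> * c), (- \<epsilon> v3 (-c), - (\<kappa> * c)),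
       (\<epsilon> v4 c, \<kappa> * c), (\<epsilon> v4 c, \<kappa> * c), (- \<epsilon> (stp 1 c v) (-c), - (\<kappa> * c)), (- \<epsilon> v c, \<kappa> * c)] (f v) = f v"
    by (simp only: run_simps F'[symmetric])
  then show ?thesis using that[OF V2 V3 V4] run_closed_iff[OF auto_mem[OF f V]] by blast
qed

text \<open>
  Two walks from \<open>pt 0 0\<close> to \<open>pt 0 (2 * q)\<close>, one of them between two layers only, would have images
  with the same end only if $q^2 = 1$.
\<close>

lemma no_reversing_auto:
  assumes f: "f \<in> graph_auto \<Gamma>" and k: "\<kappa> \<in> sgns"
    and F: "\<And>v d c. v \<in> pverts \<Gamma> \<Longrightarrow> d \<in> sgns \<Longrightarrow> c \<in> sgns \<Longrightarrow> f (stp d c v) = stp (- d) (\<kappa> * c) (f v)"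
  shows False
proof -
  obtain a b where ab: "f (pt 0 0) = pt a b" using pt_surj[OF auto_mem[OF f pt_V]] by blast
  have step: "f (pt 0 (y + 2)) = pt a (z - 2 * \<kappa> * pw 5 q (a - 1))" if "f (pt 0 y) = pt a z" for y z
  proof -
    have "pt 0 (y + 2) = stp (-1) (-1) (stp 1 1 (pt 0 y))" by (simp add: stp_pt p_values add.commute)
    then have "f (pt 0 (y + 2)) = stp 1 (- \<kappa>) (stp (-1) \<kappa> (pt a z))"
      using F[OF pt_V, of 1 1 0 y] F[OF stp_V[OF pt_V], of "-1" "-1" 1 1 0 y] that by simp
    then show ?thesis by (simp add: stp_pt algebra_simps)
  qed
  have iter: "f (pt 0 (2 * int n)) = pt a (b - 2 * int n * \<kappa> * pw 5 q (a - 1))" for n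
  proof (induction n)
    case (Suc n)
    have "f (pt 0 (2 * int n + 2)) = pt a (b - 2 * int n * \<kappa> * pw 5 q (a - 1) - 2 * \<kappa> * pw 5 q (a - 1))" by (rule step[OF Suc])
    then show ?case by (simp add: algebra_simps)
  qed (use ab in simp)
  \<comment> \<open>A zigzag between two layers advances the label by 2, so \<open>n\<close> of them
    reach \<open>2 * q\<close> when \<open>n\<close> is a natural number congruent to
    \<open>q\<close>. The other walk makes two steps up and two down.\<close>
  define n where "n = nat (q mod int r)"
  have n: "int r dvd int n - q" using r_ge_3 by (simp add: n_def mod_eq_dvd_iff[symmetric])
  have "int r dvd 2 * int n - 2 * q" using n by (metis dvd_mult right_diff_distrib)
  then have "pt 0 (2 * q) = pt 0 (2 * int n)" by (simp add: pt_eq dvd_diff_commute)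
  then have 1: "f (pt 0 (2 * q)) = pt a (b - 2 * int n * \<kappa> * pw 5 q (a - 1))" using iter by simp
  have "pt 0 (2 * q) = stp (-1) 1 (stp (-1) (-1) (stp 1 1 (stp 1 1 (pt 0 0))))" by (simp add: stp_pt p_values)
  then have "f (pt 0 (2 * q)) = stp 1 \<kappa> (stp 1 (- \<kappa>) (stp (-1) \<kappa> (stp (-1) \<kappa> (pt a b))))"
    using F[OF pt_V, of 1 1 0 0] F[OF stp_V[OF pt_V], of 1 1 1 1 0 0] F[OF stp_V[OF stp_V[OF pt_V]], of "-1" "-1" 1 1 1 1 0 0]
      F[OF stp_V[OF stp_V[OF stp_V[OF pt_V]]], of "-1" 1 "-1" "-1" 1 1 1 1 0 0] ab by simp
  then have 2: "f (pt 0 (2 * q)) = pt a (b - 2 * \<kappa> * pw 5 q (a - 2))" by (simp add: stp_pt algebra_simps)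
  have "int r dvd 2 * (\<kappa> * (int n * pw 5 q (a - 1) - pw 5 q (a - 2)))"
    using 1 2 by (simp add: pt_eq algebra_simps dvd_diff_commute)
  then have 3: "int r dvd int n * pw 5 q (a - 1) - pw 5 q (a - 2)"
    using odd_dvd_double[OF r_odd] dvd_sgns_mult[OF k] by blast
  have 4: "int r dvd pw 5 q (a - 1) - pw 5 q (a - 2) * q" using p_add[of "a - 2" 1] by (simp add: p_values)
  have "pw 5 q (a - 2) * (q ^ 2 - 1) = (int n * pw 5 q (a - 1) - pw 5 q (a - 2))
      - int n * (pw 5 q (a - 1) - pw 5 q (a - 2) * q) - (int n - q) * (pw 5 q (a - 2) * q)" by algebra
  then have "int r dvd pw 5 q (a - 2) * (q ^ 2 - 1)" using n 3 4 by (metis dvd_diff dvd_mult dvd_mult2)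
  then show False using p_dvd_cancel power_5_cases(1) by blast
qed

text \<open>\<open>M\<close> spreads forward by \<open>octagon_mixed\<close> and is therefore
  constant on the graph. If it held everywhere, \<open>\<epsilon>\<close> would depend on the sign
  only, against \<open>octagon_alternating\<close>. So \<open>\<epsilon>\<close> is one global sign,
  and \<open>no_reversing_auto\<close> excludes -1.\<close>

lemma forward_preserved:
  assumes f: "f \<in> graph_auto \<Gamma>" and uv: "(u, v) \<in> forward"
  shows "(f u, f v) \<in> forward"
proof -
  obtain \<kappa> \<epsilon> where sd: "sign_data f \<kappa> \<epsilon>" using straight_signs[OF f straight_auto[OF f]] by blast
  note k = sign_dataD(1)[OF sd] and eps = sign_dataD(2)[OF sd] and F = sign_dataD(3)[OF sd] and E = sign_dataD(4)[OF sd]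
  \<comment> \<open>\<open>M v\<close>: exactly one of the two lines through \<open>v\<close> is reversed.\<close>
  define M where "M v \<longleftrightarrow> \<epsilon> v 1 = - \<epsilon> v (-1)" for v
  have eps_cases: "\<epsilon> v (-c) = (if M v then - \<epsilon> v c else \<epsilon> v c)" if "v \<in> pverts \<Gamma>" "c \<in> sgns" for v c
    using eps[of v 1] eps[of v "-1"] that by (auto simp: M_def)
  have M_step: "M (stp 1 c v)" if v: "v \<in> pverts \<Gamma>" and c: "c \<in> sgns" and M: "M v" for v c
  proof (rule ccontr)
    assume nM: "\<not> M (stp 1 c v)"
    obtain v2 v3 v4 where V: "v2 \<in> pverts \<Gamma>" "v3 \<in> pverts \<Gamma>" "v4 \<in> pverts \<Gamma>" and
      cl: "closed_word 5 r q [(\<epsilon> v (-c), - (\<kappa> * c)), (\<epsilon> v (-c), - (\<kappa> * c)), (- \<epsilon> v2 c, \<kappa> * c), (- \<epsilon> v3 (-c), - (\<kappa> * c)),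
       (\<epsilon> v4 c, \<kappa> * c), (\<epsilon> v4 c, \<kappa> * c), (- \<epsilon> (stp 1 c v) (-c), - (\<kappa> * c)), (- \<epsilon> v c, \<kappa> * c)]"
      by (rule octagon[OF v c f sd])
    have e: "\<epsilon> v (-c) = - \<epsilon> v c" "\<epsilon> (stp 1 c v) (-c) = \<epsilon> v c"
      using eps_cases[OF v c] eps_cases[OF stp_V[OF v] c, of 1 c] M nM E[OF v, of 1 c] c by simp_all
    have "{\<epsilon> v c, \<epsilon> v2 c, \<epsilon> v3 (-c), \<epsilon> v4 c, \<kappa> * c} \<subseteq> sgns"
      using eps v V c sgns_neg[OF c] sgns_mult[OF k c] by (simp only: insert_subset empty_subsetI simp_thms)
    from octagon_mixed[OF this] cl show False unfolding e by blast
  qed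
  have M_arc: "M y \<longleftrightarrow> M x" if xy: "(x, y) \<in> parcs \<Gamma>" for x y
  proof -
    have fw: "M (stp 1 c v) \<longleftrightarrow> M v" if v: "v \<in> pverts \<Gamma>" and c: "c \<in> sgns" for v c
    proof
      \<comment> \<open>Four further steps with the same letter lead from \<open>stp 1 c v\<close>
        back to \<open>v\<close>, so spreading forward also gives the converse.\<close>
      assume m: "M (stp 1 c v)"
      have one: "1 \<in> sgns" by simp
      have V1: "stp 1 c v \<in> pverts \<Gamma>" by (rule stp_V[OF v])
      have V2: "stp 1 c (stp 1 c v) \<in> pverts \<Gamma>" by (rule stp_V[OF V1])
      have V3: "stp 1 c (stp 1 c (stp 1 c v)) \<in> pverts \<Gamma>" by (rule stp_V[OF V2])
      have V4: "stp 1 c (stp 1 c (stp 1 c (stp 1 c v))) \<in> pverts \<Gamma>" by (rule stp_V[OF V3])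
      have "M (stp 1 c (stp 1 c (stp 1 c (stp 1 c (stp 1 c v)))))"
        using M_step[OF V4 c] M_step[OF V3 c] M_step[OF V2 c] M_step[OF V1 c] m by blast
      moreover have "stp 1 c (stp 1 c (stp 1 c (stp 1 c (stp 1 c v)))) = v"
      proof -
        have "int r dvd disp 5 q [(1, c), (1, c), (1, c), (1, c), (1, c)] 0"
        proof -
          have "disp 5 q [(1, c), (1, c), (1, c), (1, c), (1, c)] 0 = c * (1 + q + q ^ 2 + q ^ 3 + q ^ 4)"
            by (simp add: p_values algebra_simps)
          then show ?thesis using cyclotomic by simp
        qed
        then have "closed_word 5 r q [(1, c), (1, c), (1, c), (1, c), (1, c)]" by (simp add: closed_word_def)
        from iffD2[OF run_closed_iff[OF v] this] show ?thesis by simp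
      qed
      ultimately show "M v" by simp
    qed (rule M_step[OF v c])
    obtain d c where dc: "d \<in> sgns" "c \<in> sgns" "y = stp d c x" using step_exists[OF xy] by blast
    have V: "x \<in> pverts \<Gamma>" "y \<in> pverts \<Gamma>" using arc_verts[OF xy] by auto
    show ?thesis
    proof (cases "d = 1")
      case True
      then show ?thesis using fw[OF V(1) dc(2)] dc(3) by simp
    next
      case False
      then have "x = stp 1 c y" using stp_inv[OF V(1) dc(1), of c] dc by auto
      then show ?thesis using fw[OF V(2) dc(2)] by simp
    qed
  qed
  have M_const: "M v \<longleftrightarrow> M (pt 0 0)" if "v \<in> pverts \<Gamma>" for v
    by (rule connected_induct[of "pt 0 0" "\<lambda>v. M v \<longleftrightarrow> M (pt 0 0)" v]) (use M_arc pt_V that in auto)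
  have e_arc: "\<epsilon> y 1 = \<epsilon> x 1" if xy: "(x, y) \<in> parcs \<Gamma>" for x y
  proof -
    obtain d c where dc: "d \<in> sgns" "c \<in> sgns" "y = stp d c x" using step_exists[OF xy] by blast
    have V: "x \<in> pverts \<Gamma>" "y \<in> pverts \<Gamma>" using arc_verts[OF xy] by auto
    have "\<epsilon> y c = \<epsilon> x c" unfolding dc(3) by (rule E[OF V(1) dc(1,2)])
    then show ?thesis using eps_cases[OF V(1) dc(2)] eps_cases[OF V(2) dc(2)] M_arc[OF xy] dc(2) by (auto split: if_splits)
  qed
  define \<sigma> where "\<sigma> = \<epsilon> (pt 0 0) 1"
  have e1: "\<epsilon> v 1 = \<sigma>" if "v \<in> pverts \<Gamma>" for v
    using connected_induct[of "pt 0 0" "\<lambda>v. \<epsilon> v 1 = \<sigma>" v] e_arc pt_V that by (metis \<sigma>_def)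
  have s: "\<sigma> \<in> sgns" unfolding \<sigma>_def by (rule eps[OF pt_V]) simp
  have nM: "\<not> M (pt 0 0)"
  proof
    assume M: "M (pt 0 0)"
    have e: "\<epsilon> v 1 = \<sigma>" "\<epsilon> v (-1) = - \<sigma>" if "v \<in> pverts \<Gamma>" for v
      using e1[OF that] eps_cases[OF that, of 1] M_const[OF that] M by auto
    obtain v2 v3 v4 where V: "v2 \<in> pverts \<Gamma>" "v3 \<in> pverts \<Gamma>" "v4 \<in> pverts \<Gamma>" and
      cl: "closed_word 5 r q [(\<epsilon> (pt 0 0) (-1), - (\<kappa> * 1)), (\<epsilon> (pt 0 0) (-1), - (\<kappa> * 1)), (- \<epsilon> v2 1, \<kappa> * 1), (- \<epsilon> v3 (-1), - (\<kappa> * 1)),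
       (\<epsilon> v4 1, \<kappa> * 1), (\<epsilon> v4 1, \<kappa> * 1), (- \<epsilon> (stp 1 1 (pt 0 0)) (-1), - (\<kappa> * 1)), (- \<epsilon> (pt 0 0) 1, \<kappa> * 1)]"
      by (rule octagon[OF pt_V _ f sd, of 1 0 0]) simp
    have "{\<sigma>, \<kappa>} \<subseteq> sgns" using s k by simp
    from octagon_alternating[OF this] cl show False
      unfolding e(1)[OF V(1)] e(2)[OF V(2)] e(1)[OF V(3)] e[OF pt_V] e(2)[OF stp_V[OF pt_V]] by simp
  qed
  have e: "\<epsilon> v c = \<sigma>" if "v \<in> pverts \<Gamma>" "c \<in> sgns" for v c
    using e1[OF that(1)] eps_cases[OF that(1), of 1] M_const[OF that(1)] nM that(2) by auto
  have "\<sigma> \<noteq> -1"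
  proof
    assume "\<sigma> = -1"
    then have "f (stp d c v) = stp (- d) (\<kappa> * c) (f v)" if "v \<in> pverts \<Gamma>" "d \<in> sgns" "c \<in> sgns" for v d c
      using F[OF that] e[OF that(1,3)] by simp
    from no_reversing_auto[OF f k this] show False .
  qed
  then have s1: "\<sigma> = 1" using s by simp
  obtain c where c: "u \<in> pverts \<Gamma>" "c \<in> sgns" "v = stp 1 c u" using uv unfolding forward_def by blast
  have "f v = stp 1 (\<kappa> * c) (f u)" using F[OF c(1) _ c(2), of 1] e[OF c(1,2)] s1 c(3) by simp
  then show ?thesis using auto_mem[OF f c(1)] sgns_mult[OF k c(2)] unfolding forward_def by blast
qed

end

section \<open>Automorphisms of labelled graphs\<close>

context labelled_graph
begin

text \<open>For \<open>q = e\<close> the words \<open>(1, 1) (1, -e)\<close> and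
  \<open>(1, -1) (1, e)\<close> have displacements \<open>1 - e * q\<close> and
  \<open>- 1 + e * q\<close>, both 0 modulo \<open>r\<close>, and so form a 4-cycle.\<close>

lemma no_quadrangle_imp:
  assumes "\<And>p. graph_cycle \<Gamma> p \<Longrightarrow> length p \<noteq> 4" and e: "e \<in> sgns"
  shows "\<not> int r dvd q - e"
proof
  assume d: "int r dvd q - e"
  have p01: "p 0 = 1" "p 1 = q" using m_ge_3 by (simp_all add: pw_def)
  define v0 v1 v3 v2 where "v0 = pt 0 0" and "v1 = stp 1 1 v0" and "v3 = stp 1 (-1) v0" and "v2 = stp 1 (-e) v1"
  have V: "v0 \<in> pverts \<Gamma>" "v1 \<in> pverts \<Gamma>" "v3 \<in> pverts \<Gamma>" using pt_V stp_V by (simp_all add: v0_def v1_def v3_def)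
  have "v2 = stp 1 e v3"
  proof -
    have "int r dvd 2 * e * (q - e)" using d by simp
    moreover have "2 * e * (q - e) = - ((1 - e * q) - (- 1 + e * q))" using e by auto
    ultimately have "int r dvd (1 - e * q) - (- 1 + e * q)" by (metis dvd_minus_iff)
    then show ?thesis by (simp add: v0_def v1_def v2_def v3_def stp_pt pt_eq p01)
  qed
  moreover have "v0 \<noteq> v2" "v1 \<noteq> v3"
  proof -
    have "\<not> int m dvd -2" using m_ge_3 by (auto dest: zdvd_imp_le)
    then show "v0 \<noteq> v2" by (simp add: v0_def v1_def v2_def stp_pt pt_eq)
    show "v1 \<noteq> v3" using not_dvd_2 by (simp add: v0_def v1_def v3_def stp_pt pt_eq p01)
  qed
  moreover have "(v0, v1) \<in> parcs \<Gamma>" "(v0, v3) \<in> parcs \<Gamma>" "(v1, v2) \<in> parcs \<Gamma>"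
    unfolding v1_def v3_def v2_def using V stp_arc e sgns_neg[OF e] by (simp_all add: v1_def)
  moreover have "(v3, stp 1 e v3) \<in> parcs \<Gamma>" by (rule stp_arc[OF V(3) _ e]) simp
  ultimately have "graph_cycle \<Gamma> [(v0, v1), (v1, v2), (v2, v3), (v3, v0)]" using quadrangle_cycle arc_sym by metis
  then show False using assms(1) by fastforce
qed

section \<open>Valency, orientation and affine automorphisms of labelled graphs\<close>

lemma tetravalent_labelled: "tetravalent \<Gamma>"
  unfolding tetravalent_def
proof
  fix v assume v: "v \<in> pverts \<Gamma>"
  let ?N = "{stp 1 1 v, stp 1 (-1) v, stp (-1) 1 v, stp (-1) (-1) v}"
  have N: "(v, w) \<in> parcs \<Gamma> \<longleftrightarrow> w \<in> ?N" for w unfolding arc_iff_stp[OF v] by simp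
  have "out_arcs (with_proj \<Gamma>) v = Pair v ` {w. (v, w) \<in> parcs \<Gamma>}" by (auto simp: out_arcs_def)
  then have "out_arcs (with_proj \<Gamma>) v = Pair v ` ?N" by (simp only: N Collect_mem_eq)
  moreover have "stp 1 1 v \<noteq> stp 1 (-1) v" "stp 1 1 v \<noteq> stp (-1) 1 v" "stp 1 1 v \<noteq> stp (-1) (-1) v"
    "stp 1 (-1) v \<noteq> stp (-1) 1 v" "stp 1 (-1) v \<noteq> stp (-1) (-1) v" "stp (-1) 1 v \<noteq> stp (-1) (-1) v"
    by (simp_all add: stp_inj[OF v])
  then have "card ?N = 4" by simp
  moreover have "inj_on (Pair v) ?N" by (simp add: inj_on_def)
  ultimately show "out_degree (with_proj \<Gamma>) v = 4" unfolding out_degree_def by (simp only: card_image)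
qed

lemma forward_asym: "(u, v) \<in> forward \<Longrightarrow> (v, u) \<notin> forward"
proof
  assume uv: "(u, v) \<in> forward" "(v, u) \<in> forward"
  obtain c where c: "u \<in> pverts \<Gamma>" "v = stp 1 c u" using uv(1) unfolding forward_def by blast
  obtain c' where c': "u = stp 1 c' v" using uv(2) unfolding forward_def by blast
  obtain i j where u: "u = pt i j" using pt_surj c(1) by blast
  have "stp 1 c' (stp 1 c u) = u" using c' c(2) by simp
  then have "int m dvd 2" unfolding u by (simp add: stp_pt pt_eq)
  then show False using m_ge_3 by (auto dest: zdvd_imp_le)
qed

lemma parcs_forward: "parcs \<Gamma> = forward \<union> forward\<inverse>"
proof -
  have "(u, v) \<in> forward \<or> (v, u) \<in> forward" if uv: "(u, v) \<in> parcs \<Gamma>" for u v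
  proof -
    have V: "u \<in> pverts \<Gamma>" "v \<in> pverts \<Gamma>" using arc_verts[OF uv] by auto
    obtain d c where dc: "d \<in> sgns" "c \<in> sgns" "v = stp d c u" using step_exists[OF uv] by blast
    show ?thesis
    proof (cases "d = 1")
      case True
      then show ?thesis using V dc unfolding forward_def by blast
    next
      case False
      then have "u = stp 1 c v" using stp_inv[OF V(1) dc(1), of c] dc by auto
      then show ?thesis using V dc(2) unfolding forward_def by blast
    qed
  qed
  moreover have "forward \<subseteq> parcs \<Gamma>"
  proof
    fix x assume "x \<in> forward"
    then obtain u c where "x = (u, stp 1 c u)" "u \<in> pverts \<Gamma>" "c \<in> sgns" unfolding forward_def by blast
    then show "x \<in> parcs \<Gamma>" using stp_arc[of u 1 c] by simp
  qed
  ultimately show ?thesis using arc_sym by auto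
qed

text \<open>A shift by \<open>s\<close> layers multiplies the edge labels by \<open>q ^ s\<close>,
  so the second coordinate is scaled by the same factor. The factor \<open>e\<close> multiplies all
  signs and leaves all directions alone.\<close>

lemma auto_exists:
  assumes e: "e \<in> sgns"
  shows "\<exists>g\<in>graph_auto \<Gamma>. \<forall>i j. g (pt i j) = pt (i + s) (e * p s * j + b)"
proof -
  let ?V = "pverts \<Gamma>"
  define F where "F v = (let (i, j) = (SOME (i, j). v = pt i j) in pt (i + s) (e * p s * j + b))" for v
  have cancel: "int r dvd e * p s * x \<longleftrightarrow> int r dvd x" for x
    using dvd_sgns_mult[OF e] p_dvd_cancel by (simp add: mult.assoc)
  have F: "F (pt i j) = pt (i + s) (e * p s * j + b)" for i j
  proof -
    define x where "x = (SOME (i', j'). pt i j = pt i' j')"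
    have "case x of (i', j') \<Rightarrow> pt i j = pt i' j'" unfolding x_def by (rule someI[of _ "(i, j)"]) simp
    then have "int m dvd fst x - i" "int r dvd snd x - j" using pt_eq by (auto simp: case_prod_beta dvd_diff_commute)
    then have "pt (fst x + s) (e * p s * snd x + b) = pt (i + s) (e * p s * j + b)"
      using cancel[of "snd x - j"] by (simp add: pt_eq right_diff_distrib)
    then show ?thesis unfolding F_def x_def[symmetric] by (simp add: case_prod_beta)
  qed
  have FV: "F v \<in> ?V" if "v \<in> ?V" for v using pt_surj[OF that] F pt_V by metis
  have inj: "inj_on F ?V"
  proof (rule inj_onI)
    fix u v assume "u \<in> ?V" "v \<in> ?V" and eq: "F u = F v"
    then obtain i j i' j' where uv: "u = pt i j" "v = pt i' j'" using pt_surj by metis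
    have "int m dvd i - i'" "int r dvd e * p s * (j - j')" using eq by (simp_all add: uv F pt_eq right_diff_distrib)
    then show "u = v" using cancel by (simp add: uv pt_eq)
  qed
  then have bij: "bij_betw F ?V ?V"
    using FV finite_verts by (simp add: bij_betw_def endo_inj_surj image_subsetI)
  have F_stp: "F (stp d c v) = stp d (e * c) (F v)" if v: "v \<in> ?V" for d c v
  proof -
    obtain i j where ij: "v = pt i j" using pt_surj[OF v] by blast
    define k where "k = (if d = 1 then i else i - 1)"
    have k: "(if d = 1 then i + s else i + s - 1) = s + k" by (simp add: k_def)
    have "int r dvd (- (d * e * c)) * (p (s + k) - p s * p k)" using p_add[of s k] by (rule dvd_mult)
    then have "int r dvd e * p s * (j + d * c * p k) + b - (e * p s * j + b + d * (e * c) * p (s + k))"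
      by (simp add: algebra_simps)
    then show ?thesis unfolding ij F stp_pt k k_def[symmetric] pt_eq by simp
  qed
  have "(F u, F v) \<in> parcs \<Gamma> \<longleftrightarrow> (u, v) \<in> parcs \<Gamma>" if uv: "u \<in> ?V" "v \<in> ?V" for u v
  proof
    assume "(u, v) \<in> parcs \<Gamma>"
    then obtain d c where dc: "d \<in> sgns" "c \<in> sgns" "v = stp d c u" using step_exists by blast
    show "(F u, F v) \<in> parcs \<Gamma>" unfolding dc(3) F_stp[OF uv(1)] by (rule stp_arc[OF FV[OF uv(1)] dc(1) sgns_mult[OF e dc(2)]])
  next
    assume "(F u, F v) \<in> parcs \<Gamma>"
    then obtain d c where dc: "d \<in> sgns" "c \<in> sgns" "F v = stp d c (F u)" using step_exists by blast
    have ee: "e * (e * c) = c" using e by auto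
    have "F v = F (stp d (e * c) u)" using F_stp[OF uv(1), of d "e * c"] dc(3) by (simp only: ee)
    then have "v = stp d (e * c) u" using inj uv stp_V[OF uv(1)] by (simp add: inj_on_def)
    then show "(u, v) \<in> parcs \<Gamma>" using stp_arc[OF uv(1) dc(1) sgns_mult[OF e dc(2)]] by simp
  qed
  then have "restrict F ?V \<in> graph_auto \<Gamma>" by (rule restrict_auto[OF bij])
  moreover have "restrict F ?V (pt i j) = pt (i + s) (e * p s * j + b)" for i j using pt_V F by simp
  ultimately show ?thesis by blast
qed

lemma forward_orbit:
  assumes "(u, v) \<in> forward"
  shows "\<exists>g\<in>graph_auto \<Gamma>. g (pt 0 0) = u \<and> g (stp 1 1 (pt 0 0)) = v"
proof -
  obtain c where c: "u \<in> pverts \<Gamma>" "c \<in> sgns" "v = stp 1 c u" using assms unfolding forward_def by blast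
  obtain i j where u: "u = pt i j" using pt_surj[OF c(1)] by blast
  obtain g where g: "g \<in> graph_auto \<Gamma>" "\<forall>i' j'. g (pt i' j') = pt (i' + i) (c * p i * j' + j)"
    using auto_exists[OF c(2)] by blast
  have "g (pt 0 0) = u" using g(2) u by simp
  moreover have "p 0 = 1" by (simp add: pw_def)
  then have "g (stp 1 1 (pt 0 0)) = v" using g(2) u c(3) by (simp add: stp_pt add.commute)
  ultimately show ?thesis using g(1) by blast
qed

end

text \<open>The affine maps of \<open>auto_exists\<close> are already transitive on
  \<open>forward\<close>. What the assumption adds is that no automorphism reverses an arc.\<close>

locale labelled_rigid = labelled_graph +
  assumes forward_invariant: "f \<in> graph_auto \<Gamma> \<Longrightarrow> (u, v) \<in> forward \<Longrightarrow> (f u, f v) \<in> forward"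
begin

abbreviation base_arc :: "'a \<times> 'a" where "base_arc \<equiv> (pt 0 0, stp 1 1 (pt 0 0))"

lemma base_arc_forward: "base_arc \<in> forward"
  unfolding forward_def using pt_V by blast

lemma half_arc_transitive_Aut: "half_arc_transitive \<Gamma> (carrier (Aut \<Gamma>))"
  unfolding half_arc_transitive_def transitive_on_def
proof (intro conjI ballI)
  interpret Aut: group "Aut \<Gamma>" by (rule group_Aut)
  show sub: "subgroup (carrier (Aut \<Gamma>)) (Aut \<Gamma>)" by (rule Aut.subgroup_self)
  have arc_trans: "\<exists>g\<in>graph_auto \<Gamma>. g u = u' \<and> g v = v'" if uv: "(u, v) \<in> forward" and uv': "(u', v') \<in> forward" for u v u' v'
  proof -
    obtain g where g: "g \<in> graph_auto \<Gamma>" "g (pt 0 0) = u" "g (stp 1 1 (pt 0 0)) = v" using forward_orbit[OF uv] by blast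
    obtain g' where g': "g' \<in> graph_auto \<Gamma>" "g' (pt 0 0) = u'" "g' (stp 1 1 (pt 0 0)) = v'" using forward_orbit[OF uv'] by blast
    obtain k where k: "k \<in> graph_auto \<Gamma>" "\<forall>v\<in>pverts \<Gamma>. k (g v) = v \<and> g (k v) = v"
      using subgroup_inv[OF sub] g(1) unfolding carrier_Aut by blast
    obtain l where l: "l \<in> graph_auto \<Gamma>" "\<forall>v\<in>pverts \<Gamma>. l v = g' (k v)"
      using subgroup_comp[OF sub] g'(1) k(1) unfolding carrier_Aut by blast
    have V: "u \<in> pverts \<Gamma>" "v \<in> pverts \<Gamma>" using auto_mem[OF g(1)] pt_V stp_V g by metis+
    have "k u = pt 0 0" "k v = stp 1 1 (pt 0 0)" using k(2) pt_V stp_V g by metis+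
    then have "l u = u' \<and> l v = v'" using l(2) V g' by simp
    then show ?thesis using l(1) by blast
  qed
  show "\<exists>g\<in>carrier (Aut \<Gamma>). g u = v" if "u \<in> pverts \<Gamma>" "v \<in> pverts \<Gamma>" for u v
  proof -
    have "(w, stp 1 1 w) \<in> forward" if "w \<in> pverts \<Gamma>" for w unfolding forward_def using that by blast
    then have "(u, stp 1 1 u) \<in> forward" "(v, stp 1 1 v) \<in> forward" using that by blast+
    then show ?thesis using arc_trans unfolding carrier_Aut by blast
  qed
  show "\<exists>g\<in>carrier (Aut \<Gamma>). g ` e = e'" if e: "e \<in> edges \<Gamma>" and e': "e' \<in> edges \<Gamma>" for e e'
  proof -
    have ex: "\<exists>u v. e = {u, v} \<and> (u, v) \<in> forward" if "e \<in> edges \<Gamma>" for e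
      using that parcs_forward by (auto simp: edges_def)
    obtain u v u' v' where "e = {u, v}" "(u, v) \<in> forward" "e' = {u', v'}" "(u', v') \<in> forward"
      using ex[OF e] ex[OF e'] by blast
    then show ?thesis using arc_trans[of u v u' v'] unfolding carrier_Aut by auto
  qed
  show "\<not> (\<forall>x\<in>parcs \<Gamma>. \<forall>y\<in>parcs \<Gamma>. \<exists>g\<in>carrier (Aut \<Gamma>). map_prod g g x = y)"
  proof
    assume A: "\<forall>x\<in>parcs \<Gamma>. \<forall>y\<in>parcs \<Gamma>. \<exists>g\<in>carrier (Aut \<Gamma>). map_prod g g x = y"
    have b: "base_arc \<in> parcs \<Gamma>" "prod.swap base_arc \<in> parcs \<Gamma>" using base_arc_forward parcs_forward by auto
    then obtain g where g: "g \<in> carrier (Aut \<Gamma>)" "map_prod g g base_arc = prod.swap base_arc" using A by blast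
    then have "prod.swap base_arc \<in> forward" using forward_invariant[of g] base_arc_forward carrier_Aut by (metis map_prod_simp)
    then show False using forward_asym[OF base_arc_forward] by simp
  qed
qed

lemma forward_orientation: "forward \<in> induced_orientations \<Gamma> (carrier (Aut \<Gamma>))"
proof -
  have "forward = {map_prod g g base_arc | g. g \<in> carrier (Aut \<Gamma>)}"
  proof (intro equalityI subsetI)
    fix x assume "x \<in> forward"
    then show "x \<in> {map_prod g g base_arc | g. g \<in> carrier (Aut \<Gamma>)}"
    proof (cases x)
      case (Pair u v)
      then obtain g where "g \<in> graph_auto \<Gamma>" "g (pt 0 0) = u" "g (stp 1 1 (pt 0 0)) = v"
        using forward_orbit[of u v] \<open>x \<in> forward\<close> by blast
      then have "g \<in> carrier (Aut \<Gamma>)" "x = map_prod g g base_arc" using Pair carrier_Aut by simp_all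
      then show ?thesis by blast
    qed
  next
    fix x assume "x \<in> {map_prod g g base_arc | g. g \<in> carrier (Aut \<Gamma>)}"
    then show "x \<in> forward" using forward_invariant base_arc_forward carrier_Aut by auto
  qed
  then show ?thesis using base_arc_forward parcs_forward unfolding induced_orientations_def by blast
qed

text \<open>Since \<open>2 * p i\<close> is a unit modulo \<open>r\<close>, the alternating cycle
  between two consecutive layers exhausts both. Two consecutive cycles therefore share exactly one
  full layer, as layers 0 and 2 are different.\<close>

lemma tightly_attached_Aut: "tightly_attached \<Gamma> (carrier (Aut \<Gamma>))"
proof -
  interpret H: half_arc_graph \<Gamma> "carrier (Aut \<Gamma>)" forward
    by unfold_locales (rule tetravalent_labelled half_arc_transitive_Aut forward_orientation)+
  have fw: "(pt i j, pt (i + 1) (j + c * p i)) \<in> forward" if "c \<in> sgns" for i j c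
  proof -
    have "(pt i j, stp 1 c (pt i j)) \<in> forward" unfolding forward_def using that pt_V by blast
    then show ?thesis by (simp add: stp_pt)
  qed
  have two: "\<not> int r dvd 2 * p i" "\<not> int r dvd - 2 * p i" for i
    using p_dvd_cancel[of i 2] not_dvd_2 by (simp_all add: mult.commute)
  have tr: "H.trail (\<lambda>n. pt i (x + 2 * n * p i)) (\<lambda>n. pt (i + 1) (x + (2 * n + 1) * p i))" for i x
    unfolding H.trail_def
  proof (intro allI conjI)
    fix n
    show "(pt i (x + 2 * n * p i), pt (i + 1) (x + (2 * n + 1) * p i)) \<in> forward"
      using fw[of 1 i "x + 2 * n * p i"] by (simp add: algebra_simps)
    show "(pt i (x + 2 * (n + 1) * p i), pt (i + 1) (x + (2 * n + 1) * p i)) \<in> forward"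
      using fw[of "-1" i "x + 2 * (n + 1) * p i"] by (simp add: algebra_simps)
    show "pt i (x + 2 * (n + 1) * p i) \<noteq> pt i (x + 2 * n * p i)" using two by (simp add: pt_eq algebra_simps)
    show "pt (i + 1) (x + (2 * (n + 1) + 1) * p i) \<noteq> pt (i + 1) (x + (2 * n + 1) * p i)"
      using two by (simp add: pt_eq algebra_simps)
  qed
  have layer_t: "range (\<lambda>n. pt i (x + 2 * n * p i)) = range (pt i)"
    and layer_h: "range (\<lambda>n. pt (i + 1) (x + (2 * n + 1) * p i)) = range (pt (i + 1))" for i x
  proof -
    have "coprime (2 * p i) (int r)" using p_coprime[of i] r_odd by simp
    then obtain k where "[2 * p i * k = 1] (mod int r)" using cong_solve_coprime_int by blast
    then have k: "int r dvd 2 * p i * k - 1" by (simp add: cong_iff_dvd_diff)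
    have sol: "int r dvd y + 2 * (k * (z - y)) * p i - z" for y z
    proof -
      have "y + 2 * (k * (z - y)) * p i - z = (2 * p i * k - 1) * (z - y)" by (simp add: algebra_simps)
      then show ?thesis using k by simp
    qed
    have "pt i z \<in> range (\<lambda>n. pt i (x + 2 * n * p i))" for z
      using sol[of x z] by (auto simp: pt_eq dvd_diff_commute intro!: image_eqI[of _ _ "k * (z - x)"])
    then show "range (\<lambda>n. pt i (x + 2 * n * p i)) = range (pt i)" by auto
    have "pt (i + 1) z \<in> range (\<lambda>n. pt (i + 1) (x + (2 * n + 1) * p i))" for z
      using sol[of "x + p i" z]
      by (auto simp: pt_eq dvd_diff_commute algebra_simps intro!: image_eqI[of _ _ "k * (z - (x + p i))"])
    then show "range (\<lambda>n. pt (i + 1) (x + (2 * n + 1) * p i)) = range (pt (i + 1))" by auto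
  qed
  note t0 = tr[of 0 0] and t1 = tr[of 1 "p 0"]
  have "tightly_attached \<Gamma> (carrier (Aut \<Gamma>)) \<longleftrightarrow>
      card ((range (pt 0) \<union> range (pt 1)) \<inter> (range (pt 1) \<union> range (pt 2))) = H.radius"
    using H.tightly_attached_iff[OF t0 t1] layer_t[of 0 0] layer_h[of 0 0] layer_t[of 1 "p 0"] layer_h[of 1 "p 0"] by simp
  moreover have "(range (pt 0) \<union> range (pt 1)) \<inter> (range (pt 1) \<union> range (pt 2)) = range (pt 1)"
  proof -
    have "\<not> int m dvd -1" "\<not> int m dvd -2" "\<not> int m dvd 1" "\<not> int m dvd 2" using m_ge_3 by (auto dest: zdvd_imp_le)
    then have "pt 0 j \<noteq> pt 2 j'" for j j' by (simp add: pt_eq)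
    then show ?thesis by auto
  qed
  moreover have "card (range (pt 1)) = H.radius"
    using H.card_ranges(1)[OF t1] layer_t[of 1 "p 0"] by simp
  ultimately show ?thesis by simp
qed

end

section \<open>The Doyle-Holt graph\<close>

definition unit_steps :: "(int \<times> int) list" where
  "unit_steps = [(1, 1), (1, -1), (-1, 1), (-1, -1)]"

lemma set_unit_steps: "set unit_steps = sgns \<times> sgns"
  by (auto simp: unit_steps_def)

definition no_return :: "int \<times> int \<Rightarrow> int \<times> int \<Rightarrow> bool" where
  "no_return s t \<longleftrightarrow> t \<noteq> (- fst s, snd s)"

text \<open>The letters \<open>s\<close> and \<open>t\<close> form a 2-path and the triple is a
  completion to a 5-cycle; the completions are grouped so that they can be enumerated for a fixed
  2-path.\<close>

definition pentagon_word_9 :: "int \<times> int \<Rightarrow> int \<times> int \<Rightarrow> (int \<times> int) \<times> (int \<times> int) \<times> (int \<times> int) \<Rightarrow> bool" where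
  "pentagon_word_9 s t = (\<lambda>(x, y, z). no_return s t \<and> no_return t x \<and> no_return x y \<and> no_return y z \<and> no_return z s \<and>
     closed_word 3 9 4 [s, t, x, y, z])"

definition unit_triples :: "((int \<times> int) \<times> (int \<times> int) \<times> (int \<times> int)) list" where
  "unit_triples = List.product unit_steps (List.product unit_steps unit_steps)"

lemma mem_unit_steps: "(d, c) \<in> set unit_steps \<longleftrightarrow> d \<in> sgns \<and> c \<in> sgns"
  unfolding set_unit_steps by (simp only: mem_Times_iff fst_conv snd_conv)

lemma mem_unit_triples:
  "((x1, x2), (y1, y2), (z1, z2)) \<in> set unit_triples \<longleftrightarrow> {x1, x2, y1, y2, z1, z2} \<subseteq> sgns"
  unfolding unit_triples_def set_product set_unit_steps
  by (simp only: mem_Times_iff fst_conv snd_conv insert_subset empty_subsetI simp_thms conj_assoc)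

text \<open>
  A 2-path with two equal letters lies on one 5-cycle only, any other 2-path on two. This is why
  automorphisms respect the lines of constant sign.
\<close>

lemma straight_words_9:
  "list_all (\<lambda>s. list_all (\<lambda>u. pentagon_word_9 s s u \<longrightarrow> u = ((1, - snd s), s, (-1, - snd s))) unit_triples) unit_steps"
  by code_simp

lemma bent_words_9:
  "list_all (\<lambda>s. list_all (\<lambda>t. t = s \<or> t = (- fst s, snd s) \<or>
     length (filter (pentagon_word_9 s t) unit_triples) = 2) unit_steps) unit_steps"
  by code_simp

lemma distinct_unit_triples: "distinct unit_triples"
  by code_simp

text \<open>The word is the image of the one in \<open>relator_closed\<close> under an automorphism
  with \<open>sign_data\<close>: the first two letters share a line, the directions of the others
  are free. Closing up forces the third line to keep its direction.\<close>

lemma image_words_9: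
  "list_all (\<lambda>(x, c). list_all (\<lambda>(d, y). list_all (\<lambda>d'.
     closed_word 3 9 4 [(x, c), (x, c), (d, -c), (y, c), (-d', -c)] \<longrightarrow> d = 1) [1, -1]) unit_steps) unit_steps"
  by code_simp

lemma no_closed_words_9:
  "list_all (\<lambda>s. list_all (\<lambda>t. list_all (\<lambda>x. \<not> closed_word 3 9 4 [s, t, x]) unit_steps) unit_steps) unit_steps"
  "list_all (\<lambda>s. list_all (\<lambda>(t, x, y). no_return s t \<longrightarrow> no_return t x \<longrightarrow> no_return x y \<longrightarrow> no_return y s \<longrightarrow>
     \<not> closed_word 3 9 4 [s, t, x, y]) unit_triples) unit_steps"
  by code_simp+

locale labelled_Doyle_Holt = labelled_graph \<Gamma> 3 9 4 pt for \<Gamma> :: "'a pair_pre_digraph" and pt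
begin

lemma p_values: "pw 3 4 0 = 1" "pw 3 4 1 = 4" "pw 3 4 2 = 16" "pw 3 4 (-1) = 16" "pw 3 4 3 = 1"
  by (simp_all add: pw_def)

lemma pentagon_of_word:
  assumes v: "v \<in> pverts \<Gamma>" and S: "(d, c) \<in> sgns \<times> sgns" "(d', c') \<in> sgns \<times> sgns" "u \<in> set unit_triples"
    and w: "pentagon_word_9 (d, c) (d', c') u"
  obtains x1 x2 y1 y2 z1 z2 where "u = ((x1, x2), (y1, y2), (z1, z2))" "{x1, x2, y1, y2, z1, z2} \<subseteq> sgns"
    "pentagon v (stp d c v) (stp d' c' (stp d c v)) (stp x1 x2 (stp d' c' (stp d c v)))
      (stp y1 y2 (stp x1 x2 (stp d' c' (stp d c v))))"
    "stp z1 z2 (stp y1 y2 (stp x1 x2 (stp d' c' (stp d c v)))) = v"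
proof -
  obtain x1 x2 y1 y2 z1 z2 where u: "u = ((x1, x2), (y1, y2), (z1, z2))" by (metis prod.exhaust)
  have s: "{x1, x2, y1, y2, z1, z2} \<subseteq> sgns"
    using S(3) unfolding u mem_unit_triples .
  have cl: "closed_word 3 9 4 [(d, c), (d', c'), (x1, x2), (y1, y2), (z1, z2)]"
    and n: "(d', c') \<noteq> (- d, c)" "(x1, x2) \<noteq> (- d', c')" "(y1, y2) \<noteq> (- x1, x2)" "(z1, z2) \<noteq> (- y1, y2)" "(d, c) \<noteq> (- z1, z2)"
    using w unfolding u pentagon_word_9_def no_return_def by simp_all
  have "{d, c, d', c', x1, x2, y1, y2, z1, z2} \<subseteq> sgns" using s S(1,2) by auto
  note P = word_pentagon[OF v this cl n]
  have "stp z1 z2 (stp y1 y2 (stp x1 x2 (stp d' c' (stp d c v)))) = v"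
    using iffD2[OF run_closed_iff[OF v] cl] by simp
  then show ?thesis using that[OF u s P] by blast
qed

lemma straight_pentagon_unique:
  assumes v: "v \<in> pverts \<Gamma>" and s: "d \<in> sgns" "c \<in> sgns"
    and P: "pentagon v (stp d c v) (stp d c (stp d c v)) x y"
  shows "x = stp 1 (- c) (stp d c (stp d c v)) \<and> y = stp d c x"
proof -
  have V1: "stp d c v \<in> pverts \<Gamma>" by (rule stp_V[OF v])
  from pentagon_word[OF P] obtain d0 c0 d1 c1 d2 c2 d3 c3 d4 c4 where
    sg: "{d0, c0, d1, c1, d2, c2, d3, c3, d4, c4} \<subseteq> sgns"
    and e: "stp d c v = stp d0 c0 v" "stp d c (stp d c v) = stp d1 c1 (stp d c v)" "x = stp d2 c2 (stp d c (stp d c v))" "y = stp d3 c3 x"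
    and cl: "closed_word 3 9 4 [(d0, c0), (d1, c1), (d2, c2), (d3, c3), (d4, c4)]"
    and n: "(d1, c1) \<noteq> (- d0, c0)" "(d2, c2) \<noteq> (- d1, c1)" "(d3, c3) \<noteq> (- d2, c2)" "(d4, c4) \<noteq> (- d3, c3)" "(d0, c0) \<noteq> (- d4, c4)"
    by metis
  have 0: "d0 = d" "c0 = c" using stp_inj[OF v s, of d0 c0] e(1) sg by simp_all
  have 1: "d1 = d" "c1 = c" using stp_inj[OF V1 s, of d1 c1] e(2) sg by simp_all
  have "((d2, c2), (d3, c3), (d4, c4)) \<in> set unit_triples"
    using sg unfolding mem_unit_triples by simp
  moreover have "(d, c) \<in> set unit_steps" using s unfolding mem_unit_steps by simp
  moreover have "pentagon_word_9 (d, c) (d, c) ((d2, c2), (d3, c3), (d4, c4))"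
    using cl n unfolding 0 1 pentagon_word_9_def no_return_def by simp
  ultimately have "((d2, c2), (d3, c3), (d4, c4)) = ((1, - c), (d, c), (-1, - c))"
    using straight_words_9 unfolding list_all_iff by (metis snd_conv)
  then show ?thesis using e by simp
qed

lemma straight_auto:
  assumes f: "f \<in> graph_auto \<Gamma>" shows "straight f"
  unfolding straight_def
proof (intro ballI)
  fix v d c assume v: "v \<in> pverts \<Gamma>" and s: "d \<in> sgns" "c \<in> sgns"
  define v1 v2 where "v1 = stp d c v" and "v2 = stp d c v1"
  have V: "v1 \<in> pverts \<Gamma>" "v2 \<in> pverts \<Gamma>" using stp_V v by (simp_all add: v1_def v2_def)
  have fV: "f v \<in> pverts \<Gamma>" "f v1 \<in> pverts \<Gamma>" "f v2 \<in> pverts \<Gamma>" using auto_mem[OF f] v V by auto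
  have "(v, v1) \<in> parcs \<Gamma>" "(v1, v2) \<in> parcs \<Gamma>" unfolding v1_def v2_def using stp_arc[OF _ s] v V(1)[unfolded v1_def] by blast+
  then have "(f v, f v1) \<in> parcs \<Gamma>" "(f v1, f v2) \<in> parcs \<Gamma>" using auto_arc_iff[OF f] v V by auto
  then obtain d' c' d'' c'' where s': "d' \<in> sgns" "c' \<in> sgns" "f v1 = stp d' c' (f v)"
    and s'': "d'' \<in> sgns" "c'' \<in> sgns" "f v2 = stp d'' c'' (f v1)"
    using step_exists by meson
  have "(d'', c'') = (d', c')"
  proof (rule ccontr)
    assume ne: "(d'', c'') \<noteq> (d', c')"
    have "v2 \<noteq> v"
    proof
      assume "v2 = v"
      then have "stp d c v1 = stp (- d) c v1" using stp_inv[OF v s(1), of c] by (simp add: v1_def v2_def)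
      then show False using stp_inj[OF V(1) s sgns_neg[OF s(1)] s(2)] s(1) by auto
    qed
    then have "f v2 \<noteq> f v" using auto_inj[OF f V(2) v] by simp
    then have nr: "(d'', c'') \<noteq> (- d', c')" using s'' s' stp_inv[OF fV(1) s'(1), of c'] by auto
    have mem: "(d', c') \<in> set unit_steps" "(d'', c'') \<in> set unit_steps" using s' s'' unfolding mem_unit_steps by blast+
    have "length (filter (pentagon_word_9 (d', c') (d'', c'')) unit_triples) = 2"
      using bent_words_9 mem ne nr unfolding list_all_iff by (metis fst_conv snd_conv)
    then obtain u u' where fl: "filter (pentagon_word_9 (d', c') (d'', c'')) unit_triples = [u, u']"
      by (auto simp: numeral_2_eq_2 length_Suc_conv)
    have "distinct [u, u']" unfolding fl[symmetric] by (rule distinct_filter[OF distinct_unit_triples])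
    then have uu: "u \<noteq> u'" by simp
    from fl have "{u, u'} \<subseteq> set (filter (pentagon_word_9 (d', c') (d'', c'')) unit_triples)" by simp
    then have u: "u \<in> set unit_triples" "pentagon_word_9 (d', c') (d'', c'') u"
      "u' \<in> set unit_triples" "pentagon_word_9 (d', c') (d'', c'') u'" by auto
    \<comment> \<open>Pulled back by \<open>f\<close>, each 5-cycle through the bent image becomes
      the only 5-cycle through the straight 2-path; yet \<open>u\<close> and \<open>u'\<close> give
      two.\<close>
    have unique: "a = f (stp 1 (- c) v2) \<and> b = f (stp d c (stp 1 (- c) v2))"
      if P: "pentagon (f v) (f v1) (f v2) a b" for a b
    proof -
      obtain \<alpha> where a: "\<alpha> \<in> pverts \<Gamma>" "f \<alpha> = a" using auto_surj[OF f] pentagon_verts[OF P] by auto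
      obtain \<beta> where b: "\<beta> \<in> pverts \<Gamma>" "f \<beta> = b" using auto_surj[OF f] pentagon_verts[OF P] by auto
      have "pentagon v v1 v2 \<alpha> \<beta>" using auto_pentagon[OF f, of v v1 v2 \<alpha> \<beta>] P a b v V by simp
      from straight_pentagon_unique[OF v s this[unfolded v2_def v1_def]]
      show ?thesis using a b by (simp add: v1_def v2_def)
    qed
    have S: "(d', c') \<in> sgns \<times> sgns" "(d'', c'') \<in> sgns \<times> sgns" using s'(1,2) s''(1,2) by blast+
    note ff = s'(3)[symmetric] s''(3)[symmetric]
    obtain x1 x2 y1 y2 z1 z2 where 1: "u = ((x1, x2), (y1, y2), (z1, z2))" "{x1, x2, y1, y2, z1, z2} \<subseteq> sgns"
      "pentagon (f v) (f v1) (f v2) (stp x1 x2 (f v2)) (stp y1 y2 (stp x1 x2 (f v2)))"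
      "stp z1 z2 (stp y1 y2 (stp x1 x2 (f v2))) = f v"
      using pentagon_of_word[OF fV(1) S u(1,2)] unfolding ff by metis
    obtain x1' x2' y1' y2' z1' z2' where 2: "u' = ((x1', x2'), (y1', y2'), (z1', z2'))" "{x1', x2', y1', y2', z1', z2'} \<subseteq> sgns"
      "pentagon (f v) (f v1) (f v2) (stp x1' x2' (f v2)) (stp y1' y2' (stp x1' x2' (f v2)))"
      "stp z1' z2' (stp y1' y2' (stp x1' x2' (f v2))) = f v"
      using pentagon_of_word[OF fV(1) S u(3,4)] unfolding ff by metis
    have eq: "stp x1 x2 (f v2) = stp x1' x2' (f v2)"
      "stp y1 y2 (stp x1 x2 (f v2)) = stp y1' y2' (stp x1' x2' (f v2))"
      using unique[OF 1(3)] unique[OF 2(3)] by metis+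
    have Vx: "stp x1 x2 (f v2) \<in> pverts \<Gamma>" "stp y1 y2 (stp x1 x2 (f v2)) \<in> pverts \<Gamma>" using fV stp_V by simp_all
    have x: "x1 = x1'" "x2 = x2'" using stp_inj[OF fV(3), of x1 x2 x1' x2'] eq(1) 1(2) 2(2) by simp_all
    have y: "y1 = y1'" "y2 = y2'" using stp_inj[OF Vx(1), of y1 y2 y1' y2'] eq x 1(2) 2(2) by simp_all
    have z: "z1 = z1'" "z2 = z2'" using stp_inj[OF Vx(2), of z1 z2 z1' z2'] 1(4) 2(4) x y 1(2) 2(2) by simp_all
    show False using uu 1(1) 2(1) x y z by simp
  qed
  then show "\<exists>d'\<in>sgns. \<exists>c'\<in>sgns. f (stp d c v) = stp d' c' (f v) \<and> f (stp d c (stp d c v)) = stp d' c' (stp d' c' (f v))"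
    using s' s'' by (metis v1_def v2_def prod.inject)
qed

text \<open>The displacement is \<open>c * (1 + 4 - 16 + 1 + 1) = - 9 * c\<close>.\<close>

lemma relator_closed: "c \<in> sgns \<Longrightarrow> closed_word 3 9 4 [(1, c), (1, c), (1, -c), (1, c), (-1, -c)]"
  by (elim insertE emptyE) (simp_all add: closed_word_def p_values)

text \<open>By \<open>image_words_9\<close> the line of the third letter of the relator keeps its
  direction. The starting vertex and the sign are arbitrary, so every line occurs in that
  position.\<close>

lemma forward_preserved:
  assumes f: "f \<in> graph_auto \<Gamma>" and uv: "(u, v) \<in> forward"
  shows "(f u, f v) \<in> forward"
proof -
  obtain \<kappa> \<epsilon> where sd: "sign_data f \<kappa> \<epsilon>" using straight_signs[OF f straight_auto[OF f]] by blast
  note k = sign_dataD(1)[OF sd] and eps = sign_dataD(2)[OF sd] and F = sign_dataD(3)[OF sd] and E = sign_dataD(4)[OF sd]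
  have d: "1 \<in> sgns" "-1 \<in> sgns" by simp_all
  have eps1: "\<epsilon> (stp 1 c (stp 1 c v)) (- c) = 1" if v: "v \<in> pverts \<Gamma>" and c: "c \<in> sgns" for v c
  proof -
    have c': "- c \<in> sgns" using c by (rule sgns_neg)
    define v1 v2 v3 v4 where defs: "v1 = stp 1 c v" "v2 = stp 1 c v1" "v3 = stp 1 (-c) v2" "v4 = stp 1 c v3"
    have V1: "v1 \<in> pverts \<Gamma>" unfolding defs by (rule stp_V[OF v])
    have V2: "v2 \<in> pverts \<Gamma>" unfolding defs(2) by (rule stp_V[OF V1])
    have V3: "v3 \<in> pverts \<Gamma>" unfolding defs(3) by (rule stp_V[OF V2])
    have V4: "v4 \<in> pverts \<Gamma>" unfolding defs(4) by (rule stp_V[OF V3])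
    have v5: "stp (-1) (-c) v4 = v"
      using iffD2[OF run_closed_iff[OF v] relator_closed[OF c]] by (simp only: run_simps defs)
    have e1: "\<epsilon> v1 c = \<epsilon> v c" unfolding defs(1) by (rule E[OF v d(1) c])
    have F': "f v1 = stp (\<epsilon> v c) (\<kappa> * c) (f v)" "f v2 = stp (\<epsilon> v c) (\<kappa> * c) (f v1)"
      "f v3 = stp (\<epsilon> v2 (-c)) (- (\<kappa> * c)) (f v2)" "f v4 = stp (\<epsilon> v3 c) (\<kappa> * c) (f v3)"
      "f v = stp (- \<epsilon> v4 (-c)) (- (\<kappa> * c)) (f v4)"
      using F[OF v d(1) c] F[OF V1 d(1) c] F[OF V2 d(1) c'] F[OF V3 d(1) c] F[OF V4 d(2) c']
      unfolding defs[symmetric] v5 e1 by simp_all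
    have "run [(\<epsilon> v c, \<kappa> * c), (\<epsilon> v c, \<kappa> * c), (\<epsilon> v2 (-c), - (\<kappa> * c)), (\<epsilon> v3 c, \<kappa> * c), (- \<epsilon> v4 (-c), - (\<kappa> * c))] (f v) = f v"
      by (simp only: run_simps F'[symmetric])
    then have cl: "closed_word 3 9 4 [(\<epsilon> v c, \<kappa> * c), (\<epsilon> v c, \<kappa> * c), (\<epsilon> v2 (-c), - (\<kappa> * c)), (\<epsilon> v3 c, \<kappa> * c), (- \<epsilon> v4 (-c), - (\<kappa> * c))]"
      using run_closed_iff[OF auto_mem[OF f v]] by blast
    have "(\<epsilon> v c, \<kappa> * c) \<in> set unit_steps" "(\<epsilon> v2 (-c), \<epsilon> v3 c) \<in> set unit_steps" "\<epsilon> v4 (-c) \<in> set [1, -1]"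
      using eps[OF v c] eps[OF V2 c'] eps[OF V3 c] eps[OF V4 c'] sgns_mult[OF k c] unfolding mem_unit_steps by simp_all
    then have "\<epsilon> v2 (-c) = 1" using image_words_9 cl unfolding list_all_iff by fastforce
    then show ?thesis by (simp only: defs)
  qed
  have eps_1: "\<epsilon> w c = 1" if w: "w \<in> pverts \<Gamma>" and c: "c \<in> sgns" for w c
  proof -
    \<comment> \<open>Two steps back along the line of sign \<open>- c\<close> give a relator whose
      third letter leaves \<open>w\<close> with sign \<open>c\<close>.\<close>
    define w1 w2 where "w1 = stp (-1) (- c) w" and "w2 = stp (-1) (- c) w1"
    have V: "w1 \<in> pverts \<Gamma>" "w2 \<in> pverts \<Gamma>" using stp_V w by (simp_all add: w1_def w2_def)
    have "stp 1 (- c) w2 = w1" "stp 1 (- c) w1 = w" using stp_inv[OF V(1) d(2), of "- c"] stp_inv[OF w d(2), of "- c"] by (simp_all add: w1_def w2_def)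
    then show ?thesis using eps1[OF V(2) sgns_neg[OF c]] by simp
  qed
  obtain c where c: "u \<in> pverts \<Gamma>" "c \<in> sgns" "v = stp 1 c u" using uv unfolding forward_def by blast
  have "f v = stp 1 (\<kappa> * c) (f u)" using F[OF c(1) d(1) c(2)] eps_1[OF c(1,2)] c(3) by simp
  then show ?thesis using auto_mem[OF f c(1)] sgns_mult[OF k c(2)] unfolding forward_def by blast
qed

section \<open>Girth of the Doyle-Holt graph\<close>

lemma relator_pentagon:
  assumes "v \<in> pverts \<Gamma>"
  shows "pentagon v (stp 1 1 v) (stp 1 1 (stp 1 1 v)) (stp 1 (-1) (stp 1 1 (stp 1 1 v)))
    (stp 1 1 (stp 1 (-1) (stp 1 1 (stp 1 1 v))))"
  by (rule word_pentagon[OF assms _ relator_closed[of 1]]) simp_all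

lemma girth_5: "girth \<Gamma> = 5"
  unfolding girth_eq_5_iff
proof (intro conjI allI impI)
  show "\<exists>p. graph_cycle \<Gamma> p \<and> length p = 5"
    by (rule exI, rule conjI, rule pentagon_cycle[OF relator_pentagon[OF pt_V[of 0 0]]]) simp
  fix p assume p: "graph_cycle \<Gamma> p"
  define w where "w k = fst (p ! (k mod length p))" for k
  note W = graph_cycle_fun[OF p, folded w_def]
  have V: "w k \<in> pverts \<Gamma>" for k using arc_verts[OF W(3)] by blast
  have "\<forall>k. \<exists>d c. d \<in> sgns \<and> c \<in> sgns \<and> w (Suc k) = stp d c (w k)" using step_exists[OF W(3)] by blast
  then obtain d c where dc: "\<And>k. d k \<in> sgns" "\<And>k. c k \<in> sgns" "\<And>k. w (Suc k) = stp (d k) (c k) (w k)" by metis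
  have mem: "(d k, c k) \<in> set unit_steps" for k using dc(1,2) unfolding mem_unit_steps by blast
  have nr: "no_return (d k, c k) (d (Suc k), c (Suc k))" for k
  proof -
    have "w (Suc (Suc k)) \<noteq> w k"
    proof
      assume "w (Suc (Suc k)) = w k"
      then have "(k + 2) mod length p = k mod length p" using W(4) by simp
      then have "length p dvd 2" by (metis add_diff_cancel_left' mod_eq_dvd_iff_nat le_add1)
      then show False using W(1) by (auto dest: dvd_imp_le)
    qed
    then show ?thesis using dc(3)[of "Suc k"] dc(3)[of k] stp_inv[OF V dc(1), of k "c k"] by (auto simp: no_return_def)
  qed
  show "5 \<le> length p"
  proof (rule ccontr)
    assume "\<not> 5 \<le> length p"
    then consider "length p = 3" | "length p = 4" using W(1) by linarith
    then show False
    proof cases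
      case 1
      have w3: "w 3 = w 0" using W(4)[of 3 0] 1 by simp
      have S: "Suc 0 = 1" "Suc 1 = 2" "Suc 2 = 3" by simp_all
      have *: "w 1 = stp (d 0) (c 0) (w 0)" "w 2 = stp (d 1) (c 1) (w 1)" "w 0 = stp (d 2) (c 2) (w 2)"
        using dc(3)[of 0] dc(3)[of 1] dc(3)[of 2] unfolding S w3 by blast+
      have "run [(d 0, c 0), (d 1, c 1), (d 2, c 2)] (w 0) = w 0" by (simp only: run_simps *[symmetric])
      then have "closed_word 3 9 4 [(d 0, c 0), (d 1, c 1), (d 2, c 2)]" using run_closed_iff[OF V] by blast
      then show False using no_closed_words_9(1) mem unfolding list_all_iff by blast
    next
      case 2
      have w4: "w 4 = w 0" using W(4)[of 4 0] 2 by simp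
      have S: "Suc 0 = 1" "Suc 1 = 2" "Suc 2 = 3" "Suc 3 = 4" by simp_all
      have *: "w 1 = stp (d 0) (c 0) (w 0)" "w 2 = stp (d 1) (c 1) (w 1)" "w 3 = stp (d 2) (c 2) (w 2)" "w 0 = stp (d 3) (c 3) (w 3)"
        using dc(3)[of 0] dc(3)[of 1] dc(3)[of 2] dc(3)[of 3] unfolding S w4 by blast+
      have "run [(d 0, c 0), (d 1, c 1), (d 2, c 2), (d 3, c 3)] (w 0) = w 0" by (simp only: run_simps *[symmetric])
      then have cl: "closed_word 3 9 4 [(d 0, c 0), (d 1, c 1), (d 2, c 2), (d 3, c 3)]" using run_closed_iff[OF V] by blast
      have nr3: "no_return (d 3, c 3) (d 0, c 0)"
      proof -
        have "w 1 \<noteq> w 3" using W(4)[of 1 3] 2 by simp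
        moreover have "stp (- d 3) (c 3) (w 0) = w 3" unfolding *(4) by (rule stp_inv[OF V dc(1)])
        ultimately show ?thesis using *(1) by (auto simp: no_return_def)
      qed
      have "((d 1, c 1), (d 2, c 2), (d 3, c 3)) \<in> set unit_triples" using dc by (simp add: mem_unit_triples)
      moreover have "no_return (d 0, c 0) (d 1, c 1)" "no_return (d 1, c 1) (d 2, c 2)" "no_return (d 2, c 2) (d 3, c 3)"
        using nr[of 0] nr[of 1] nr[of 2] unfolding S by blast+
      ultimately show False using no_closed_words_9(2) mem[of 0] cl nr3 unfolding list_all_iff by fastforce
    qed
  qed
qed

end

sublocale labelled_Doyle_Holt \<subseteq> labelled_rigid \<Gamma> 3 9 4 pt
  by unfold_locales (rule forward_preserved)

sublocale labelled_5_cyclic \<subseteq> labelled_rigid \<Gamma> 5 r q pt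
  by unfold_locales (rule forward_preserved)

section \<open>Isomorphism with the standard graphs\<close>

text \<open>Only the arcs that leave a vertex in \<open>D\<close> have to be described. The arcs
  that enter it follow by solving for the label of the tail.\<close>

lemma labelled_graphI:
  assumes G: "connected_graph \<Gamma>" and m: "m \<ge> 3" and r: "r \<ge> 3" "odd r" and q: "int r dvd q ^ m - 1"
    and eq: "\<And>i j i' j'. pt i j = pt i' j' \<longleftrightarrow> int m dvd i - i' \<and> int r dvd j - j'"
    and V: "\<And>i j. pt i j \<in> pverts \<Gamma>" and surj: "\<And>v. v \<in> pverts \<Gamma> \<Longrightarrow> \<exists>i j. v = pt i j"
    and D_V: "\<And>u v. (u, v) \<in> D \<Longrightarrow> u \<in> pverts \<Gamma>" and D_total: "parcs \<Gamma> = D \<union> D\<inverse>"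
    and D: "\<And>i j w. (pt i j, w) \<in> D \<longleftrightarrow> (\<exists>c\<in>sgns. w = pt (i + 1) (j + c * pw m q i))"
  shows "labelled_graph \<Gamma> m r q pt"
proof -
  have back_iff: "(v, pt i j) \<in> D \<longleftrightarrow> (\<exists>c\<in>sgns. v = pt (i - 1) (j - c * pw m q (i - 1)))" for v i j
  proof
    assume vD: "(v, pt i j) \<in> D"
    then obtain a b where v: "v = pt a b" using surj D_V by blast
    then obtain c where c: "c \<in> sgns" "pt i j = pt (a + 1) (b + c * pw m q a)" using vD D by blast
    have i: "int m dvd i - (a + 1)" and j: "int r dvd j - (b + c * pw m q a)" using iffD1[OF eq c(2)] by auto
    have "(i - 1) mod int m = a mod int m" using i unfolding mod_eq_dvd_iff by (simp add: algebra_simps)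
    then have p: "pw m q (i - 1) = pw m q a" by (simp add: pw_def)
    have "int m dvd a - (i - 1)" using i by (metis add.commute diff_diff_eq dvd_diff_commute diff_diff_add)
    moreover have "int r dvd b - (j - c * pw m q a)" using j by (metis diff_diff_eq2 dvd_diff_commute)
    ultimately have "v = pt (i - 1) (j - c * pw m q (i - 1))" unfolding v p by (rule iffD2[OF eq, OF conjI])
    then show "\<exists>c\<in>sgns. v = pt (i - 1) (j - c * pw m q (i - 1))" using c(1) by blast
  next
    assume "\<exists>c\<in>sgns. v = pt (i - 1) (j - c * pw m q (i - 1))"
    then obtain c where c: "c \<in> sgns" "v = pt (i - 1) (j - c * pw m q (i - 1))" by blast
    have "pt i j = pt (i - 1 + 1) (j - c * pw m q (i - 1) + c * pw m q (i - 1))" by simp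
    then show "(v, pt i j) \<in> D" unfolding c(2) D using c(1) by blast
  qed
  show ?thesis
  proof (intro labelled_graph.intro labelled_graph_axioms.intro)
    show "(pt i j, v) \<in> parcs \<Gamma> \<longleftrightarrow>
      (\<exists>c\<in>sgns. v = pt (i + 1) (j + c * pw m q i) \<or> v = pt (i - 1) (j - c * pw m q (i - 1)))" for i j v
      using D[of i j v] back_iff[of v i j] unfolding D_total by blast
  qed (use assms in auto)
qed

text \<open>On both sides tail and head are the projections of pairs, and this forces the arc map of
  an isomorphism to be induced by its vertex map.\<close>

lemma graph_iso_iff:
  assumes "pair_wf_digraph \<Gamma>"
  shows "graph_iso \<Gamma> \<Delta> \<longleftrightarrow> (\<exists>\<phi>. inj_on \<phi> (pverts \<Gamma>) \<and> pverts \<Delta> = \<phi> ` pverts \<Gamma> \<and> parcs \<Delta> = map_prod \<phi> \<phi> ` parcs \<Gamma>)"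
proof
  assume "graph_iso \<Gamma> \<Delta>"
  then obtain f where f: "pre_digraph.digraph_isomorphism (with_proj \<Gamma>) f" "with_proj \<Delta> = app_iso f (with_proj \<Gamma>)"
    by (auto simp: digraph_iso_def)
  have ts: "iso_tail f = fst" "iso_head f = snd" using f(2) by (simp_all add: with_proj_def app_iso_def)
  have "iso_arcs f a = map_prod (iso_verts f) (iso_verts f) a" if "a \<in> parcs \<Gamma>" for a
    using f(1) that ts by (auto simp: pre_digraph.digraph_isomorphism_def prod_eq_iff)
  then have "iso_arcs f ` parcs \<Gamma> = map_prod (iso_verts f) (iso_verts f) ` parcs \<Gamma>" by (rule image_cong[OF refl])
  moreover have "pverts \<Delta> = iso_verts f ` pverts \<Gamma>" "parcs \<Delta> = iso_arcs f ` parcs \<Gamma>"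
    using f(2) by (simp_all add: with_proj_def app_iso_def)
  moreover have "inj_on (iso_verts f) (pverts \<Gamma>)" using f(1) by (simp add: pre_digraph.digraph_isomorphism_def)
  ultimately show "\<exists>\<phi>. inj_on \<phi> (pverts \<Gamma>) \<and> pverts \<Delta> = \<phi> ` pverts \<Gamma> \<and> parcs \<Delta> = map_prod \<phi> \<phi> ` parcs \<Gamma>" by metis
next
  assume "\<exists>\<phi>. inj_on \<phi> (pverts \<Gamma>) \<and> pverts \<Delta> = \<phi> ` pverts \<Gamma> \<and> parcs \<Delta> = map_prod \<phi> \<phi> ` parcs \<Gamma>"
  then obtain \<phi> where phi: "inj_on \<phi> (pverts \<Gamma>)" "pverts \<Delta> = \<phi> ` pverts \<Gamma>" "parcs \<Delta> = map_prod \<phi> \<phi> ` parcs \<Gamma>" by blast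
  define f where "f = \<lparr>iso_verts = \<phi>, iso_arcs = map_prod \<phi> \<phi>, iso_head = snd, iso_tail = fst\<rparr>"
  have "inj_on (map_prod \<phi> \<phi>) (parcs \<Gamma>)"
  proof (rule inj_onI)
    fix x y assume xy: "x \<in> parcs \<Gamma>" "y \<in> parcs \<Gamma>" "map_prod \<phi> \<phi> x = map_prod \<phi> \<phi> y"
    then have "fst x \<in> pverts \<Gamma>" "snd x \<in> pverts \<Gamma>" "fst y \<in> pverts \<Gamma>" "snd y \<in> pverts \<Gamma>"
      using assms pair_wf_digraph.arc_fst_in_verts pair_wf_digraph.arc_snd_in_verts by blast+
    then show "x = y" using xy(3) phi(1) by (auto simp: prod_eq_iff inj_on_def)
  qed
  then have "pre_digraph.digraph_isomorphism (with_proj \<Gamma>) f"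
    using assms phi(1) by (simp add: pre_digraph.digraph_isomorphism_def f_def wf_digraph_wp_iff)
  moreover have "with_proj \<Delta> = app_iso f (with_proj \<Gamma>)" using phi by (simp add: app_iso_def with_proj_def f_def)
  ultimately show "graph_iso \<Gamma> \<Delta>" unfolding digraph_iso_def by blast
qed

section \<open>Labels of the standard graphs\<close>

definition Xo_vertex :: "nat \<Rightarrow> nat \<Rightarrow> int \<Rightarrow> int \<Rightarrow> nat \<times> int" where
  "Xo_vertex m r i j = (nat (i mod int m), j mod int r)"

lemma Xo_vertex_eq_iff:
  assumes "m > 0"
  shows "Xo_vertex m r i j = Xo_vertex m r i' j' \<longleftrightarrow> int m dvd i - i' \<and> int r dvd j - j'"
  using assms by (simp add: Xo_vertex_def eq_nat_nat_iff mod_eq_dvd_iff)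

lemma pverts_Xo:
  assumes "m > 0" "r > 0"
  shows "Xo_vertex m r i j \<in> pverts (Xo m r q)" "x \<in> pverts (Xo m r q) \<Longrightarrow> \<exists>i j. x = Xo_vertex m r i j"
proof -
  show "Xo_vertex m r i j \<in> pverts (Xo m r q)" using assms by (auto simp: Xo_vertex_def Xo_def Let_def nat_less_iff)
  assume "x \<in> pverts (Xo m r q)"
  then have "x = Xo_vertex m r (int (fst x)) (snd x)" by (auto simp: Xo_def Let_def Xo_vertex_def)
  then show "\<exists>i j. x = Xo_vertex m r i j" by blast
qed

lemma Xo_step_iff:
  assumes "m > 0"
  shows "Xo_step m r q (Xo_vertex m r i j) (Xo_vertex m r a b) \<longleftrightarrow>
    (\<exists>c\<in>sgns. Xo_vertex m r a b = Xo_vertex m r (i + 1) (j + c * pw m q i))"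
proof -
  have "nat (a mod int m) = Suc (nat (i mod int m)) mod m \<longleftrightarrow> a mod int m = (i + 1) mod int m"
  proof -
    have "int (Suc (nat (i mod int m)) mod m) = (i + 1) mod int m"
      using assms by (simp add: zmod_int mod_add_right_eq add.commute)
    moreover have "int (nat (a mod int m)) = a mod int m" using assms by simp
    ultimately show ?thesis by (metis of_nat_eq_iff)
  qed
  then have "nat (a mod int m) = Suc (nat (i mod int m)) mod m \<longleftrightarrow> int m dvd a - (i + 1)" by (simp only: mod_eq_dvd_iff)
  moreover have "[b mod int r = j mod int r + x] (mod int r) \<longleftrightarrow> int r dvd b - (j + x)" for x
    by (simp add: cong_def mod_add_left_eq flip: mod_eq_dvd_iff)
  moreover have "[b mod int r = j mod int r - x] (mod int r) \<longleftrightarrow> int r dvd b - (j - x)" for x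
    by (simp add: cong_def mod_diff_left_eq flip: mod_eq_dvd_iff)
  ultimately show ?thesis
    unfolding Xo_vertex_eq_iff[OF assms] by (auto simp: Xo_step_def Xo_vertex_def pw_def)
qed

lemma graph_iso_imp_labelled:
  assumes G: "connected_graph \<Gamma>" and m: "m \<ge> 3" and r: "r \<ge> 3" "odd r" and q: "int r dvd q ^ m - 1"
    and iso: "graph_iso \<Gamma> (Xo m r q)"
  obtains pt where "labelled_graph \<Gamma> m r q pt"
proof -
  interpret connected_graph \<Gamma> by (rule G)
  obtain \<phi> where phi: "inj_on \<phi> (pverts \<Gamma>)" "pverts (Xo m r q) = \<phi> ` pverts \<Gamma>"
    "parcs (Xo m r q) = map_prod \<phi> \<phi> ` parcs \<Gamma>" using iso unfolding graph_iso_iff[OF wf] by blast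
  have pos: "m > 0" "r > 0" using m r by auto
  define pt where "pt i j = inv_into (pverts \<Gamma>) \<phi> (Xo_vertex m r i j)" for i j
  have X_mem: "Xo_vertex m r i j \<in> \<phi> ` pverts \<Gamma>" for i j using pverts_Xo(1)[OF pos] phi(2) by blast
  have pt: "pt i j \<in> pverts \<Gamma>" "\<phi> (pt i j) = Xo_vertex m r i j" for i j
    using inv_into_into[OF X_mem] f_inv_into_f[OF X_mem] by (simp_all add: pt_def)
  have inj: "u = v \<longleftrightarrow> \<phi> u = \<phi> v" if "u \<in> pverts \<Gamma>" "v \<in> pverts \<Gamma>" for u v
    using phi(1) that by (auto simp: inj_on_def)
  define D where "D = {(u, v). u \<in> pverts \<Gamma> \<and> v \<in> pverts \<Gamma> \<and> Xo_step m r q (\<phi> u) (\<phi> v)}"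
  have arc_iff: "(u, v) \<in> parcs \<Gamma> \<longleftrightarrow> (\<phi> u, \<phi> v) \<in> parcs (Xo m r q)" if "u \<in> pverts \<Gamma>" "v \<in> pverts \<Gamma>" for u v
  proof
    assume "(\<phi> u, \<phi> v) \<in> parcs (Xo m r q)"
    then obtain a b where ab: "(a, b) \<in> parcs \<Gamma>" "\<phi> u = \<phi> a" "\<phi> v = \<phi> b" unfolding phi(3) by auto
    then show "(u, v) \<in> parcs \<Gamma>" using inj that arc_verts[OF ab(1)] by blast
  qed (auto simp: phi(3))
  have surj: "\<exists>i j. v = pt i j" if v: "v \<in> pverts \<Gamma>" for v
  proof -
    obtain i j where "\<phi> v = Xo_vertex m r i j" using pverts_Xo(2)[OF pos, of "\<phi> v" q] phi(2) v by blast
    then have "v = pt i j" using inj[OF v pt(1)] pt(2) by simp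
    then show ?thesis by blast
  qed
  have "labelled_graph \<Gamma> m r q pt"
  proof (rule labelled_graphI[OF G m r q, where D = D])
    show "pt i j = pt i' j' \<longleftrightarrow> int m dvd i - i' \<and> int r dvd j - j'" for i j i' j'
      using inj[OF pt(1) pt(1)] unfolding pt(2) Xo_vertex_eq_iff[OF pos(1)] by blast
    show "pt i j \<in> pverts \<Gamma>" for i j by (rule pt(1))
    show "\<exists>i j. v = pt i j" if "v \<in> pverts \<Gamma>" for v by (rule surj[OF that])
    show "u \<in> pverts \<Gamma>" if "(u, v) \<in> D" for u v using that by (simp add: D_def)
    have "(u, v) \<in> parcs \<Gamma> \<longleftrightarrow> (u, v) \<in> D \<or> (v, u) \<in> D" for u v
    proof (cases "u \<in> pverts \<Gamma> \<and> v \<in> pverts \<Gamma>")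
      case True
      then have "\<phi> u \<in> pverts (Xo m r q)" "\<phi> v \<in> pverts (Xo m r q)" using phi(2) by auto
      then show ?thesis using True arc_iff[of u v] by (auto simp: D_def Xo_def Let_def)
    qed (use arc_verts in \<open>auto simp: D_def\<close>)
    then show "parcs \<Gamma> = D \<union> D\<inverse>" by auto
    show "(pt i j, w) \<in> D \<longleftrightarrow> (\<exists>c\<in>sgns. w = pt (i + 1) (j + c * pw m q i))" for i j w
    proof (cases "w \<in> pverts \<Gamma>")
      case True
      then obtain a b where w: "w = pt a b" using surj by blast
      have "(pt i j, w) \<in> D \<longleftrightarrow> Xo_step m r q (Xo_vertex m r i j) (Xo_vertex m r a b)"
        unfolding w by (simp add: D_def pt)
      also have "\<dots> \<longleftrightarrow> (\<exists>c\<in>sgns. w = pt (i + 1) (j + c * pw m q i))"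
        unfolding Xo_step_iff[OF pos(1)] w inj[OF pt(1) pt(1)] pt(2) by blast
      finally show ?thesis .
    next
      case False
      then show ?thesis using pt(1) by (auto simp: D_def)
    qed
  qed
  then show ?thesis by (rule that)
qed

lemma (in labelled_graph) graph_iso_Xo: "graph_iso \<Gamma> (Xo m r q)"
proof -
  have pos: "m > 0" "r > 0" using m_ge_3 r_ge_3 by auto
  define \<phi> where "\<phi> v = (let (i, j) = (SOME (i, j). v = pt i j) in Xo_vertex m r i j)" for v
  have phi: "\<phi> (pt i j) = Xo_vertex m r i j" for i j
  proof -
    define x where "x = (SOME (i', j'). pt i j = pt i' j')"
    have "case x of (i', j') \<Rightarrow> pt i j = pt i' j'" unfolding x_def by (rule someI[of _ "(i, j)"]) simp
    then have "Xo_vertex m r i j = Xo_vertex m r (fst x) (snd x)"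
      using pt_eq Xo_vertex_eq_iff[OF pos(1)] by (simp add: case_prod_beta)
    then show ?thesis unfolding \<phi>_def x_def[symmetric] by (simp add: case_prod_beta)
  qed
  have inj: "inj_on \<phi> (pverts \<Gamma>)"
  proof (rule inj_onI)
    fix u v assume "u \<in> pverts \<Gamma>" "v \<in> pverts \<Gamma>" and eq: "\<phi> u = \<phi> v"
    then obtain i j i' j' where "u = pt i j" "v = pt i' j'" using pt_surj by metis
    then show "u = v" using eq phi pt_eq Xo_vertex_eq_iff[OF pos(1)] by simp
  qed
  have verts: "pverts (Xo m r q) = \<phi> ` pverts \<Gamma>"
  proof (intro equalityI subsetI)
    fix x assume "x \<in> pverts (Xo m r q)"
    then obtain i j where "x = \<phi> (pt i j)" using pverts_Xo(2)[OF pos] phi by metis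
    then show "x \<in> \<phi> ` pverts \<Gamma>" using pt_V by blast
  next
    fix x assume "x \<in> \<phi> ` pverts \<Gamma>"
    then obtain i j where "x = \<phi> (pt i j)" using pt_surj by blast
    then show "x \<in> pverts (Xo m r q)" using pverts_Xo(1)[OF pos] phi by simp
  qed
  have step: "Xo_step m r q (\<phi> u) (\<phi> v) \<longleftrightarrow> (u, v) \<in> forward" if V: "u \<in> pverts \<Gamma>" "v \<in> pverts \<Gamma>" for u v
  proof -
    obtain i j a b where uv: "u = pt i j" "v = pt a b" using pt_surj V by metis
    have "Xo_step m r q (\<phi> u) (\<phi> v) \<longleftrightarrow> (\<exists>c\<in>sgns. v = stp 1 c u)"
      unfolding uv phi Xo_step_iff[OF pos(1)] Xo_vertex_eq_iff[OF pos(1)] by (simp add: stp_pt pt_eq)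
    then show ?thesis using V unfolding forward_def by blast
  qed
  have "(x, y) \<in> parcs (Xo m r q) \<longleftrightarrow> (x, y) \<in> map_prod \<phi> \<phi> ` parcs \<Gamma>" for x y
  proof
    assume xy: "(x, y) \<in> parcs (Xo m r q)"
    then have "x \<in> pverts (Xo m r q)" "y \<in> pverts (Xo m r q)" by (auto simp: Xo_def Let_def)
    then obtain u v where uv: "u \<in> pverts \<Gamma>" "v \<in> pverts \<Gamma>" "x = \<phi> u" "y = \<phi> v" using verts by auto
    then have "(u, v) \<in> parcs \<Gamma>" using xy step[of u v] step[of v u] parcs_forward by (auto simp: Xo_def Let_def)
    then show "(x, y) \<in> map_prod \<phi> \<phi> ` parcs \<Gamma>" using uv by (auto intro: image_eqI[of _ _ "(u, v)"])
  next
    assume "(x, y) \<in> map_prod \<phi> \<phi> ` parcs \<Gamma>"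
    then obtain u v where uv: "(u, v) \<in> parcs \<Gamma>" "x = \<phi> u" "y = \<phi> v" by auto
    then have "u \<in> pverts \<Gamma>" "v \<in> pverts \<Gamma>" using arc_verts by auto
    moreover from this have "x \<in> pverts (Xo m r q)" "y \<in> pverts (Xo m r q)" using verts uv by auto
    ultimately show "(x, y) \<in> parcs (Xo m r q)"
      using step[of u v] step[of v u] uv parcs_forward by (auto simp: Xo_def Let_def)
  qed
  then have "parcs (Xo m r q) = map_prod \<phi> \<phi> ` parcs \<Gamma>" by (intro equalityI subrelI) blast+
  then show ?thesis unfolding graph_iso_iff[OF wf] using inj verts by blast
qed

lemma (in labelled_graph) forward_pt:
  "(pt i j, w) \<in> forward \<longleftrightarrow> (\<exists>c\<in>sgns. w = pt (i + 1) (j + c * p i))"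
proof -
  have "stp 1 c (pt i j) = pt (i + 1) (j + c * p i)" for c by (simp add: stp_pt)
  moreover have "(pt i j, w) \<in> forward \<longleftrightarrow> (\<exists>c\<in>sgns. w = stp 1 c (pt i j))"
    unfolding forward_def using pt_V by blast
  ultimately show ?thesis by simp
qed

section \<open>Change of the parameter \<open>q\<close>\<close>

lemma labelled_graph_cong:
  assumes L: "labelled_graph \<Gamma> m r q pt" and q: "int r dvd q - q'"
  shows "labelled_graph \<Gamma> m r q' pt"
proof -
  interpret labelled_graph \<Gamma> m r q pt by (rule L)
  have pow: "int r dvd q ^ k - q' ^ k" for k
    using cong_pow[of q q' "int r" k] q by (simp add: cong_iff_dvd_diff)
  have pw: "int r dvd pw m q i - pw m q' i" for i by (simp add: pw_def pow)
  have eq: "pt (i + 1) (j + c * pw m q i) = pt (i + 1) (j + c * pw m q' i)" for i j c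
  proof -
    have "int r dvd c * (pw m q i - pw m q' i)" using pw by simp
    then show ?thesis by (simp add: pt_eq algebra_simps)
  qed
  show ?thesis
  proof (rule labelled_graphI[OF connected_graph_axioms m_ge_3 r_ge_3 r_odd _ pt_eq pt_V pt_surj, where D = forward])
    have "int r dvd (q ^ m - 1) - (q ^ m - q' ^ m)" using q_m pow by (rule dvd_diff)
    then show "int r dvd q' ^ m - 1" by simp
    show "u \<in> pverts \<Gamma>" if "(u, v) \<in> forward" for u v using that parcs_forward arc_verts by blast
    show "parcs \<Gamma> = forward \<union> forward\<inverse>" by (rule parcs_forward)
    show "(pt i j, w) \<in> forward \<longleftrightarrow> (\<exists>c\<in>sgns. w = pt (i + 1) (j + c * pw m q' i))" for i j w
      unfolding eq[symmetric] by (rule forward_pt)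
  qed
qed

text \<open>
  Modulo 9, 7 is the inverse of 4: reversing the order of the layers exchanges the two parameters.
\<close>

lemma Xo_3_9_7_relabel:
  assumes L: "labelled_graph \<Gamma> 3 9 7 pt"
  shows "labelled_graph \<Gamma> 3 9 4 (\<lambda>i j. pt (- i) (4 * j))"
proof -
  interpret labelled_graph \<Gamma> 3 9 7 pt by (rule L)
  \<comment> \<open>Modulo 9, \<open>7 ^ (- i - 1)\<close> is \<open>4 * 4 ^ i\<close>; the surplus
    factor 4 is absorbed by the label \<open>4 * j\<close>.\<close>
  have pw: "9 dvd 4 * pw 3 4 i - pw 3 7 (- i - 1)" for i
  proof -
    have "i mod 3 = 0 \<or> i mod 3 = 1 \<or> i mod 3 = 2" by presburger
    moreover have "(- i - 1) mod 3 = 2 - i mod 3" by presburger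
    ultimately show ?thesis by (auto simp: pw_def)
  qed
  have eq: "pt (- i - 1) (4 * j + c * pw 3 7 (- i - 1)) = pt (- (i + 1)) (4 * (j + c * pw 3 4 i))" for i j c
  proof -
    have "9 dvd c * (4 * pw 3 4 i - pw 3 7 (- i - 1))" using pw[of i] by simp
    then show ?thesis by (simp add: pt_eq algebra_simps dvd_diff_commute)
  qed
  show ?thesis
  proof (rule labelled_graphI[OF connected_graph_axioms m_ge_3 r_ge_3 r_odd, where D = "forward\<inverse>"])
    show "pt (- i) (4 * j) = pt (- i') (4 * j') \<longleftrightarrow> int 3 dvd i - i' \<and> int 9 dvd j - j'" for i j i' j'
    proof -
      have "3 dvd - i - - i' \<longleftrightarrow> 3 dvd i - i'" "9 dvd 4 * j - 4 * j' \<longleftrightarrow> 9 dvd j - j'" by presburger+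
      then show ?thesis unfolding pt_eq by simp
    qed
    show "\<exists>i j. v = pt (- i) (4 * j)" if v: "v \<in> pverts \<Gamma>" for v
    proof -
      obtain i j where "v = pt i j" using pt_surj[OF v] by blast
      moreover have "9 dvd j - 4 * (7 * j)" by presburger
      ultimately have "v = pt (- (- i)) (4 * (7 * j))" by (simp add: pt_eq)
      then show ?thesis by blast
    qed
    show "u \<in> pverts \<Gamma>" if "(u, v) \<in> forward\<inverse>" for u v
      using that parcs_forward arc_verts by blast
    show "parcs \<Gamma> = forward\<inverse> \<union> (forward\<inverse>)\<inverse>" using parcs_forward by auto
    show "(pt (- i) (4 * j), w) \<in> forward\<inverse> \<longleftrightarrow> (\<exists>c\<in>sgns. w = pt (- (i + 1)) (4 * (j + c * pw 3 4 i)))" for i j w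
    proof -
      have "(pt (- i) (4 * j), w) \<in> forward\<inverse> \<longleftrightarrow> (\<exists>c\<in>sgns. w = stp (-1) c (pt (- i) (4 * j)))"
      proof
        assume "(pt (- i) (4 * j), w) \<in> forward\<inverse>"
        then obtain c where c: "w \<in> pverts \<Gamma>" "c \<in> sgns" "pt (- i) (4 * j) = stp 1 c w" unfolding forward_def by blast
        then show "\<exists>c\<in>sgns. w = stp (-1) c (pt (- i) (4 * j))" using stp_inv[OF c(1), of 1 c] by auto
      next
        assume "\<exists>c\<in>sgns. w = stp (-1) c (pt (- i) (4 * j))"
        then obtain c where c: "c \<in> sgns" "w = stp (-1) c (pt (- i) (4 * j))" by blast
        then have "stp 1 c w = pt (- i) (4 * j)" using stp_inv[OF pt_V, of "-1" c] by simp
        moreover have "w \<in> pverts \<Gamma>" unfolding c(2) by (rule stp_V[OF pt_V])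
        then have "(w, stp 1 c w) \<in> forward" using c(1) unfolding forward_def by blast
        ultimately show "(pt (- i) (4 * j), w) \<in> forward\<inverse>" by simp
      qed
      also have "\<dots> \<longleftrightarrow> (\<exists>c\<in>sgns. w = pt (- i - 1) (4 * j + c * pw 3 7 (- i - 1)))"
        by (auto simp: stp_pt)
      finally show ?thesis unfolding eq .
    qed
  qed (simp_all add: pt_V)
qed

section \<open>Classification\<close>

locale labelled_3 = labelled_graph \<Gamma> 3 r q pt for \<Gamma> :: "'a pair_pre_digraph" and r q pt +
  assumes q_ne_1: "\<not> int r dvd q - 1"
begin

section \<open>Three layers: 5-cycles force the Doyle-Holt parameters\<close>

lemma p_values: "pw 3 q 0 = 1" "pw 3 q 1 = q" "pw 3 q 2 = q ^ 2" "pw 3 q 3 = 1"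
  by (simp_all add: pw_def)

text \<open>Combined with \<open>q ^ 3 = 1\<close>, equal signs give \<open>q = 1\<close>, and the
  other two choices give \<open>2 * q + 1 = 0\<close> or \<open>q + 2 = 0\<close>. Eliminating
  \<open>q\<close> leaves \<open>r\<close> as a divisor of 9; for \<open>r = 3\<close> both
  solutions would be \<open>q = 1\<close>.\<close>

lemma r_q_cases:
  assumes a: "a \<in> sgns" "b \<in> sgns" and S: "int r dvd 3 + a * q + b * q ^ 2"
  shows "r = 9 \<and> (int r dvd q - 4 \<or> int r dvd q - 7)"
proof -
  have fin: "r = 9" if "r dvd 9" "r \<noteq> 3"
  proof -
    have "r \<le> 9" using that by (auto dest: dvd_imp_le)
    then have "r = 4 \<or> r = 5 \<or> r = 6 \<or> r = 7 \<or> r = 8 \<or> r = 9" using r_ge_3 that(2) by linarith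
    then show ?thesis using that(1) by auto
  qed
  have nat9: "r dvd 9" if "int r dvd 9" using that by (metis of_nat_dvd_iff of_nat_numeral)
  consider "a = 1" "b = 1" | "a = -1" "b = -1" | "a = 1" "b = -1" | "a = -1" "b = 1" using a by auto
  then show ?thesis
  proof cases
    case 1
    have "2 * (q - 1) = (q - 1) * (3 + a * q + b * q ^ 2) - (q ^ 3 - 1)" unfolding 1 by algebra
    then have "int r dvd 2 * (q - 1)" using S q_m by (metis dvd_diff dvd_mult)
    then show ?thesis using odd_dvd_double[OF r_odd] q_ne_1 by blast
  next
    case 2
    have "2 * (2 * (q - 1)) = (q - 1) * (3 + a * q + b * q ^ 2) + (q ^ 3 - 1)" unfolding 2 by algebra
    then have "int r dvd 2 * (2 * (q - 1))" using S q_m by (metis dvd_add dvd_mult)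
    then show ?thesis using odd_dvd_double[OF r_odd] q_ne_1 by blast
  next
    case 3
    have "2 * (2 * q + 1) = (q ^ 3 - 1) + (q + 1) * (3 + a * q + b * q ^ 2)" unfolding 3 by algebra
    then have "int r dvd 2 * (2 * q + 1)" using S q_m by (metis dvd_add dvd_mult)
    then have q2: "int r dvd 2 * q + 1" using odd_dvd_double[OF r_odd] by blast
    have "9 = 4 * (3 + a * q + b * q ^ 2) + (2 * q - 3) * (2 * q + 1)" unfolding 3 by algebra
    then have "int r dvd 9" using S q2 by (metis dvd_add dvd_mult)
    moreover have "r \<noteq> 3"
    proof
      assume "r = 3"
      then have "3 dvd 2 * q + 1" "\<not> 3 dvd q - 1" using q2 q_ne_1 by simp_all
      then show False by presburger
    qed
    ultimately have r9: "r = 9" using fin nat9 by blast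
    then have "9 dvd 2 * q + 1" using q2 by simp
    then have "9 dvd q - 4" by presburger
    then show ?thesis using r9 by simp
  next
    case 4
    have "2 * (q + 2) = (q + 1) * (3 + a * q + b * q ^ 2) - (q ^ 3 - 1)" unfolding 4 by algebra
    then have "int r dvd 2 * (q + 2)" using S q_m by (metis dvd_diff dvd_mult)
    then have q2: "int r dvd q + 2" using odd_dvd_double[OF r_odd] by blast
    have "9 = (3 + a * q + b * q ^ 2) - (q - 3) * (q + 2)" unfolding 4 by algebra
    then have "int r dvd 9" using S q2 by (metis dvd_diff dvd_mult)
    moreover have "r \<noteq> 3"
    proof
      assume "r = 3"
      then have "3 dvd q + 2" "\<not> 3 dvd q - 1" using q2 q_ne_1 by simp_all
      then show False by presburger
    qed
    ultimately have r9: "r = 9" using fin nat9 by blast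
    then have "9 dvd q + 2" using q2 by simp
    then have "9 dvd q - 7" by presburger
    then show ?thesis using r9 by simp
  qed
qed

text \<open>Four steps up and one down. No backtracking around the step down forces
  \<open>c4 = - c3\<close> and \<open>c4 = - c0\<close>, so the three edges between the same two
  layers contribute \<open>3 * c0\<close>. Multiplying by \<open>c0\<close> normalises the
  congruence.\<close>

lemma pentagon_normal:
  assumes P: "pentagon v0 v1 v2 v3 v4" and c: "{c0, c1, c2, c3, c4} \<subseteq> sgns"
    and v: "v1 = stp 1 c0 v0" "v2 = stp 1 c1 v1" "v3 = stp 1 c2 v2" "v4 = stp 1 c3 v3" "v0 = stp (-1) c4 v4"
  shows "r = 9 \<and> (int r dvd q - 4 \<or> int r dvd q - 7)"
proof -
  have V: "v0 \<in> pverts \<Gamma>" "v3 \<in> pverts \<Gamma>" "v4 \<in> pverts \<Gamma>" using pentagon_verts[OF P] by auto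
  have ne: "v3 \<noteq> v0" "v4 \<noteq> v1" using P by (auto simp: pentagon_def)
  have "stp (-1) c3 v4 = v3" unfolding v(4) by (rule stp_inv[OF V(2)]) simp
  then have "c4 \<noteq> c3" using v(5) ne(1) by blast
  then have c3: "c4 = - c3" using c by auto
  have "stp (- (-1)) c4 v0 = v4" unfolding v(5) by (rule stp_inv[OF V(3)]) simp
  then have "c4 \<noteq> c0" using v(1) ne(2) by auto
  then have c0: "c3 = c0" using c c3 by auto
  have "run [(1, c0), (1, c1), (1, c2), (1, c3), (-1, c4)] v0 = v0" by (simp only: run_simps v[symmetric])
  then have "closed_word 3 r q [(1, c0), (1, c1), (1, c2), (1, c3), (-1, c4)]" using run_closed_iff[OF V(1)] by blast
  then have "int r dvd 3 * c0 + c1 * q + c2 * q ^ 2" unfolding c3 c0 by (simp add: closed_word_def p_values algebra_simps)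
  then have "int r dvd c0 * (3 * c0 + c1 * q + c2 * q ^ 2)" by simp
  moreover have "c0 * (3 * c0 + c1 * q + c2 * q ^ 2) = 3 * (c0 * c0) + (c0 * c1) * q + (c0 * c2) * q ^ 2" by algebra
  moreover have "c0 * c0 = 1" using c by auto
  ultimately have "int r dvd 3 + (c0 * c1) * q + (c0 * c2) * q ^ 2" by simp
  moreover have "c0 * c1 \<in> sgns" "c0 * c2 \<in> sgns" using c by auto
  ultimately show ?thesis using r_q_cases by blast
qed

lemma pentagon_normal_signed:
  assumes P: "pentagon v0 v1 v2 v3 v4" and c: "{c0, c1, c2, c3, c4} \<subseteq> sgns" and d: "d \<in> sgns"
    and v: "v1 = stp d c0 v0" "v2 = stp d c1 v1" "v3 = stp d c2 v2" "v4 = stp d c3 v3" "v0 = stp (- d) c4 v4"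
  shows "r = 9 \<and> (int r dvd q - 4 \<or> int r dvd q - 7)"
proof (cases "d = 1")
  case True
  show ?thesis by (rule pentagon_normal[OF P c]) (use v True in simp_all)
next
  case False
  then have d1: "d = -1" using d by simp
  have V: "v0 \<in> pverts \<Gamma>" "v1 \<in> pverts \<Gamma>" "v2 \<in> pverts \<Gamma>" "v3 \<in> pverts \<Gamma>" "v4 \<in> pverts \<Gamma>" using pentagon_verts[OF P] by auto
  have inv: "x = stp (- e) c' y" if "x \<in> pverts \<Gamma>" "y = stp e c' x" "e \<in> sgns" for x y e c'
    using stp_inv[OF that(1,3), of c'] that(2) by simp
  have f: "v3 = stp 1 c3 v4" using inv[OF V(4) v(4) d] d1 by simp
  have f2: "v2 = stp 1 c2 v3" using inv[OF V(3) v(3) d] d1 by simp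
  have f3: "v1 = stp 1 c1 v2" using inv[OF V(2) v(2) d] d1 by simp
  have f4: "v0 = stp 1 c0 v1" using inv[OF V(1) v(1) d] d1 by simp
  have f5: "v4 = stp (-1) c4 v0" using inv[OF V(5) v(5) sgns_neg[OF d]] d1 by simp
  show ?thesis by (rule pentagon_normal[OF pentagon_reverse[OF P] _ f f2 f3 f4 f5]) (use c in simp)
qed

text \<open>A sum of five signs divisible by 3 is 3 or -3, so exactly one step goes against the
  others; a rotation of the 5-cycle makes it the last one.\<close>

lemma pentagon_imp_Doyle_Holt:
  assumes P: "pentagon v0 v1 v2 v3 v4"
  shows "r = 9 \<and> (int r dvd q - 4 \<or> int r dvd q - 7)"
proof -
  from pentagon_word[OF P] obtain d0 c0 d1 c1 d2 c2 d3 c3 d4 c4 where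
    s: "{d0, c0, d1, c1, d2, c2, d3, c3, d4, c4} \<subseteq> sgns"
    and v: "v1 = stp d0 c0 v0" "v2 = stp d1 c1 v1" "v3 = stp d2 c2 v2" "v4 = stp d3 c3 v3" "v0 = stp d4 c4 v4"
    and cl: "closed_word 3 r q [(d0, c0), (d1, c1), (d2, c2), (d3, c3), (d4, c4)]" by metis
  have sd: "d0 \<in> sgns" "d1 \<in> sgns" "d2 \<in> sgns" "d3 \<in> sgns" "d4 \<in> sgns"
    and sc: "{c0, c1, c2, c3, c4} \<subseteq> sgns" using s by simp_all
  have "3 dvd d0 + d1 + d2 + d3 + d4" using cl by (simp add: closed_word_def add.assoc)
  then have "d0 = d1 \<and> d1 = d2 \<and> d2 = d3 \<and> d4 = - d0 \<or> d1 = d2 \<and> d2 = d3 \<and> d3 = d4 \<and> d0 = - d1 \<or>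
      d2 = d3 \<and> d3 = d4 \<and> d4 = d0 \<and> d1 = - d2 \<or> d3 = d4 \<and> d4 = d0 \<and> d0 = d1 \<and> d2 = - d3 \<or>
      d4 = d0 \<and> d0 = d1 \<and> d1 = d2 \<and> d3 = - d4"
    using sd by (elim insertE emptyE; simp)
  then consider "d1 = d0" "d2 = d0" "d3 = d0" "d4 = - d0" | "d2 = d1" "d3 = d1" "d4 = d1" "d0 = - d1" |
      "d3 = d2" "d4 = d2" "d0 = d2" "d1 = - d2" | "d4 = d3" "d0 = d3" "d1 = d3" "d2 = - d3" |
      "d0 = d4" "d1 = d4" "d2 = d4" "d3 = - d4" by metis
  then show ?thesis
  proof cases
    case 1
    show ?thesis by (rule pentagon_normal_signed[OF P sc sd(1) v[unfolded 1]])
  next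
    case 2
    show ?thesis
      by (rule pentagon_normal_signed[OF pentagon_rotate[OF P] _ sd(2) v(2,3,4,5,1)[unfolded 2]]) (use sc in simp)
  next
    case 3
    show ?thesis
      by (rule pentagon_normal_signed[OF pentagon_rotate[OF pentagon_rotate[OF P]] _ sd(3) v(3,4,5,1,2)[unfolded 3]]) (use sc in simp)
  next
    case 4
    show ?thesis
      by (rule pentagon_normal_signed[OF pentagon_rotate[OF pentagon_rotate[OF pentagon_rotate[OF P]]] _ sd(4) v(4,5,1,2,3)[unfolded 4]])
        (use sc in simp)
  next
    case 5
    show ?thesis
      by (rule pentagon_normal_signed[OF pentagon_rotate[OF pentagon_rotate[OF pentagon_rotate[OF pentagon_rotate[OF P]]]] _ sd(5)
            v(5,1,2,3,4)[unfolded 5]]) (use sc in simp)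
  qed
qed

end

context half_arc_graph
begin

section \<open>From girth 5 and tight attachment to three or five layers\<close>

lemma radius_ge_3:
  assumes g: "girth \<Gamma> = 5" shows "radius \<ge> 3"
proof -
  obtain v where "v \<in> pverts \<Gamma>" using verts_ne by blast
  then have "{w. (v, w) \<in> D} \<noteq> {}" using out2[of v] by force
  then obtain t h where t: "trail t h" using trail_exists by blast
  have "radius \<noteq> 2"
  proof
    assume r: "radius = 2"
    have "t 2 = t 0" using t_eq_iff[OF t, of 2 0] r by simp
    moreover have "t (1 + 1) = t 2" "t (0 + 1) = t 1" "h (0 + 1) = h 1" by simp_all
    ultimately have a: "(t 0, h 0) \<in> D" "(t 1, h 0) \<in> D" "(t 1, h 1) \<in> D" "(t 0, h 1) \<in> D" "t 0 \<noteq> t 1" "h 0 \<noteq> h 1"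
      using trailD(1,2,3,4)[OF t, of 0] trailD(1,2)[OF t, of 1] by metis+
    then have "(t 0, h 0) \<in> parcs \<Gamma>" "(h 0, t 1) \<in> parcs \<Gamma>" "(t 1, h 1) \<in> parcs \<Gamma>" "(h 1, t 0) \<in> parcs \<Gamma>"
      using D_total by auto
    from quadrangle_cycle[OF this a(5,6)] have "5 \<le> length [(t 0, h 0), (h 0, t 1), (t 1, h 1), (h 1, t 0)]"
      using g unfolding girth_eq_5_iff by blast
    then show False by simp
  qed
  then show ?thesis using radius_ge_2[OF t] by linarith
qed

lemma tight_labelling:
  assumes g: "girth \<Gamma> = 5" and tight: "tightly_attached \<Gamma> G"
  obtains m r q pt where "labelled_graph \<Gamma> m r q pt" "m = 3 \<or> m = 5"
    "\<And>i j c. c \<in> sgns \<Longrightarrow> (pt i j, pt (i + 1) (j + c * pw m q i)) \<in> D"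
proof -
  obtain v0 v1 v2 v3 v4 where P: "pentagon v0 v1 v2 v3 v4"
    using g cycle_pentagon unfolding girth_eq_5_iff by metis
  interpret T: tight_half_transitive "pverts \<Gamma>" D G
  proof
    show "range h = range t'" if t: "trail t h" "trail t' h'" "h 0 = t' 0" for t h t' h'
      by (rule tight_imp_range_eq[OF t]) (use tightly_attached_iff[OF t] tight in blast)
    show "3 \<le> radius" by (rule radius_ge_3[OF g])
  qed
  have pent_arcs: "(v0, v1) \<in> parcs \<Gamma>" "(v1, v2) \<in> parcs \<Gamma>" "(v2, v3) \<in> parcs \<Gamma>" "(v3, v4) \<in> parcs \<Gamma>" "(v4, v0) \<in> parcs \<Gamma>"
    using P unfolding pentagon_def by blast+
  \<comment> \<open>A proper 2-colouring cannot exist along a 5-cycle.\<close>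
  have nonbip: "\<exists>x y. (x, y) \<in> D \<and> (Q x \<longleftrightarrow> Q y)" for Q :: "'a \<Rightarrow> bool"
  proof (rule ccontr)
    assume "\<not> ?thesis"
    then have "Q x \<longleftrightarrow> \<not> Q y" if "(x, y) \<in> parcs \<Gamma>" for x y using that unfolding D_total by blast
    from this[OF pent_arcs(1)] this[OF pent_arcs(2)] this[OF pent_arcs(3)] this[OF pent_arcs(4)] this[OF pent_arcs(5)]
    show False by blast
  qed
  obtain m q P where m0: "m > 0" and r_odd: "odd radius"
    and q: "int radius dvd q ^ m - 1 \<or> int radius dvd q ^ m + 1"
    and P_eq: "\<And>i j i' j'. P i j = P i' j' \<longleftrightarrow> i mod m = i' mod m \<and> int radius dvd j - j'"
    and P_V: "\<And>i j. P i j \<in> pverts \<Gamma>" and P_surj: "\<And>v. v \<in> pverts \<Gamma> \<Longrightarrow> \<exists>i j. v = P i j"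
    and P_D: "\<And>i j w. (P i j, w) \<in> D \<longleftrightarrow> w = P (Suc i) (j + q ^ i) \<or> w = P (Suc i) (j - q ^ i)"
    using T.labelling[OF nonbip] by blast
  have layer: "\<exists>i' j' d. d \<in> sgns \<and> w = P i' j' \<and> int m dvd int i' - int i - d" if arc: "(P i j, w) \<in> parcs \<Gamma>" for i j w
  proof (cases "(P i j, w) \<in> D")
    case True
    then obtain j' where "w = P (Suc i) j'" using P_D by blast
    then show ?thesis by (intro exI[of _ "Suc i"] exI[of _ j'] exI[of _ 1]) simp
  next
    case False
    then have wD: "(w, P i j) \<in> D" using arc D_total by blast
    obtain i' j' where w: "w = P i' j'" using P_surj arc_verts[OF arc] by blast
    then obtain j'' where "P i j = P (Suc i') j''" using wD P_D by blast
    then have "i mod m = Suc i' mod m" using P_eq by blast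
    then have "int m dvd int i - int (Suc i')" by (metis mod_eq_dvd_iff of_nat_mod)
    then have "int m dvd int i' - int i - (-1)" by (metis (no_types, lifting) add.commute diff_diff_eq diff_minus_eq_add dvd_diff_commute of_nat_Suc)
    then show ?thesis using w by (intro exI[of _ i'] exI[of _ j'] exI[of _ "-1"]) simp
  qed
  \<comment> \<open>Around the 5-cycle the layer index changes by a sum of five signs, which is odd,
    at most 5 in absolute value and 0 modulo \<open>m\<close>.\<close>
  have m_dvd: "\<exists>d\<in>{1, 3, 5}. m dvd d"
  proof -
    obtain i0 j0 where 0: "v0 = P i0 j0" using P_surj arc_verts[OF pent_arcs(1)] by blast
    obtain i1 j1 d0 where 1: "d0 \<in> sgns" "v1 = P i1 j1" "int m dvd int i1 - int i0 - d0"
      using layer[OF pent_arcs(1)[unfolded 0]] by (elim exE conjE)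
    obtain i2 j2 d1 where 2: "d1 \<in> sgns" "v2 = P i2 j2" "int m dvd int i2 - int i1 - d1"
      using layer[OF pent_arcs(2)[unfolded 1(2)]] by (elim exE conjE)
    obtain i3 j3 d2 where 3: "d2 \<in> sgns" "v3 = P i3 j3" "int m dvd int i3 - int i2 - d2"
      using layer[OF pent_arcs(3)[unfolded 2(2)]] by (elim exE conjE)
    obtain i4 j4 d3 where 4: "d3 \<in> sgns" "v4 = P i4 j4" "int m dvd int i4 - int i3 - d3"
      using layer[OF pent_arcs(4)[unfolded 3(2)]] by (elim exE conjE)
    obtain i5 j5 d4 where 5: "d4 \<in> sgns" "v0 = P i5 j5" "int m dvd int i5 - int i4 - d4"
      using layer[OF pent_arcs(5)[unfolded 4(2)]] by (elim exE conjE)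
    have "i5 mod m = i0 mod m" using 0 5(2) P_eq by metis
    then have 6: "int m dvd int i5 - int i0" by (metis mod_eq_dvd_iff of_nat_mod)
    have "d0 + d1 + d2 + d3 + d4 = (int i5 - int i0) - (int i1 - int i0 - d0) - (int i2 - int i1 - d1) - (int i3 - int i2 - d2)
        - (int i4 - int i3 - d3) - (int i5 - int i4 - d4)" by simp
    then have sum: "int m dvd d0 + d1 + d2 + d3 + d4" using 1(3) 2(3) 3(3) 4(3) 5(3) 6 by (simp only: dvd_diff)
    have "\<bar>d0 + d1 + d2 + d3 + d4\<bar> \<in> {1, 3, 5}" using 1(1) 2(1) 3(1) 4(1) 5(1) by (elim insertE emptyE; simp)
    moreover have "int m dvd \<bar>d0 + d1 + d2 + d3 + d4\<bar>" using sum by simp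
    ultimately have "int m dvd 1 \<or> int m dvd 3 \<or> int m dvd 5" by (metis empty_iff insert_iff)
    then have "m dvd 1 \<or> m dvd 3 \<or> m dvd 5" by (metis of_nat_1 of_nat_dvd_iff of_nat_numeral)
    then show ?thesis by blast
  qed
  \<comment> \<open>With a single layer, \<open>D\<close> would contain arcs between
    \<open>P 0 0\<close> and \<open>P 0 1\<close> in both directions.\<close>
  have "m \<noteq> 1"
  proof
    assume m: "m = 1"
    have "P 1 0 = P 0 0" "P 2 0 = P 0 0" "P 1 1 = P 0 1" using P_eq m by simp_all
    moreover have "(P 0 0, P (Suc 0) (0 + q ^ 0)) \<in> D" "(P 0 1, P (Suc 0) (1 - q ^ 0)) \<in> D" using P_D by blast+
    ultimately have "(P 0 0, P 0 1) \<in> D" "(P 0 1, P 0 0) \<in> D" by simp_all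
    then show False using D_asym by blast
  qed
  moreover have "m \<le> 5" using m_dvd by (auto dest: dvd_imp_le)
  then have "m = 1 \<or> m = 2 \<or> m = 3 \<or> m = 4 \<or> m = 5" using m0 by linarith
  ultimately have m35: "m = 3 \<or> m = 5" using m_dvd by auto
  \<comment> \<open>For odd \<open>m\<close>, negating \<open>q\<close> turns
    \<open>q ^ m = - 1\<close> into 1. In odd layers it only swaps the two out-neighbours.\<close>
  define q0 where "q0 = (if int radius dvd q ^ m - 1 then q else - q)"
  have q0: "int radius dvd q0 ^ m - 1"
  proof (cases "int radius dvd q ^ m - 1")
    case False
    then have "int radius dvd - (q ^ m + 1)" using q by (simp only: dvd_minus_iff simp_thms)
    moreover have "q0 ^ m - 1 = - (q ^ m + 1)" using False m35 by (auto simp: q0_def)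
    ultimately show ?thesis by simp
  qed (simp add: q0_def)
  have pow: "q0 ^ i = q ^ i \<or> q0 ^ i = - (q ^ i)" for i by (cases "even i") (simp_all add: q0_def)
  define pt where "pt i j = P (nat (i mod int m)) j" for i j
  have D_iff: "(pt i j, w) \<in> D \<longleftrightarrow> (\<exists>c\<in>sgns. w = pt (i + 1) (j + c * pw m q0 i))" for i j w
  proof -
    define k where "k = nat (i mod int m)"
    have k: "int k = i mod int m" using m0 by (simp add: k_def)
    have "int (Suc k mod m) = (int k + 1) mod int m" by (simp only: of_nat_mod of_nat_Suc add.commute)
    also have "\<dots> = (i + 1) mod int m" unfolding k by (rule mod_add_left_eq)
    finally have "nat ((i + 1) mod int m) = Suc k mod m" by (metis nat_int)
    then have nxt: "pt (i + 1) x = P (Suc k) x" for x using P_eq[of "Suc k mod m" x "Suc k" x] by (simp add: pt_def)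
    have "(pt i j, w) \<in> D \<longleftrightarrow> w = P (Suc k) (j + q ^ k) \<or> w = P (Suc k) (j - q ^ k)" by (simp add: pt_def P_D k_def)
    also have "\<dots> \<longleftrightarrow> w = P (Suc k) (j + q0 ^ k) \<or> w = P (Suc k) (j - q0 ^ k)" using pow[of k] by auto
    finally show ?thesis unfolding nxt pw_def k_def[symmetric] by simp
  qed
  have "labelled_graph \<Gamma> m radius q0 pt"
  proof (rule labelled_graphI[OF connected_graph_axioms _ radius_ge_3[OF g] r_odd q0, where D = D])
    show "3 \<le> m" using m35 by auto
    show "pt i j = pt i' j' \<longleftrightarrow> int m dvd i - i' \<and> int radius dvd j - j'" for i j i' j'
    proof -
      have "nat (i mod int m) mod m = nat (i' mod int m) mod m \<longleftrightarrow> i mod int m = i' mod int m"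
        using m0 by (simp add: nat_less_iff eq_nat_nat_iff)
      then show ?thesis by (simp add: pt_def P_eq mod_eq_dvd_iff)
    qed
    show "pt i j \<in> pverts \<Gamma>" for i j by (simp add: pt_def P_V)
    show "\<exists>i j. v = pt i j" if v: "v \<in> pverts \<Gamma>" for v
    proof -
      obtain i j where "v = P i j" using P_surj[OF v] by blast
      then have "v = pt (int i) j" using P_eq[of i j "i mod m" j] by (simp add: pt_def nat_mod_as_int)
      then show ?thesis by blast
    qed
    show "u \<in> pverts \<Gamma>" if "(u, v) \<in> D" for u v using D_verts[OF that] by blast
    show "parcs \<Gamma> = D \<union> D\<inverse>" by (rule D_total)
    show "(pt i j, w) \<in> D \<longleftrightarrow> (\<exists>c\<in>sgns. w = pt (i + 1) (j + c * pw m q0 i))" for i j w by (rule D_iff)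
  qed
  then show ?thesis using that[of m radius q0 pt] m35 D_iff by blast
qed

end

section \<open>Directed and undirected 5-cycles\<close>

lemma directed_wrt_pentagon:
  "directed_wrt D [(v0, v1), (v1, v2), (v2, v3), (v3, v4), (v4, v0)] \<longleftrightarrow>
    ((v0, v1) \<in> D \<and> (v1, v2) \<in> D \<or> (v1, v0) \<in> D \<and> (v2, v1) \<in> D) \<and>
    ((v1, v2) \<in> D \<and> (v2, v3) \<in> D \<or> (v2, v1) \<in> D \<and> (v3, v2) \<in> D) \<and>
    ((v2, v3) \<in> D \<and> (v3, v4) \<in> D \<or> (v3, v2) \<in> D \<and> (v4, v3) \<in> D) \<and>
    ((v3, v4) \<in> D \<and> (v4, v0) \<in> D \<or> (v4, v3) \<in> D \<and> (v0, v4) \<in> D) \<and>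
    ((v4, v0) \<in> D \<and> (v0, v1) \<in> D \<or> (v0, v4) \<in> D \<and> (v1, v0) \<in> D)"
proof -
  have len: "length [(v0, v1), (v1, v2), (v2, v3), (v3, v4), (v4, v0)] = 5" by simp
  show ?thesis unfolding directed_wrt_def len all_less_5 Let_def by simp
qed

lemma (in labelled_graph) forward_eqI:
  assumes DF: "\<And>i j c. c \<in> sgns \<Longrightarrow> (pt i j, pt (i + 1) (j + c * pw m q i)) \<in> D"
    and D: "D \<subseteq> parcs \<Gamma>" and asym: "\<And>u v. (u, v) \<in> D \<Longrightarrow> (v, u) \<notin> D"
  shows "D = forward"
proof -
  have "forward \<subseteq> D"
  proof (rule subrelI)
    fix u v assume uv: "(u, v) \<in> forward"
    then have "u \<in> pverts \<Gamma>" unfolding forward_def by blast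
    then obtain i j where u: "u = pt i j" using pt_surj by blast
    then obtain c where "c \<in> sgns" "v = pt (i + 1) (j + c * pw m q i)" using uv forward_pt[of i j v] by blast
    then show "(u, v) \<in> D" using DF[of c i j] u by simp
  qed
  then show ?thesis using D asym unfolding parcs_forward by blast
qed

lemma (in labelled_5_cyclic) pentagons_directed:
  fixes p :: "('a \<times> 'a) list"
  assumes p: "graph_cycle \<Gamma> p" "length p = 5" and D: "D = forward \<or> D = forward\<inverse>"
  shows "directed_wrt D p"
proof -
  obtain v0 v1 v2 v3 v4 where P: "pentagon v0 v1 v2 v3 v4" and pl: "p = [(v0, v1), (v1, v2), (v2, v3), (v3, v4), (v4, v0)]"
    by (rule cycle_pentagon[OF p])
  have V: "v0 \<in> pverts \<Gamma>" "v1 \<in> pverts \<Gamma>" "v2 \<in> pverts \<Gamma>" "v3 \<in> pverts \<Gamma>" "v4 \<in> pverts \<Gamma>" using pentagon_verts[OF P] by auto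
  obtain d c where d: "d \<in> sgns" "c \<in> sgns"
    and v: "v1 = stp d c v0" "v2 = stp d c v1" "v3 = stp d c v2" "v4 = stp d c v3" "v0 = stp d c v4"
    using pentagon_steps[OF P] by blast
  have arc: "(if d = 1 then (x, y) else (y, x)) \<in> forward" if "x \<in> pverts \<Gamma>" "y = stp d c x" for x y
  proof (cases "d = 1")
    case True
    then show ?thesis using that d(2) unfolding forward_def by auto
  next
    case False
    then have "x = stp 1 c y" using stp_inv[OF that(1) d(1), of c] that(2) d(1) by auto
    moreover have "y \<in> pverts \<Gamma>" unfolding that(2) by (rule stp_V[OF that(1)])
    ultimately show ?thesis using False d(2) unfolding forward_def by auto
  qed
  note arcs = arc[OF V(1) v(1)] arc[OF V(2) v(2)] arc[OF V(3) v(3)] arc[OF V(4) v(4)] arc[OF V(5) v(5)]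
  show ?thesis
    unfolding pl directed_wrt_pentagon using arcs D by (cases "d = 1") auto
qed

lemma (in labelled_Doyle_Holt) undirected_pentagon: "has_undirected_5_cycle \<Gamma> (carrier (Aut \<Gamma>))"
proof -
  define v0 v1 v2 v3 v4 where defs: "v0 = pt 0 0" "v1 = stp 1 1 v0" "v2 = stp 1 1 v1" "v3 = stp 1 (-1) v2" "v4 = stp 1 1 v3"
  have V: "v0 \<in> pverts \<Gamma>" "v3 \<in> pverts \<Gamma>" using pt_V stp_V by (simp_all add: defs)
  have P: "pentagon v0 v1 v2 v3 v4" using relator_pentagon[OF V(1)] by (simp add: defs)
  have v0: "stp (-1) (-1) v4 = v0"
    using iffD2[OF run_closed_iff[OF V(1)] relator_closed[of 1]] by (simp add: defs)
  have v4: "v4 \<in> pverts \<Gamma>" unfolding defs(5) by (rule stp_V[OF V(2)])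
  \<comment> \<open>The last step of the relator goes down, so \<open>v4\<close> is the head of both
    arcs of the 5-cycle at it.\<close>
  have "v4 = stp 1 (-1) v0" using stp_inv[OF v4, of "-1" "-1"] v0 by simp
  then have "(v3, v4) \<in> forward" "(v0, v4) \<in> forward"
    using V defs(5) unfolding forward_def by blast+
  then have "\<not> directed_wrt forward [(v0, v1), (v1, v2), (v2, v3), (v3, v4), (v4, v0)]"
    using forward_asym unfolding directed_wrt_pentagon by blast
  moreover have "length [(v0, v1), (v1, v2), (v2, v3), (v3, v4), (v4, v0)] = 5" by simp
  ultimately show ?thesis
    unfolding has_undirected_5_cycle_def using forward_orientation pentagon_cycle[OF P] by blast
qed

text \<open>For five layers \<open>D\<close> is \<open>forward\<close>, and every 5-cycle is
  directed with respect to it and to its converse. Recording this for the given \<open>G\<close> is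
  what singles out the Doyle-Holt graph in the last claim of the theorem.\<close>

lemma tight_girth_5_classification:
  assumes G: "connected_graph \<Gamma>" and t: "tetravalent \<Gamma>" and g: "girth \<Gamma> = 5"
    and hat: "half_arc_transitive \<Gamma> G" and tight: "tightly_attached \<Gamma> G"
  shows "(\<exists>pt. labelled_Doyle_Holt \<Gamma> pt) \<or> (\<exists>r q pt. labelled_5_cyclic \<Gamma> r q pt) \<and> \<not> has_undirected_5_cycle \<Gamma> G"
proof -
  interpret connected_graph \<Gamma> by (rule G)
  obtain p where p: "graph_cycle \<Gamma> p" "length p = 5" using g unfolding girth_eq_5_iff by blast
  obtain v0 v1 v2 v3 v4 where P: "pentagon v0 v1 v2 v3 v4" by (rule cycle_pentagon[OF p])
  define D where "D = {map_prod g g (v0, v1) | g. g \<in> G}"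
  have "(v0, v1) \<in> parcs \<Gamma>" using P by (simp add: pentagon_def)
  then have D: "D \<in> induced_orientations \<Gamma> G" unfolding induced_orientations_def D_def by blast
  interpret half_arc_graph \<Gamma> G D by unfold_locales (fact t hat D)+
  obtain m r q pt where L: "labelled_graph \<Gamma> m r q pt" and m: "m = 3 \<or> m = 5"
    and DF: "\<And>i j c. c \<in> sgns \<Longrightarrow> (pt i j, pt (i + 1) (j + c * pw m q i)) \<in> D"
    using tight_labelling[OF g tight] by blast
  interpret L: labelled_graph \<Gamma> m r q pt by (rule L)
  have no4: "length p \<noteq> 4" if "graph_cycle \<Gamma> p" for p using g that unfolding girth_eq_5_iff by fastforce
  have q1: "\<not> int r dvd q - 1" by (rule L.no_quadrangle_imp[OF no4]) simp_all
  from m show ?thesis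
  proof
    assume m: "m = 3"
    interpret L3: labelled_3 \<Gamma> r q pt using L q1 unfolding m by (intro labelled_3.intro labelled_3_axioms.intro)
    have r: "r = 9" and "int r dvd q - 4 \<or> int r dvd q - 7" using L3.pentagon_imp_Doyle_Holt[OF P] by auto
    then show ?thesis
    proof (elim disjE)
      assume "int r dvd q - 4"
      then have "labelled_graph \<Gamma> 3 9 4 pt" using labelled_graph_cong[OF L] m r by simp
      then show ?thesis unfolding labelled_Doyle_Holt_def by blast
    next
      assume "int r dvd q - 7"
      then have "labelled_graph \<Gamma> 3 9 7 pt" using labelled_graph_cong[OF L] m r by simp
      then show ?thesis using Xo_3_9_7_relabel unfolding labelled_Doyle_Holt_def by blast
    qed
  next
    assume m: "m = 5"
    interpret L5: labelled_5 \<Gamma> r q pt using L q1 unfolding m by (intro labelled_5.intro labelled_5_axioms.intro)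
    have C: "labelled_5_cyclic \<Gamma> r q pt"
      by unfold_locales (use L5.pentagon_steps[OF P] in blast)
    have "D = labelled_graph.forward \<Gamma> m q pt" using D_total D_asym by (intro L.forward_eqI[OF DF]) blast+
    then have "D' = D \<or> D' = D\<inverse>" "D = labelled_graph.forward \<Gamma> 5 q pt" if "D' \<in> induced_orientations \<Gamma> G" for D'
      using orientations[OF that] m by auto
    then have "\<not> has_undirected_5_cycle \<Gamma> G"
      unfolding has_undirected_5_cycle_def using labelled_5_cyclic.pentagons_directed[OF C] by metis
    then show ?thesis using C by blast
  qed
qed

section \<open>The isomorphism conditions as existence of labellings\<close>

lemma graph_iso_Doyle_Holt_iff:
  assumes G: "connected_graph \<Gamma>"
  shows "graph_iso \<Gamma> Doyle_Holt \<longleftrightarrow> (\<exists>pt. labelled_Doyle_Holt \<Gamma> pt)"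
proof
  assume "graph_iso \<Gamma> Doyle_Holt"
  then obtain pt where "labelled_graph \<Gamma> 3 9 4 pt"
    using graph_iso_imp_labelled[OF G, of 3 9 4] by auto
  then show "\<exists>pt. labelled_Doyle_Holt \<Gamma> pt" unfolding labelled_Doyle_Holt_def by blast
next
  assume "\<exists>pt. labelled_Doyle_Holt \<Gamma> pt"
  then obtain pt where "labelled_graph \<Gamma> 3 9 4 pt" unfolding labelled_Doyle_Holt_def by blast
  then show "graph_iso \<Gamma> Doyle_Holt" by (rule labelled_graph.graph_iso_Xo)
qed

lemma graph_iso_Xo_5_iff:
  assumes G: "connected_graph \<Gamma>"
  shows "(\<exists>r q. 3 \<le> r \<and> odd r \<and> q \<in> {0..<int r} \<and> \<not> [q = 1] (mod int r) \<and> \<not> [q = - 1] (mod int r) \<and>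
      [1 + q + q ^ 2 + q ^ 3 + q ^ 4 = 0] (mod int r) \<and> graph_iso \<Gamma> (Xo 5 r q)) \<longleftrightarrow>
    (\<exists>r q pt. labelled_5_cyclic \<Gamma> r q pt)"
proof
  assume "\<exists>r q. 3 \<le> r \<and> odd r \<and> q \<in> {0..<int r} \<and> \<not> [q = 1] (mod int r) \<and> \<not> [q = - 1] (mod int r) \<and>
      [1 + q + q ^ 2 + q ^ 3 + q ^ 4 = 0] (mod int r) \<and> graph_iso \<Gamma> (Xo 5 r q)"
  then obtain r q where r: "3 \<le> r" "odd r" and q1: "\<not> int r dvd q - 1"
    and cyc: "int r dvd 1 + q + q ^ 2 + q ^ 3 + q ^ 4" and iso: "graph_iso \<Gamma> (Xo 5 r q)"
    by (auto simp: cong_iff_dvd_diff)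
  have "q ^ 5 - 1 = (q - 1) * (1 + q + q ^ 2 + q ^ 3 + q ^ 4)" by algebra
  then have "int r dvd q ^ 5 - 1" using cyc by simp
  from graph_iso_imp_labelled[OF G _ r this iso] obtain pt where "labelled_graph \<Gamma> 5 r q pt" by auto
  then have "labelled_5_cyclic \<Gamma> r q pt"
    using q1 cyc by (intro labelled_5_cyclic.intro labelled_5.intro labelled_5_axioms.intro labelled_5_cyclic_axioms.intro)
  then show "\<exists>r q pt. labelled_5_cyclic \<Gamma> r q pt" by blast
next
  assume "\<exists>r q pt. labelled_5_cyclic \<Gamma> r q pt"
  then obtain r q pt where L: "labelled_5_cyclic \<Gamma> r q pt" by blast
  interpret labelled_5_cyclic \<Gamma> r q pt by (rule L)
  define q' where "q' = q mod int r"
  have r0: "int r > 0" using r_ge_3 by simp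
  have qq': "int r dvd q - q'" by (simp add: q'_def mod_eq_dvd_iff[symmetric])
  have "[q' = q] (mod int r)" by (simp add: q'_def)
  then have c: "[1 + q' + q' ^ 2 + q' ^ 3 + q' ^ 4 = 1 + q + q ^ 2 + q ^ 3 + q ^ 4] (mod int r)"
    by (intro cong_add cong_pow cong_refl)
  then have cyc': "[1 + q' + q' ^ 2 + q' ^ 3 + q' ^ 4 = 0] (mod int r)"
    by (rule cong_trans) (use cyclotomic in \<open>simp only: cong_0_iff\<close>)
  have n1: "\<not> [q' = 1] (mod int r)" using q_ne_1 by (simp add: q'_def cong_iff_dvd_diff[symmetric])
  \<comment> \<open>At \<open>q' = -1\<close> the sum of the five powers is 1, which is not 0 modulo
    \<open>r\<close>.\<close>
  have n2: "\<not> [q' = - 1] (mod int r)"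
  proof
    assume "[q' = - 1] (mod int r)"
    then have "[1 + q' + q' ^ 2 + q' ^ 3 + q' ^ 4 = 1 + (- 1) + (- 1) ^ 2 + (- 1) ^ 3 + (- 1) ^ 4] (mod int r)"
      by (intro cong_add cong_pow cong_refl)
    then have "[1 = 0] (mod int r)" using cyc' by (simp add: cong_def)
    then show False using not_dvd_1 by (simp add: cong_iff_dvd_diff)
  qed
  have "graph_iso \<Gamma> (Xo 5 r q')"
    using labelled_graph.graph_iso_Xo[OF labelled_graph_cong[OF labelled_graph_axioms qq']] .
  then show "\<exists>r q. 3 \<le> r \<and> odd r \<and> q \<in> {0..<int r} \<and> \<not> [q = 1] (mod int r) \<and> \<not> [q = - 1] (mod int r) \<and>
      [1 + q + q ^ 2 + q ^ 3 + q ^ 4 = 0] (mod int r) \<and> graph_iso \<Gamma> (Xo 5 r q)"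
    using r_ge_3 r_odd n1 n2 cyc' r0 by (intro exI[of _ r] exI[of _ q'] conjI) (simp_all add: q'_def)
qed

theorem theorem4p1:
  fixes \<Gamma> :: "'a pair_pre_digraph"
  assumes "pair_graph \<Gamma>" and "Digraph_Component.connected (with_proj \<Gamma>)"
  shows
    "(tetravalent \<Gamma> \<and> girth \<Gamma> = 5 \<longrightarrow>
        ((\<exists>G. half_arc_transitive \<Gamma> G \<and> tightly_attached \<Gamma> G) \<longleftrightarrow>
           graph_iso \<Gamma> Doyle_Holt \<or>
           (\<exists>r q. 3 \<le> r \<and> odd r \<and> q \<in> {0..<int r} \<and>
              \<not> [q = 1] (mod int r) \<and> \<not> [q = - 1] (mod int r) \<and>
              [1 + q + q ^ 2 + q ^ 3 + q ^ 4 = 0] (mod int r) \<and>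
              graph_iso \<Gamma> (Xo 5 r q))) \<and>
        ((\<exists>G. half_arc_transitive \<Gamma> G \<and> tightly_attached \<Gamma> G) \<longrightarrow>
           half_arc_transitive \<Gamma> (carrier (Aut \<Gamma>)))) \<and>
     (tetravalent \<Gamma> \<and> girth \<Gamma> = 5 \<and>
        (\<exists>G. half_arc_transitive \<Gamma> G \<and> tightly_attached \<Gamma> G \<and> has_undirected_5_cycle \<Gamma> G)
      \<longleftrightarrow> graph_iso \<Gamma> Doyle_Holt)"
proof -
  have G: "connected_graph \<Gamma>" by (rule connected_graph.intro[OF assms])
  note DH = graph_iso_Doyle_Holt_iff[OF G] and X5 = graph_iso_Xo_5_iff[OF G]
  note classify = tight_girth_5_classification[OF G]
  \<comment> \<open>The full automorphism group serves twice: as the group whose existence is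
    asserted, and for the claim that the graph itself is half-arc-transitive.\<close>
  have rigid: "half_arc_transitive \<Gamma> (carrier (Aut \<Gamma>)) \<and> tightly_attached \<Gamma> (carrier (Aut \<Gamma>))"
    if "(\<exists>pt. labelled_Doyle_Holt \<Gamma> pt) \<or> (\<exists>r q pt. labelled_5_cyclic \<Gamma> r q pt)"
    using that
  proof (elim disjE exE)
    fix pt assume "labelled_Doyle_Holt \<Gamma> pt"
    then interpret labelled_Doyle_Holt \<Gamma> pt .
    show ?thesis using half_arc_transitive_Aut tightly_attached_Aut ..
  next
    fix r q pt assume "labelled_5_cyclic \<Gamma> r q pt"
    then interpret labelled_5_cyclic \<Gamma> r q pt .
    show ?thesis using half_arc_transitive_Aut tightly_attached_Aut ..
  qed
  have undirected: "tetravalent \<Gamma> \<and> girth \<Gamma> = 5 \<and> has_undirected_5_cycle \<Gamma> (carrier (Aut \<Gamma>))"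
    if ex: "\<exists>pt. labelled_Doyle_Holt \<Gamma> pt"
  proof -
    obtain pt where "labelled_Doyle_Holt \<Gamma> pt" using ex by blast
    then interpret labelled_Doyle_Holt \<Gamma> pt .
    show ?thesis using tetravalent_labelled girth_5 undirected_pentagon by blast
  qed
  show ?thesis unfolding DH X5 using classify rigid undirected by blast
qed

end
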